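(* Let $p\in(0,2]$, and let $(b,a)$ be a Pythagorean pair such that $\phi:=b/a\in H^p$. Let $f$ be a holomorphic function on $\mathbb{D}$ whose Taylor coefficients satisfy $$\sum_{m\ge0}m^{2/p-1}|\hat{f}(m)|^2<\infty.$$ (i) For all $m\in\mathbb{Z}$, we have $$\sum_{n\ge0}\bigl|\overline{\hat{\phi}(n)}\hat{f}(m+n)\bigr|<\infty.$$ (ii) If $$\sum_{m\ge0}\Bigl|\sum_{n\ge0}\overline{\hat{\phi}(n)}\hat{f}(m+n)\Bigr|^2<\infty,$$ then $f\in\mathcal{H}(b)$ and $$\|f\|_{\mathcal{H}(b)}^2=\sum_{m\ge0}|\hat{f}(m)|^2+\sum_{m\ge0}\Bigl|\sum_{n\ge0}\overline{\hat{\phi}(n)}\hat{f}(m+n)\Bigr|^2.$$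
   Context: $\mathbb{D}$ is the open unit disk, $\mathbb{T}$ the unit circle, and $H^p$ ($0<p\le\infty$) the Hardy spaces on $\mathbb{D}$. A Pythagorean pair is a pair $(b,a)$ of functions in $H^\infty$ such that $|b|^2+|a|^2=1$ a.e. on $\mathbb{T}$, $a$ is outer and $a(0)>0$. For $b\in H^\infty$ with $\|b\|_{H^\infty}\le1$, the de Branges--Rovnyak space $\mathcal{H}(b)$ is the Hilbert space of functions on $\mathbb{D}$ with reproducing kernel $(z,w)\mapsto (1-\overline{b(w)}b(z))/(1-\overline{w}z)$; it is contractively contained in $H^2$. For $f$ holomorphic on $\mathbb{D}$, $\hat{f}(n)$ denotes the $n$-th Taylor coefficient of $f$ at $0$ for $n\ge0$, with the convention $\hat{f}(j)=0$ for $j<0$. *)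

theory Defs
  imports "HOL-Complex_Analysis.Complex_Analysis" "HOL-Library.FuncSet"
begin

abbreviation unit_disk :: "complex set" where
  "unit_disk \<equiv> ball 0 1"

text \<open>The unit circle is parametrised by \<open>cis t\<close> with \<open>t\<close> in \<open>{0..2*pi}\<close>.\<close>

definition hardy_space :: "real \<Rightarrow> (complex \<Rightarrow> complex) set" where
  "hardy_space p = {f. f holomorphic_on unit_disk \<and>
     (\<exists>M. \<forall>r\<in>{0..<1}.
        1 / (2 * pi) * integral {0..2*pi} (\<lambda>t. cmod (f (of_real r * cis t)) powr p) \<le> M)}"

definition hardy_space_inf :: "(complex \<Rightarrow> complex) set" where
  "hardy_space_inf = {f. f holomorphic_on unit_disk \<and> bounded (f ` unit_disk)}"

definition has_radial_limit :: "(complex \<Rightarrow> complex) \<Rightarrow> complex \<Rightarrow> complex \<Rightarrow> bool" where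
  "has_radial_limit f \<zeta> w \<longleftrightarrow> ((\<lambda>r::real. f (of_real r * \<zeta>)) \<longlongrightarrow> w) (at_left 1)"

definition outer_function :: "(complex \<Rightarrow> complex) \<Rightarrow> bool" where
  "outer_function a \<longleftrightarrow> (\<exists>(c::complex) (k::real \<Rightarrow> real).
     cmod c = 1 \<and> (\<forall>t\<in>{0..2*pi}. k t > 0) \<and>
     (\<lambda>t. ln (k t)) absolutely_integrable_on {0..2*pi} \<and>
     (\<forall>z\<in>unit_disk. a z = c * exp (1 / (2 * pi) *
        integral {0..2*pi} (\<lambda>t. (cis t + z) / (cis t - z) * of_real (ln (k t))))))"

text \<open>By Fatou's theorem the radial limits below exist almost everywhere; they are the
  boundary values of \<open>b\<close> and \<open>a\<close>.\<close>

definition pythagorean_pair :: "(complex \<Rightarrow> complex) \<Rightarrow> (complex \<Rightarrow> complex) \<Rightarrow> bool" where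
  "pythagorean_pair b a \<longleftrightarrow>
     b \<in> hardy_space_inf \<and> a \<in> hardy_space_inf \<and>
     (AE t in lebesgue_on {0..2*pi}. \<exists>\<beta> \<alpha>.
        has_radial_limit b (cis t) \<beta> \<and> has_radial_limit a (cis t) \<alpha> \<and>
        (cmod \<beta>)\<^sup>2 + (cmod \<alpha>)\<^sup>2 = 1) \<and>
     outer_function a \<and> a 0 \<in> \<real> \<and> Re (a 0) > 0"

definition hnorm :: "(('x \<Rightarrow> complex) \<Rightarrow> ('x \<Rightarrow> complex) \<Rightarrow> complex) \<Rightarrow> ('x \<Rightarrow> complex) \<Rightarrow> real" where
  "hnorm ip f = sqrt (Re (ip f f))"

text \<open>Functions on \<open>X\<close> are represented by elements of \<open>extensional X\<close>, so that they are
  determined by their values on \<open>X\<close>; the inner product is linear in its first argument.\<close>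

locale hilbert_function_space =
  fixes X :: "'x set"
    and H :: "('x \<Rightarrow> complex) set"
    and ip :: "('x \<Rightarrow> complex) \<Rightarrow> ('x \<Rightarrow> complex) \<Rightarrow> complex"
  assumes functions_on: "H \<subseteq> extensional X"
    and zero_mem: "(\<lambda>x\<in>X. 0) \<in> H"
    and add_mem: "\<And>f g. f \<in> H \<Longrightarrow> g \<in> H \<Longrightarrow> (\<lambda>x\<in>X. f x + g x) \<in> H"
    and scale_mem: "\<And>c f. f \<in> H \<Longrightarrow> (\<lambda>x\<in>X. c * f x) \<in> H"
    and ip_add: "\<And>f g h. f \<in> H \<Longrightarrow> g \<in> H \<Longrightarrow> h \<in> H \<Longrightarrow>
      ip (\<lambda>x\<in>X. f x + g x) h = ip f h + ip g h"
    and ip_scale: "\<And>c f h. f \<in> H \<Longrightarrow> h \<in> H \<Longrightarrow> ip (\<lambda>x\<in>X. c * f x) h = c * ip f h"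
    and ip_commute: "\<And>f g. f \<in> H \<Longrightarrow> g \<in> H \<Longrightarrow> ip g f = cnj (ip f g)"
    and ip_nonneg: "\<And>f. f \<in> H \<Longrightarrow> Re (ip f f) \<ge> 0"
    and ip_definite: "\<And>f. f \<in> H \<Longrightarrow> ip f f = 0 \<Longrightarrow> f = (\<lambda>x\<in>X. 0)"
    and complete: "\<And>\<sigma>::nat \<Rightarrow> 'x \<Rightarrow> complex. (\<And>n. \<sigma> n \<in> H) \<Longrightarrow>
      (\<And>e. e > 0 \<Longrightarrow> \<exists>N. \<forall>m\<ge>N. \<forall>n\<ge>N. hnorm ip (\<lambda>x\<in>X. \<sigma> m x - \<sigma> n x) < e) \<Longrightarrow>
      \<exists>f\<in>H. (\<lambda>n. hnorm ip (\<lambda>x\<in>X. \<sigma> n x - f x)) \<longlonglongrightarrow> 0"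

locale reproducing_kernel_hilbert_space = hilbert_function_space X H ip
  for X :: "'x set" and K :: "'x \<Rightarrow> 'x \<Rightarrow> complex" and H ip +
  assumes kernel_mem: "\<And>w. w \<in> X \<Longrightarrow> (\<lambda>z\<in>X. K z w) \<in> H"
    and reproducing: "\<And>f w. f \<in> H \<Longrightarrow> w \<in> X \<Longrightarrow> f w = ip f (\<lambda>z\<in>X. K z w)"

text \<open>\<open>H\<close> with inner product \<open>ip\<close> is the de Branges--Rovnyak space of \<open>b\<close>. A Hilbert space of
  functions is determined by its reproducing kernel, and one exists for every positive definite
  kernel (Moore--Aronszajn), so for \<open>b\<close> in the unit ball of \<open>hardy_space_inf\<close> exactly one space
  qualifies (with \<open>ip\<close> unique on \<open>H\<close>).\<close>

definition is_de_branges_rovnyak_space ::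
  "(complex \<Rightarrow> complex) \<Rightarrow> (complex \<Rightarrow> complex) set \<Rightarrow>
   ((complex \<Rightarrow> complex) \<Rightarrow> (complex \<Rightarrow> complex) \<Rightarrow> complex) \<Rightarrow> bool" where
  "is_de_branges_rovnyak_space b H ip \<longleftrightarrow>
     reproducing_kernel_hilbert_space unit_disk
       (\<lambda>z w. (1 - cnj (b w) * b z) / (1 - cnj w * z)) H ip"

definition taylor_coeff :: "(complex \<Rightarrow> complex) \<Rightarrow> int \<Rightarrow> complex" where
  "taylor_coeff f j = (if j < 0 then 0 else (deriv ^^ nat j) f 0 / fact (nat j))"

end

theory Submission
  imports Defs
begin

text \<open>Write \<open>a = exp l\<close>, \<open>s = 2/p\<close> and \<open>g = a\<^bsup>-p/2\<^esup>\<close>. Since \<open>log |a|\<close> is the Poisson integral of an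
  integrable function, its restrictions to circles are uniformly integrable, so
  \<open>|a|\<^sup>2 + |b|\<^sup>2 = 1\<close> on the boundary gives \<open>log (|a|\<^sup>2 + |b|\<^sup>2) \<rightarrow> 0\<close> in the mean over circles; with
  Jensen's inequality, \<open>\<phi> \<in> H\<^sup>p\<close> then yields \<open>g \<in> H\<^sup>2\<close>. Because \<open>1/a = g\<^sup>s\<close> is zero-free, a
  Littlewood--Paley argument gives \<open>\<Sum> (n+1)\<^bsup>1-s\<^esup> |c\<^sub>n|\<^sup>2 < \<infinity>\<close> for the Taylor coefficients of \<open>1/a\<close>, and
  multiplication by the bounded function \<open>b\<close> preserves this, so it holds for \<open>\<phi>\<close>. This is dual to the
  condition on \<open>f\<close> and proves (i).

  For (ii) let \<open>f\<^sup>+\<close> be the sequence \<open>\<Sum>\<^sub>n cnj \<phi>\<^sub>n f\<^bsub>m+n\<^esub>\<close>. Approximating \<open>a\<close> by its dilations in the weighted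
  duality shows that the co-analytic Toeplitz operators with symbols \<open>a\<close> and \<open>b\<close> satisfy
  \<open>T\<^sub>a f\<^sup>+ = T\<^sub>b f\<close>. The pairs of square summable sequences with this property form a Hilbert space
  containing the kernels \<open>(K\<^sub>w, cnj (b w) a k\<^sub>w)\<close> of \<open>H(b)\<close>, which reproduce the first component.
  As \<open>T\<^sub>a\<close> is injective for outer \<open>a\<close>, the kernels span a dense subspace, so this space is \<open>H(b)\<close> with the
  norm \<open>\<parallel>f\<parallel>\<^sup>2 + \<parallel>f\<^sup>+\<parallel>\<^sup>2\<close>.\<close>

section \<open>Square summable sequences\<close>

text \<open>On the circle 1/|a|^2 = 1 + |\<phi>|^2, so |g|^2 = |a|^(-p) = (1 + |\<phi>|^2)^(p/2) is
  controlled by 1 + |\<phi>|^p; hence the exponent p/2 in g. Boundary values alone would not bound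
  the circle means of g, since a singular inner factor of a is invisible there; outerness of a
  excludes this, in the form of uniform integrability of log |a|. The coefficient estimate is made
  for 1/a because \<phi> may have zeros, while the power g^s needs a logarithm; b enters only as a
  bounded multiplier. In (ii) the function \<phi> may be unbounded, and the double series behind the
  operator identity for a, \<phi> and b need not converge absolutely. Replacing a(z) by a(r z) gives
  geometrically decaying coefficients, so the series can be rearranged; bounds uniform in r then
  allow a weak limit as r tends to 1. The same device in H^2 gives the injectivity for outer a. The
  space H(b) is given only through its kernel, so membership of f must come from approximating by
  kernels and completeness.\<close>

definition l2_seq :: "(nat \<Rightarrow> complex) \<Rightarrow> bool" where
  "l2_seq x \<longleftrightarrow> summable (\<lambda>n. (cmod (x n))\<^sup>2)"

definition energy :: "(nat \<Rightarrow> complex) \<Rightarrow> real" where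
  "energy x = (\<Sum>n. (cmod (x n))\<^sup>2)"

lemma energy_nonneg: "l2_seq x \<Longrightarrow> 0 \<le> energy x"
  unfolding l2_seq_def energy_def by (rule suminf_nonneg) auto

lemma l2_seq_bounded_partial:
  assumes "\<And>N. (\<Sum>n<N. (cmod (x n))\<^sup>2) \<le> C"
  shows "l2_seq x" "energy x \<le> C"
proof -
  show "l2_seq x"
    unfolding l2_seq_def using assms by (intro summableI_nonneg_bounded[where x=C]) auto
  then show "energy x \<le> C"
    unfolding l2_seq_def energy_def using assms by (intro suminf_le_const) auto
qed

lemma partial_le_energy:
  assumes "l2_seq x" "finite I"
  shows "(\<Sum>n\<in>I. (cmod (x n))\<^sup>2) \<le> energy x"
  using assms unfolding l2_seq_def energy_def by (intro sum_le_suminf) auto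

lemma l2_seq_cnj [simp]: "l2_seq (\<lambda>n. cnj (x n)) \<longleftrightarrow> l2_seq x"
  by (simp add: l2_seq_def)

lemma energy_cnj [simp]: "energy (\<lambda>n. cnj (x n)) = energy x"
  by (simp add: energy_def)

lemma norm_add_square_le: "(norm (x + y))\<^sup>2 \<le> 2 * (norm x)\<^sup>2 + 2 * (norm (y :: complex))\<^sup>2"
proof -
  have "(norm (x + y))\<^sup>2 \<le> (norm x + norm y)\<^sup>2"
    by (intro power_mono norm_triangle_ineq) auto
  also have "\<dots> \<le> 2 * (norm x)\<^sup>2 + 2 * (norm y)\<^sup>2"
    using sum_squares_bound[of "norm x" "norm y"] by (simp add: power2_sum)
  finally show ?thesis .
qed

lemma l2_seq_add:
  assumes "l2_seq x" "l2_seq y"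
  shows "l2_seq (\<lambda>n. x n + y n)"
    "energy (\<lambda>n. x n + y n) \<le> 2 * energy x + 2 * energy y"
proof -
  have s: "summable (\<lambda>n. 2 * (cmod (x n))\<^sup>2 + 2 * (cmod (y n))\<^sup>2)"
    using assms unfolding l2_seq_def by (intro summable_add summable_mult)
  show 1: "l2_seq (\<lambda>n. x n + y n)"
    unfolding l2_seq_def
    by (rule summable_comparison_test[OF _ s]) (auto simp: norm_add_square_le)
  have "energy (\<lambda>n. x n + y n) \<le> (\<Sum>n. 2 * (cmod (x n))\<^sup>2 + 2 * (cmod (y n))\<^sup>2)"
    unfolding energy_def
    by (rule suminf_le[OF norm_add_square_le 1[unfolded l2_seq_def] s])
  also have "\<dots> = 2 * energy x + 2 * energy y"
    unfolding energy_def using assms unfolding l2_seq_def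
    by (simp add: suminf_add suminf_mult summable_mult flip: suminf_mult)
  finally show "energy (\<lambda>n. x n + y n) \<le> 2 * energy x + 2 * energy y" .
qed

lemma l2_seq_scale:
  assumes "l2_seq x"
  shows "l2_seq (\<lambda>n. c * x n)" "energy (\<lambda>n. c * x n) = (cmod c)\<^sup>2 * energy x"
  using assms unfolding l2_seq_def energy_def
  by (simp_all add: norm_mult power_mult_distrib summable_mult suminf_mult)

lemma l2_seq_mono:
  assumes "l2_seq x" "\<And>n. cmod (y n) \<le> cmod (x n)"
  shows "l2_seq y" "energy y \<le> energy x"
proof -
  have le: "(cmod (y n))\<^sup>2 \<le> (cmod (x n))\<^sup>2" for n
    using assms(2) by (intro power_mono) auto
  show 1: "l2_seq y"
    unfolding l2_seq_def
    by (rule summable_comparison_test[OF _ assms(1)[unfolded l2_seq_def]]) (use le in auto)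
  show "energy y \<le> energy x"
    unfolding energy_def using le assms(1) 1 unfolding l2_seq_def by (intro suminf_le) auto
qed

lemma l2_seq_shift:
  assumes "l2_seq x"
  shows "l2_seq (\<lambda>n. x (m + n))" "energy (\<lambda>n. x (m + n)) \<le> energy x"
proof -
  show 1: "l2_seq (\<lambda>n. x (m + n))"
    using summable_ignore_initial_segment[of "\<lambda>n. (cmod (x n))\<^sup>2" m] assms
    by (simp add: l2_seq_def add.commute)
  show "energy (\<lambda>n. x (m + n)) \<le> energy x"
  proof (rule l2_seq_bounded_partial)
    fix N
    have "(\<Sum>n<N. (cmod (x (m + n)))\<^sup>2) = (\<Sum>n\<in>(+) m ` {..<N}. (cmod (x n))\<^sup>2)"
      by (subst sum.reindex) auto
    also have "\<dots> \<le> energy x"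
      by (rule partial_le_energy[OF assms]) auto
    finally show "(\<Sum>n<N. (cmod (x (m + n)))\<^sup>2) \<le> energy x" .
  qed
qed

lemma l2_Cauchy_Schwarz:
  assumes x: "l2_seq x" and y: "l2_seq y"
  shows "summable (\<lambda>n. cmod (x n * y n))"
    "(\<Sum>n. cmod (x n * y n)) \<le> sqrt (energy x) * sqrt (energy y)"
proof -
  have *: "(\<Sum>n<N. cmod (x n * y n)) \<le> sqrt (energy x) * sqrt (energy y)" for N
  proof -
    have "(\<Sum>n<N. cmod (x n * y n)) = (\<Sum>n<N. \<bar>cmod (x n)\<bar> * \<bar>cmod (y n)\<bar>)"
      by (simp add: norm_mult)
    also have "\<dots> \<le> L2_set (\<lambda>n. cmod (x n)) {..<N} * L2_set (\<lambda>n. cmod (y n)) {..<N}"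
      by (rule L2_set_mult_ineq)
    also have "\<dots> \<le> sqrt (energy x) * sqrt (energy y)"
      unfolding L2_set_def using partial_le_energy[OF x, of "{..<N}"] partial_le_energy[OF y, of "{..<N}"]
      by (intro mult_mono real_sqrt_le_mono) (auto intro!: sum_nonneg energy_nonneg x y)
    finally show ?thesis .
  qed
  show 1: "summable (\<lambda>n. cmod (x n * y n))"
    using * by (intro summableI_nonneg_bounded) auto
  show "(\<Sum>n. cmod (x n * y n)) \<le> sqrt (energy x) * sqrt (energy y)"
    by (rule suminf_le_const[OF 1 *])
qed

lemma l2_pairing_bound:
  assumes "l2_seq x" "l2_seq y"
  shows "summable (\<lambda>n. x n * y n)" "cmod (\<Sum>n. x n * y n) \<le> sqrt (energy x) * sqrt (energy y)"
proof -
  show "summable (\<lambda>n. x n * y n)"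
    by (rule summable_norm_cancel[OF l2_Cauchy_Schwarz(1)[OF assms]])
  have "cmod (\<Sum>n. x n * y n) \<le> (\<Sum>n. cmod (x n * y n))"
    by (rule summable_norm[OF l2_Cauchy_Schwarz(1)[OF assms]])
  with l2_Cauchy_Schwarz(2)[OF assms] show "cmod (\<Sum>n. x n * y n) \<le> sqrt (energy x) * sqrt (energy y)"
    by linarith
qed

lemma energy_tail_tendsto:
  assumes "l2_seq x"
  shows "(\<lambda>N. energy (\<lambda>n. x (N + n))) \<longlonglongrightarrow> 0"
  using suminf_exist_split2[OF assms[unfolded l2_seq_def]]
  by (simp add: energy_def add.commute)

text \<open>The tail of the fixed sequence \<open>F\<close> is small by Cauchy-Schwarz, and what
  remains is a finite sum; the bound for the limit is Fatou's lemma on partial sums. The later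
  limits of coefficient pairings rest on this.\<close>

lemma bounded_imp_weak_convergence:
  fixes U :: "'j \<Rightarrow> nat \<Rightarrow> complex"
  assumes F: "l2_seq F"
    and ev: "eventually (\<lambda>j. l2_seq (U j) \<and> energy (U j) \<le> C) \<F>"
    and lim: "\<And>n. ((\<lambda>j. U j n) \<longlongrightarrow> u n) \<F>" and nt: "\<F> \<noteq> bot"
  shows "l2_seq u" "energy u \<le> C" "((\<lambda>j. \<Sum>n. F n * U j n) \<longlongrightarrow> (\<Sum>n. F n * u n)) \<F>"
proof -
  have part: "(\<Sum>n<N. (cmod (u n))\<^sup>2) \<le> C" for N
  proof (rule tendsto_upperbound[OF _ _ nt])
    show "((\<lambda>j. \<Sum>n<N. (cmod (U j n))\<^sup>2) \<longlongrightarrow> (\<Sum>n<N. (cmod (u n))\<^sup>2)) \<F>"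
      by (intro tendsto_intros lim)
    show "eventually (\<lambda>j. (\<Sum>n<N. (cmod (U j n))\<^sup>2) \<le> C) \<F>"
      using ev by eventually_elim (auto intro: order_trans[OF partial_le_energy])
  qed
  show u: "l2_seq u" and uC: "energy u \<le> C"
    using l2_seq_bounded_partial[OF part] by auto
  show "((\<lambda>j. \<Sum>n. F n * U j n) \<longlongrightarrow> (\<Sum>n. F n * u n)) \<F>"
  proof (rule tendstoI)
    fix e :: real assume e: "e > 0"
    \<comment> \<open>The constant \<open>4 * C\<close> bounds the energy of \<open>U j - u\<close>:
      both terms have energy at most \<open>C\<close>, and \<open>l2_seq_add\<close> doubles
      each.\<close>
    have "(\<lambda>N. sqrt (energy (\<lambda>n. F (N + n))) * sqrt (4 * C)) \<longlonglongrightarrow> sqrt 0 * sqrt (4 * C)"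
      by (intro tendsto_intros energy_tail_tendsto F)
    then have "eventually (\<lambda>N. sqrt (energy (\<lambda>n. F (N + n))) * sqrt (4 * C) < e/2) sequentially"
      using e by (intro order_tendstoD) auto
    then obtain N where N: "sqrt (energy (\<lambda>n. F (N + n))) * sqrt (4 * C) < e/2"
      by (auto simp: eventually_sequentially)
    have "((\<lambda>j. \<Sum>n<N. cmod (F n * (U j n - u n))) \<longlongrightarrow> (\<Sum>n<N. cmod (F n * (u n - u n)))) \<F>"
      by (intro tendsto_intros lim)
    then have "eventually (\<lambda>j. (\<Sum>n<N. cmod (F n * (U j n - u n))) < e/2) \<F>"
      using e by (intro order_tendstoD) auto
    then show "eventually (\<lambda>j. dist (\<Sum>n. F n * U j n) (\<Sum>n. F n * u n) < e) \<F>"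
      using ev
    proof eventually_elim
      case (elim j)
      define D where "D = (\<lambda>n. U j n - u n)"
      have nu: "l2_seq (\<lambda>n. - u n)" "energy (\<lambda>n. - u n) \<le> C"
        using u uC by (auto simp: l2_seq_def energy_def)
      have D: "l2_seq D" "energy D \<le> 4 * C"
        using l2_seq_add[of "U j" "\<lambda>n. - u n"] elim nu by (auto simp: D_def)
      have Dt: "l2_seq (\<lambda>n. D (N + n))" "energy (\<lambda>n. D (N + n)) \<le> 4 * C"
        using l2_seq_shift[OF D(1)] D(2) by (auto intro: order_trans)
      have s: "summable (\<lambda>n. cmod (F n * D n))" by (rule l2_Cauchy_Schwarz(1)[OF F D(1)])
      have "(\<Sum>n. F n * U j n) - (\<Sum>n. F n * u n) = (\<Sum>n. F n * D n)"
        using suminf_diff[OF l2_pairing_bound(1)[OF F, of "U j"] l2_pairing_bound(1)[OF F u]] elim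
        by (simp add: D_def algebra_simps)
      then have "dist (\<Sum>n. F n * U j n) (\<Sum>n. F n * u n) = cmod (\<Sum>n. F n * D n)"
        by (simp add: dist_norm)
      also have "\<dots> \<le> (\<Sum>n. cmod (F n * D n))" by (rule summable_norm[OF s])
      also have "\<dots> = (\<Sum>n. cmod (F (n + N) * D (n + N))) + (\<Sum>n<N. cmod (F n * D n))"
        by (rule suminf_split_initial_segment[OF s])
      also have "(\<Sum>n. cmod (F (n + N) * D (n + N))) \<le>
          sqrt (energy (\<lambda>n. F (N + n))) * sqrt (energy (\<lambda>n. D (N + n)))"
        using l2_Cauchy_Schwarz(2)[OF l2_seq_shift(1)[OF F] Dt(1), of N] by (simp add: add.commute)
      also have "\<dots> \<le> sqrt (energy (\<lambda>n. F (N + n))) * sqrt (4 * C)"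
        using Dt(2) by (intro mult_left_mono real_sqrt_le_mono) (auto intro!: energy_nonneg l2_seq_shift F)
      finally show ?case using N elim(1) by (simp add: D_def)
    qed
  qed
qed

section \<open>Convolution and its pairing with a sequence\<close>

definition conv :: "(nat \<Rightarrow> complex) \<Rightarrow> (nat \<Rightarrow> complex) \<Rightarrow> nat \<Rightarrow> complex" where
  "conv a x n = (\<Sum>i\<le>n. a i * x (n - i))"

lemma cnj_conv: "cnj (conv a x n) = conv (\<lambda>i. cnj (a i)) (\<lambda>i. cnj (x i)) n"
  by (simp add: conv_def)

text \<open>Fubini for the double series over (k, l), summed by rows on one side and along the
  diagonals n = k + l on the other. The hypotheses are absolute convergence in iterated
  form.\<close>

lemma conv_pairing_sums:
  fixes a x f :: "nat \<Rightarrow> complex"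
  assumes s1: "\<And>k. summable (\<lambda>l. cmod (x l * f (k + l)))"
    and s2: "summable (\<lambda>k. cmod (a k) * (\<Sum>l. cmod (x l * f (k + l))))"
  shows "(\<lambda>n. conv a x n * f n) sums (\<Sum>k. a k * (\<Sum>l. x l * f (k + l)))"
proof -
  define h where "h = (\<lambda>(k,l). a k * (x l * f (k + l)))"
  define T where "T = (\<lambda>k. a k * (\<Sum>l. x l * f (k + l)))"
  have row: "summable (\<lambda>l. norm (h (k, l)))" for k
    using summable_mult[OF s1, of "cmod (a k)" k] by (simp add: h_def norm_mult)
  have rowsum: "(\<Sum>l. norm (h (k, l))) = cmod (a k) * (\<Sum>l. cmod (x l * f (k + l)))" for k
    using suminf_mult[OF s1, of "cmod (a k)" k] by (simp add: h_def norm_mult)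
  have row_on: "(\<lambda>l. norm (h (k, l))) summable_on UNIV" for k
    using row by (subst summable_on_UNIV_nonneg_real_iff) auto
  have "infsum (\<lambda>l. norm (h (k, l))) UNIV = (\<Sum>l. norm (h (k, l)))" for k
    using sums_nonneg_imp_has_sum[OF summable_sums[OF row]] by (intro infsumI) auto
  moreover have "(\<lambda>k. \<Sum>l. norm (h (k, l))) summable_on UNIV"
    using s2 row unfolding rowsum[symmetric]
    by (subst summable_on_UNIV_nonneg_real_iff) (auto intro!: suminf_nonneg)
  ultimately have "(\<lambda>z. norm (h z)) summable_on (UNIV \<times> UNIV)"
    using row_on by (subst Infinite_Sum.abs_summable_on_Sigma_iff) (auto simp: suminf_nonneg row)
  then have h_on: "h summable_on (UNIV \<times> UNIV)" by (rule abs_summable_summable)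
  define S where "S = infsum h (UNIV \<times> UNIV)"
  have hS: "(h has_sum S) (UNIV \<times> UNIV)" using h_on by (simp add: S_def)
  have "((\<lambda>l. h (k, l)) has_sum T k) UNIV" for k
  proof -
    have "(\<lambda>l. h (k, l)) sums T k"
      unfolding h_def T_def using summable_norm_cancel[OF s1[of k]]
      by (auto intro!: sums_mult summable_sums)
    with row show ?thesis by (rule norm_summable_imp_has_sum)
  qed
  from has_sum_Sigma'[OF hS this] have "(T has_sum S) UNIV" by auto
  then have T: "T sums S" by (rule has_sum_imp_sums)
  have "(h has_sum S) (UNIV \<times> UNIV) \<longleftrightarrow>
      ((\<lambda>(n,i). a i * x (n - i) * f n) has_sum S) (SIGMA n:UNIV. {..n})"
    by (rule has_sum_reindex_bij_witness[of _ "\<lambda>(n,i). (i, n - i)" "\<lambda>(k,l). (k + l, k)"])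
      (auto simp: h_def mult_ac)
  with hS have "((\<lambda>(n,i). a i * x (n - i) * f n) has_sum S) (SIGMA n:UNIV. {..n})" by simp
  moreover have "((\<lambda>i. case (n, i) of (n, i) \<Rightarrow> a i * x (n - i) * f n) has_sum (conv a x n * f n)) {..n}" for n
    by (auto simp: conv_def sum_distrib_right intro!: has_sum_finiteI)
  ultimately have "((\<lambda>n. conv a x n * f n) has_sum S) UNIV"
    by (rule has_sum_Sigma'[where b="\<lambda>n. conv a x n * f n"])
  then have "(\<lambda>n. conv a x n * f n) sums S" by (rule has_sum_imp_sums)
  with T show ?thesis by (simp add: sums_iff T_def)
qed

section \<open>The Hilbert space of square summable sequences\<close>

text \<open>A separate type lets the sequences, and their pairs, be instances of the inner product
  classes. Those classes have real scalars, so \<open>inner\<close> will be the real part of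
  \<open>pair\<close> and complex scalars are treated by hand.\<close>

typedef ell2 = "{x. l2_seq x}"
  by (rule exI[of _ "\<lambda>_. 0"]) (simp add: l2_seq_def)

setup_lifting type_definition_ell2

lemma l2_seq_Rep [simp]: "l2_seq (Rep_ell2 x)"
  using Rep_ell2 by auto

definition pair :: "(nat \<Rightarrow> complex) \<Rightarrow> (nat \<Rightarrow> complex) \<Rightarrow> complex" where
  "pair x y = (\<Sum>n. x n * cnj (y n))"

lemma pair_summable: "l2_seq x \<Longrightarrow> l2_seq y \<Longrightarrow> summable (\<lambda>n. x n * cnj (y n))"
  by (rule l2_pairing_bound) auto

lemma pair_bound:
  "l2_seq x \<Longrightarrow> l2_seq y \<Longrightarrow> cmod (pair x y) \<le> sqrt (energy x) * sqrt (energy y)"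
  using l2_pairing_bound(2)[of x "\<lambda>n. cnj (y n)"] by (simp add: pair_def)

lemma pair_add_left:
  "l2_seq x \<Longrightarrow> l2_seq y \<Longrightarrow> l2_seq z \<Longrightarrow>
    pair (\<lambda>n. x n + y n) z = pair x z + pair y z"
  unfolding pair_def by (simp add: suminf_add pair_summable ring_distribs)

lemma pair_scale_left:
  "l2_seq x \<Longrightarrow> l2_seq z \<Longrightarrow> pair (\<lambda>n. c * x n) z = c * pair x z"
  unfolding pair_def by (simp add: suminf_mult pair_summable mult.assoc)

lemma pair_commute: "l2_seq x \<Longrightarrow> l2_seq y \<Longrightarrow> pair y x = cnj (pair x y)"
proof -
  assume xy: "l2_seq x" "l2_seq y"
  have "(\<lambda>n. x n * cnj (y n)) sums pair x y"
    unfolding pair_def by (rule summable_sums[OF pair_summable[OF xy]])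
  then have "(\<lambda>n. cnj (x n * cnj (y n))) sums cnj (pair x y)"
    by (simp only: sums_cnj)
  then have "(\<lambda>n. y n * cnj (x n)) sums cnj (pair x y)"
    by (simp add: mult.commute)
  then show ?thesis unfolding pair_def by (rule sums_unique[symmetric])
qed

lemma pair_self: "l2_seq x \<Longrightarrow> pair x x = of_real (energy x)"
proof -
  have "x n * cnj (x n) = of_real ((cmod (x n))\<^sup>2)" for n
    by (rule complex_norm_square[symmetric])
  moreover assume "l2_seq x"
  ultimately show ?thesis
    unfolding pair_def energy_def l2_seq_def by (simp only: suminf_of_real)
qed

instantiation ell2 :: real_inner
begin

lift_definition zero_ell2 :: ell2 is "\<lambda>_. 0" by (simp add: l2_seq_def)
lift_definition plus_ell2 :: "ell2 \<Rightarrow> ell2 \<Rightarrow> ell2" is "\<lambda>x y n. x n + y n"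
  by (rule l2_seq_add)
lift_definition uminus_ell2 :: "ell2 \<Rightarrow> ell2" is "\<lambda>x n. - x n" by (simp add: l2_seq_def)
lift_definition minus_ell2 :: "ell2 \<Rightarrow> ell2 \<Rightarrow> ell2" is "\<lambda>x y n. x n - y n"
  subgoal for x y using l2_seq_add(1)[of x "\<lambda>n. - y n"] by (simp add: l2_seq_def)
  done
lift_definition scaleR_ell2 :: "real \<Rightarrow> ell2 \<Rightarrow> ell2" is "\<lambda>r x n. of_real r * x n"
  by (rule l2_seq_scale)
definition inner_ell2 :: "ell2 \<Rightarrow> ell2 \<Rightarrow> real" where
  "inner_ell2 x y = Re (pair (Rep_ell2 x) (Rep_ell2 y))"
definition norm_ell2 :: "ell2 \<Rightarrow> real" where "norm_ell2 x = sqrt (inner x x)"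
definition dist_ell2 :: "ell2 \<Rightarrow> ell2 \<Rightarrow> real" where "dist_ell2 x y = norm (x - y)"
definition sgn_ell2 :: "ell2 \<Rightarrow> ell2" where "sgn_ell2 x = inverse (norm x) *\<^sub>R x"
definition uniformity_ell2 :: "(ell2 \<times> ell2) filter" where
  "uniformity_ell2 = (INF e\<in>{0<..}. principal {(x, y). dist x y < e})"
definition open_ell2 :: "ell2 set \<Rightarrow> bool" where
  "open_ell2 U \<longleftrightarrow> (\<forall>x\<in>U. eventually (\<lambda>(x', y). x' = x \<longrightarrow> y \<in> U) uniformity)"

instance
proof
  fix x y z :: ell2 and r s :: real
  show "x + y + z = x + (y + z)" by transfer (simp add: add.assoc)
  show "x + y = y + x" by transfer (simp add: add.commute)
  show "0 + x = x" "- x + x = 0" "x - y = x + - y" by (transfer; simp)+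
  show "r *\<^sub>R (x + y) = r *\<^sub>R x + r *\<^sub>R y" by transfer (simp add: distrib_left)
  show "(r + s) *\<^sub>R x = r *\<^sub>R x + s *\<^sub>R x" by transfer (simp add: distrib_right)
  show "r *\<^sub>R s *\<^sub>R x = (r * s) *\<^sub>R x" by transfer (simp add: mult.assoc)
  show "1 *\<^sub>R x = x" by transfer simp
  show "inner x y = inner y x"
    unfolding inner_ell2_def by (subst pair_commute) auto
  show "inner (x + y) z = inner x z + inner y z"
    unfolding inner_ell2_def plus_ell2.rep_eq by (subst pair_add_left) auto
  show "inner (r *\<^sub>R x) y = r * inner x y"
    unfolding inner_ell2_def scaleR_ell2.rep_eq by (subst pair_scale_left) auto
  show "0 \<le> inner x x"
    unfolding inner_ell2_def by (simp add: pair_self energy_nonneg)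
  show "inner x x = 0 \<longleftrightarrow> x = 0"
  proof
    assume "inner x x = 0"
    then have "energy (Rep_ell2 x) = 0" by (simp add: inner_ell2_def pair_self)
    then have "(cmod (Rep_ell2 x n))\<^sup>2 \<le> 0" for n
      using partial_le_energy[of "Rep_ell2 x" "{n}"] by simp
    then have "\<forall>n. Rep_ell2 x n = 0" by simp
    then show "x = 0" by transfer auto
  next
    assume "x = 0"
    then show "inner x x = 0" by (simp add: inner_ell2_def zero_ell2.rep_eq pair_def)
  qed
qed (rule norm_ell2_def dist_ell2_def sgn_ell2_def uniformity_ell2_def open_ell2_def)+

end

lemma norm_ell2_energy: "(norm x)\<^sup>2 = energy (Rep_ell2 x)"
  by (simp add: power2_norm_eq_inner inner_ell2_def pair_self)

lemma norm_ell2_sqrt: "norm x = sqrt (energy (Rep_ell2 x))"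
  by (simp add: norm_ell2_energy[symmetric])

lemma norm_pair_le: "cmod (pair (Rep_ell2 x) (Rep_ell2 y)) \<le> norm x * norm y"
  using pair_bound[of "Rep_ell2 x" "Rep_ell2 y"] by (simp add: norm_ell2_sqrt)

lemma norm_component_le: "cmod (Rep_ell2 x n) \<le> norm x"
  unfolding norm_ell2_sqrt
  using partial_le_energy[of "Rep_ell2 x" "{n}"] by (intro real_le_rsqrt) auto

instance ell2 :: complete_space
proof
  fix X :: "nat \<Rightarrow> ell2" assume C: "Cauchy X"
  have "Cauchy (\<lambda>j. Rep_ell2 (X j) n)" for n
  proof (rule CauchyI)
    fix e :: real assume "e > 0"
    then obtain M where M: "\<forall>i\<ge>M. \<forall>j\<ge>M. norm (X i - X j) < e"
      using CauchyD[OF C] by blast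
    have "cmod (Rep_ell2 (X i) n - Rep_ell2 (X j) n) \<le> norm (X i - X j)" for i j
      using norm_component_le[of "X i - X j" n] by (simp add: minus_ell2.rep_eq)
    with M show "\<exists>M. \<forall>i\<ge>M. \<forall>j\<ge>M. cmod (Rep_ell2 (X i) n - Rep_ell2 (X j) n) < e"
      by (meson le_less_trans)
  qed
  then have "\<exists>l. (\<lambda>j. Rep_ell2 (X j) n) \<longlonglongrightarrow> l" for n
    by (simp add: Cauchy_convergent_iff convergent_def)
  then obtain l where l: "\<And>n. (\<lambda>j. Rep_ell2 (X j) n) \<longlonglongrightarrow> l n" by metis
  have tail: "l2_seq (\<lambda>n. Rep_ell2 (X i) n - l n) \<and> energy (\<lambda>n. Rep_ell2 (X i) n - l n) \<le> e\<^sup>2"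
    if M: "\<forall>i\<ge>M. \<forall>j\<ge>M. norm (X i - X j) < e" and i: "i \<ge> M" for i M e
  proof -
    have ev: "eventually (\<lambda>j. l2_seq (Rep_ell2 (X i - X j)) \<and> energy (Rep_ell2 (X i - X j)) \<le> e\<^sup>2) sequentially"
      using eventually_ge_at_top[of M]
    proof eventually_elim
      case (elim j)
      then have "norm (X i - X j) \<le> e" using M i by (auto intro: less_imp_le)
      then show ?case by (simp add: norm_ell2_energy[symmetric] power_mono)
    qed
    have "(\<lambda>j. Rep_ell2 (X i - X j) n) \<longlonglongrightarrow> Rep_ell2 (X i) n - l n" for n
      unfolding minus_ell2.rep_eq by (intro tendsto_intros l)
    \<comment> \<open>Only Fatou's lemma is wanted here: the test sequence is zero, and just the two
      bounds for the coordinatewise limit are extracted.\<close>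
    then show ?thesis
      using bounded_imp_weak_convergence(1,2)[of "\<lambda>_. 0", OF _ ev] by (simp add: l2_seq_def)
  qed
  obtain M where M: "\<forall>i\<ge>M. \<forall>j\<ge>M. norm (X i - X j) < 1"
    using CauchyD[OF C, of 1] by auto
  have "l2_seq (\<lambda>n. - (Rep_ell2 (X M) n - l n))"
    using tail[OF M, of M] by (simp add: l2_seq_def norm_minus_commute)
  from l2_seq_add(1)[OF l2_seq_Rep this, of "X M"]
  have "l2_seq l" by simp
  then have L: "Rep_ell2 (Abs_ell2 l) = l" by (simp add: Abs_ell2_inverse)
  have "X \<longlonglongrightarrow> Abs_ell2 l"
  proof (rule LIMSEQ_I)
    fix e :: real assume e: "e > 0"
    then obtain M where M: "\<forall>i\<ge>M. \<forall>j\<ge>M. norm (X i - X j) < e/2"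
      using CauchyD[OF C, of "e/2"] by auto
    have "norm (X i - Abs_ell2 l) \<le> e/2" if "i \<ge> M" for i
    proof -
      have "(norm (X i - Abs_ell2 l))\<^sup>2 \<le> (e/2)\<^sup>2"
        using tail[OF M that] by (simp add: norm_ell2_energy minus_ell2.rep_eq L)
      then show ?thesis by (rule power2_le_imp_le) (use e in auto)
    qed
    then show "\<exists>M. \<forall>i\<ge>M. norm (X i - Abs_ell2 l) < e" using e by (intro exI[of _ M]) force
  qed
  then show "convergent X" by (auto simp: convergent_def)
qed

section \<open>Orthogonal projection onto a closed subspace\<close>

lemma hilbert_projection:
  fixes S :: "'a :: {real_inner, complete_space} set"
  assumes S: "subspace S" "closed S"
  obtains s where "s \<in> S" "\<And>t. t \<in> S \<Longrightarrow> inner (x - s) t = 0"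
proof -
  define d where "d = (INF s\<in>S. (norm (x - s))\<^sup>2)"
  have bdd: "bdd_below ((\<lambda>s. (norm (x - s))\<^sup>2) ` S)" by (rule bdd_belowI[of _ 0]) auto
  have ne: "S \<noteq> {}" using subspace_0[OF S(1)] by auto
  have d_le: "d \<le> (norm (x - s))\<^sup>2" if "s \<in> S" for s
    unfolding d_def by (rule cINF_lower[OF bdd that])
  have "\<exists>s\<in>S. (norm (x - s))\<^sup>2 < d + 1 / Suc n" for n
  proof -
    have "d < d + 1 / Suc n" by simp
    then show ?thesis unfolding d_def using cINF_less_iff[OF ne bdd] by blast
  qed
  then obtain s where s: "\<And>n. s n \<in> S" "\<And>n. (norm (x - s n))\<^sup>2 < d + 1 / Suc n" by metis
  have par: "(norm (s m - s n))\<^sup>2 \<le> 2 / Suc m + 2 / Suc n" for m n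
  proof -
    have mid: "(1/2) *\<^sub>R (s m + s n) \<in> S" using S s by (auto intro: subspace_scale subspace_add)
    \<comment> \<open>The parallelogram law for \<open>x - s m\<close> and \<open>x - s n\<close>.
      The midpoint lies in \<open>S\<close>, so the subtracted term is at least
      \<open>4 * d\<close>, which makes the minimizing sequence Cauchy.\<close>
    have "(norm (s m - s n))\<^sup>2 = 2 * (norm (x - s m))\<^sup>2 + 2 * (norm (x - s n))\<^sup>2
        - 4 * (norm (x - (1/2) *\<^sub>R (s m + s n)))\<^sup>2"
      unfolding power2_norm_eq_inner
      by (simp add: inner_diff_left inner_diff_right inner_add_left inner_add_right inner_commute algebra_simps)
    with d_le[OF mid] s(2)[of m] s(2)[of n] show ?thesis by linarith
  qed
  have "Cauchy s"
  proof (rule CauchyI)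
    fix e :: real assume e: "e > 0"
    then obtain N where N: "4 / e\<^sup>2 < real (Suc N)"
      by (meson reals_Archimedean2 less_trans lessI of_nat_less_iff)
    have "norm (s m - s n) < e" if "m \<ge> N" "n \<ge> N" for m n
    proof -
      have "2 / real (Suc m) + 2 / real (Suc n) \<le> 2 / real (Suc N) + 2 / real (Suc N)"
        using that by (intro add_mono divide_left_mono) auto
      also have "\<dots> = 4 / real (Suc N)" by simp
      also have "\<dots> < e\<^sup>2" using N e by (simp add: field_simps)
      finally have "(norm (s m - s n))\<^sup>2 < e\<^sup>2" using par[of m n] by linarith
      then show ?thesis by (rule power2_less_imp_less) (use e in auto)
    qed
    then show "\<exists>M. \<forall>m\<ge>M. \<forall>n\<ge>M. norm (s m - s n) < e" by blast
  qed
  then obtain l where l: "s \<longlonglongrightarrow> l" by (auto simp: Cauchy_convergent_iff convergent_def)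
  have lS: "l \<in> S" using closed_sequentially[OF S(2) s(1) l] .
  have "(norm (x - l))\<^sup>2 \<le> d + 0"
  proof (rule LIMSEQ_le)
    show "(\<lambda>n. (norm (x - s n))\<^sup>2) \<longlonglongrightarrow> (norm (x - l))\<^sup>2" by (intro tendsto_intros l)
    show "(\<lambda>n. d + 1 / real (Suc n)) \<longlonglongrightarrow> d + 0"
      by (intro tendsto_intros LIMSEQ_Suc lim_1_over_n)
    show "\<exists>N. \<forall>n\<ge>N. (norm (x - s n))\<^sup>2 \<le> d + 1 / real (Suc n)"
      using s(2) by (auto intro: less_imp_le)
  qed
  then have min: "(norm (x - l))\<^sup>2 \<le> (norm (x - t))\<^sup>2" if "t \<in> S" for t
    using d_le[OF that] by linarith
  have "inner (x - l) t = 0" if t: "t \<in> S" for t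
  proof (cases "t = 0")
    case False
    \<comment> \<open>With this \<open>c\<close> the vector \<open>c *\<^sub>R t\<close> is the
      projection of \<open>x - l\<close> onto the line through \<open>t\<close>; the resulting gain
      in squared distance must vanish by minimality of \<open>l\<close>.\<close>
    define c where "c = inner (x - l) t / (norm t)\<^sup>2"
    have nt: "(norm t)\<^sup>2 > 0" using False by simp
    have "l + c *\<^sub>R t \<in> S" using S t lS by (auto intro: subspace_scale subspace_add)
    from min[OF this] have "(norm (x - l))\<^sup>2 \<le> (norm ((x - l) - c *\<^sub>R t))\<^sup>2"
      by (simp add: algebra_simps)
    also have "\<dots> = (norm (x - l))\<^sup>2 - 2 * c * inner (x - l) t + c\<^sup>2 * (norm t)\<^sup>2"
      unfolding power2_norm_eq_inner
      by (simp add: inner_diff_left inner_diff_right inner_commute algebra_simps power2_eq_square)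
    also have "\<dots> = (norm (x - l))\<^sup>2 - (inner (x - l) t)\<^sup>2 / (norm t)\<^sup>2"
      using nt by (simp add: c_def field_simps power2_eq_square)
    finally have "(inner (x - l) t)\<^sup>2 / (norm t)\<^sup>2 \<le> 0" by simp
    with nt have "(inner (x - l) t)\<^sup>2 \<le> 0"
      by (simp add: divide_le_0_iff)
    then show ?thesis by simp
  qed auto
  with lS show thesis by (rule that)
qed

section \<open>Fourier series on circles and the Poisson kernel\<close>

abbreviation tc :: "(complex \<Rightarrow> complex) \<Rightarrow> nat \<Rightarrow> complex" where
  "tc u n \<equiv> fps_nth (fps_expansion u 0) n"

text \<open>Arc length, not normalized: the total mass is 2 pi, whence the factors
  \<open>2 * pi\<close> in the integral formulas.\<close>

definition circ :: "real measure" where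
  "circ = lebesgue_on {0..2*pi}"

lemma space_circ [simp]: "space circ = {0..2*pi}"
  by (simp add: circ_def)

lemma taylor_coeff_int: "taylor_coeff u (int n) = tc u n"
  by (simp add: taylor_coeff_def fps_expansion_def)

lemma holomorphic_has_fps_expansion:
  "u holomorphic_on unit_disk \<Longrightarrow> u has_fps_expansion fps_expansion u 0"
  by (rule has_fps_expansion_fps_expansion[of unit_disk]) auto

lemma tc_sums:
  assumes "u holomorphic_on unit_disk" "cmod z < 1"
  shows "(\<lambda>n. tc u n * z ^ n) sums u z"
  using holomorphic_power_series[OF assms(1), of z] assms(2) by (simp add: fps_expansion_def)

lemma tc_abs_summable:
  assumes "u holomorphic_on unit_disk" "0 \<le> r" "r < 1"
  shows "summable (\<lambda>n. cmod (tc u n) * r ^ n)"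
proof -
  have "summable (\<lambda>n. tc u n * of_real ((1 + r) / 2) ^ n)"
    by (intro sums_summable[OF tc_sums] assms) (use assms in \<open>simp only: norm_of_real, simp\<close>)
  moreover have "cmod (complex_of_real r) < cmod (complex_of_real ((1 + r) / 2))"
    unfolding norm_of_real using assms by simp
  ultimately have "summable (\<lambda>n. norm (tc u n * of_real r ^ n))"
    by (rule powser_insidea)
  then show ?thesis
    using assms by (simp add: norm_mult norm_power)
qed

lemma tc_eqI:
  assumes "\<And>z. cmod z < 1 \<Longrightarrow> (\<lambda>n. c n * z ^ n) sums u z"
  shows "tc u n = c n"
proof -
  have "eventually (\<lambda>z. z \<in> unit_disk) (nhds (0 :: complex))"
    by (rule eventually_nhds_in_open) auto
  then have "u has_fps_expansion Abs_fps c"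
    by (intro has_fps_expansionI) (auto elim!: eventually_mono simp: assms)
  then show ?thesis by (simp add: fps_expansion_eqI)
qed

lemma tc_mult:
  assumes "u holomorphic_on unit_disk" "v holomorphic_on unit_disk"
  shows "tc (\<lambda>z. u z * v z) n = conv (tc u) (tc v) n"
  using has_fps_expansion_mult[OF assms[THEN holomorphic_has_fps_expansion]]
  by (simp add: fps_expansion_eqI fps_mult_nth conv_def atLeast0AtMost)

lemma tc_dilate:
  assumes "u holomorphic_on unit_disk" "0 \<le> r" "r \<le> 1"
  shows "tc (\<lambda>z. u (of_real r * z)) n = of_real r ^ n * tc u n"
proof (rule tc_eqI)
  fix z :: complex assume "cmod z < 1"
  then have "cmod (of_real r * z) < 1"
    using assms mult_left_le_one_le[of "cmod z" r] by (simp add: norm_mult)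
  from tc_sums[OF assms(1) this]
  show "(\<lambda>n. of_real r ^ n * tc u n * z ^ n) sums u (of_real r * z)"
    by (simp add: power_mult_distrib mult_ac)
qed

lemma dilate_holomorphic:
  assumes "u holomorphic_on unit_disk" "0 \<le> r" "r \<le> 1"
  shows "(\<lambda>z. u (of_real r * z)) holomorphic_on unit_disk"
proof -
  have "(u \<circ> (\<lambda>z. of_real r * z)) holomorphic_on unit_disk"
  proof (rule holomorphic_on_compose_gen[OF _ assms(1)])
    show "(*) (complex_of_real r) ` unit_disk \<subseteq> unit_disk"
      using assms mult_left_le_one_le[of "cmod z" r for z]
      by (force simp: norm_mult intro: le_less_trans)
  qed (intro holomorphic_intros)
  then show ?thesis by (simp add: o_def)
qed

lemma continuous_on_circle:
  assumes "u holomorphic_on unit_disk" "0 \<le> r" "r < 1"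
  shows "continuous_on A (\<lambda>t. u (of_real r * cis t))"
proof -
  have "continuous_on A (u \<circ> (\<lambda>t. of_real r * cis t))"
    by (intro continuous_on_compose continuous_intros
        continuous_on_subset[OF holomorphic_on_imp_continuous_on[OF assms(1)]])
      (use assms in \<open>auto simp: norm_mult\<close>)
  then show ?thesis by (simp add: o_def)
qed

section \<open>Fourier integrals over circles and Parseval's identity\<close>

abbreviation cint :: "(real \<Rightarrow> 'a :: {banach, second_countable_topology}) \<Rightarrow> 'a" where
  "cint \<equiv> integral\<^sup>L circ"

lemma circ_measure [simp]: "measure circ {0..2*pi} = 2 * pi" "finite_measure circ"
proof -
  show "finite_measure circ"
    unfolding circ_def by (intro finite_measureI) (simp add: emeasure_restrict_space)
  show "measure circ {0..2*pi} = 2 * pi" unfolding circ_def by (simp add: measure_restrict_space)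
qed

lemma integrable_circ_continuous:
  fixes f :: "real \<Rightarrow> 'b :: euclidean_space"
  shows "continuous_on {0..2*pi} f \<Longrightarrow> integrable circ f"
  unfolding circ_def by (rule continuous_imp_integrable_real)

lemmas circ_intros = integrable_circ_continuous continuous_intros

lemma circ_integral_eq:
  fixes f :: "real \<Rightarrow> 'b :: euclidean_space"
  shows "integrable circ f \<Longrightarrow> cint f = integral {0..2*pi} f"
  unfolding circ_def by (rule lebesgue_integral_eq_integral) auto

lemma circ_integral_cis:
  "cint (\<lambda>t. cis (of_int m * t)) = (if m = 0 then of_real (2 * pi) else 0)"
proof (cases "m = 0")
  case True
  then show ?thesis by (simp add: scaleR_conv_of_real circ_measure(1))
next
  case False
  define E where "E = (\<lambda>z. exp (\<i> * of_int m * z) / (\<i> * of_int m))"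
  have E: "E (of_real t) = cis (of_int m * t) / (\<i> * of_int m)" for t
    by (simp add: E_def cis_conv_exp mult.assoc)
  have "((\<lambda>t. cis (of_int m * t)) has_integral (E (of_real (2 * pi)) - E (of_real 0))) {0..2*pi}"
  proof (rule fundamental_theorem_of_calculus)
    fix t
    have "(E has_field_derivative exp (\<i> * of_int m * of_real t)) (at (of_real t))"
      unfolding E_def using False by (auto intro!: derivative_eq_intros)
    then have "((\<lambda>t. E (of_real t)) has_vector_derivative cis (of_int m * t)) (at t within {0..2*pi})"
      using has_vector_derivative_real_field[of E] by (simp add: cis_conv_exp mult.assoc)
    then show "((\<lambda>t. E (of_real t)) has_vector_derivative cis (of_int m * t)) (at t within {0..2*pi})" .
  qed simp
  moreover have "cis (of_int m * (2 * pi)) = 1"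
    using cis_multiple_2pi[of "of_int m"] by (simp add: mult.commute mult.left_commute)
  ultimately have "integral {0..2*pi} (\<lambda>t. cis (of_int m * t)) = 0"
    by (simp add: integral_unique E[of 0, simplified] E[of "2 * pi", simplified])
  moreover have "integrable circ (\<lambda>t. cis (of_int m * t))"
    by (intro circ_intros)
  ultimately show ?thesis using False by (simp add: circ_integral_eq)
qed

text \<open>Termwise integration, dominated by summability of \<open>d\<close> since the characters
  have modulus one. The integer frequencies \<open>j n\<close> are free, so the lemma serves power
  series as well as both halves of the Poisson kernel.\<close>

lemma circ_integral_series:
  fixes F :: "real \<Rightarrow> complex"
  assumes F: "integrable circ F" and d: "summable (\<lambda>n. cmod (d n))"
  shows "(\<lambda>n. d n * cint (\<lambda>t. F t * cis (of_int (j n) * t))) sums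
      cint (\<lambda>t. F t * (\<Sum>n. d n * cis (of_int (j n) * t)))"
    "integrable circ (\<lambda>t. F t * (\<Sum>n. d n * cis (of_int (j n) * t)))"
proof -
  have m [measurable]: "(\<lambda>t. cis (of_int k * t)) \<in> borel_measurable circ" for k
    by (intro borel_measurable_integrable circ_intros)
  have i: "integrable circ (\<lambda>t. F t * cis (of_int k * t))" for k
    by (rule Bochner_Integration.integrable_bound[OF F]) (use F in \<open>auto simp: norm_mult\<close>)
  define T where "T = (\<lambda>n t. d n * (F t * cis (of_int (j n) * t)))"
  have 1: "integrable circ (T n)" for n
    unfolding T_def by (intro integrable_mult_right i)
  have nT: "norm (T n t) = cmod (d n) * norm (F t)" for n t
    by (simp add: T_def norm_mult)
  have 2: "AE t in circ. summable (\<lambda>n. norm (T n t))"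
    unfolding nT by (intro AE_I2 summable_mult2 d)
  have 3: "summable (\<lambda>n. cint (\<lambda>t. norm (T n t)))"
    unfolding nT using d by (simp add: summable_mult2)
  have eq: "(\<Sum>n. T n t) = F t * (\<Sum>n. d n * cis (of_int (j n) * t))" for t
  proof -
    have "summable (\<lambda>n. d n * cis (of_int (j n) * t))"
      by (rule summable_norm_cancel) (simp add: norm_mult d)
    from suminf_mult[OF this, of "F t"] show ?thesis by (simp add: T_def mult_ac)
  qed
  show "(\<lambda>n. d n * cint (\<lambda>t. F t * cis (of_int (j n) * t))) sums
      cint (\<lambda>t. F t * (\<Sum>n. d n * cis (of_int (j n) * t)))"
    using sums_integral[OF 1 2 3] unfolding eq by (simp add: T_def)
  show "integrable circ (\<lambda>t. F t * (\<Sum>n. d n * cis (of_int (j n) * t)))"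
    using integrable_suminf[OF 1 2 3] unfolding eq .
qed

lemma circle_series:
  assumes "u holomorphic_on unit_disk" "0 \<le> r" "r < 1"
  shows "u (of_real r * cis t) = (\<Sum>n. (tc u n * of_real r ^ n) * cis (of_int (int n) * t))"
    "summable (\<lambda>n. cmod (tc u n * of_real r ^ n))"
proof -
  have "(\<lambda>n. tc u n * (of_real r * cis t) ^ n) sums u (of_real r * cis t)"
    by (rule tc_sums) (use assms in \<open>auto simp: norm_mult\<close>)
  then show "u (of_real r * cis t) = (\<Sum>n. (tc u n * of_real r ^ n) * cis (of_int (int n) * t))"
    by (simp add: power_mult_distrib Complex.DeMoivre mult.assoc sums_iff)
  show "summable (\<lambda>n. cmod (tc u n * of_real r ^ n))"
    using tc_abs_summable[OF assms] assms by (simp add: norm_mult norm_power)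
qed

lemma circ_integral_fourier:
  assumes "u holomorphic_on unit_disk" "0 \<le> r" "r < 1"
  shows "cint (\<lambda>t. u (of_real r * cis t) * cis (of_int (- m) * t)) =
    (if m \<ge> 0 then of_real (2 * pi) * tc u (nat m) * of_real r ^ nat m else 0)"
proof -
  define d where "d = (\<lambda>n. tc u n * of_real r ^ n)"
  let ?S = "\<lambda>n. d n * (if int n - m = 0 then of_real (2 * pi) else 0)"
  have F: "integrable circ (\<lambda>t. cis (of_int (- m) * t))"
    by (intro circ_intros)
  have "(\<lambda>n. d n * cint (\<lambda>t. cis (of_int (- m) * t) * cis (of_int (int n) * t))) sums
      cint (\<lambda>t. cis (of_int (- m) * t) * (\<Sum>n. d n * cis (of_int (int n) * t)))"
    by (rule circ_integral_series[OF F]) (simp only: d_def circle_series(2)[OF assms])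
  moreover have "cis (of_int (- m) * t) * cis (of_int (int n) * t) = cis (of_int (int n - m) * t)" for n t
    by (simp add: cis_mult algebra_simps)
  ultimately have "(\<lambda>n. ?S n) sums
      cint (\<lambda>t. cis (of_int (- m) * t) * u (of_real r * cis t))"
    by (simp only: circ_integral_cis circle_series(1)[OF assms] d_def)
  moreover have "(\<lambda>n. ?S n) sums
      (if m \<ge> 0 then d (nat m) * of_real (2 * pi) else 0)"
  proof (cases "m \<ge> 0")
    case True
    have "(\<lambda>n. ?S n) =
        (\<lambda>n. if n = nat m then d n * of_real (2 * pi) else 0)"
      using True by (intro ext) auto
    then show ?thesis using True sums_single[of "nat m" "\<lambda>n. d n * of_real (2 * pi)"] by simp
  next
    case False
    then have "(\<lambda>n. ?S n) = (\<lambda>_. 0)"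
      by auto
    with False show ?thesis by simp
  qed
  ultimately have "cint (\<lambda>t. cis (of_int (- m) * t) * u (of_real r * cis t)) =
      (if m \<ge> 0 then d (nat m) * of_real (2 * pi) else 0)"
    by (rule sums_unique2)
  then show ?thesis by (simp add: d_def mult_ac)
qed

text \<open>The exponent \<open>2 * j + m\<close> collects \<open>r ^ j\<close> from
  \<open>u\<close> and \<open>r ^ (m + j)\<close> from \<open>v\<close>. Parseval is the case
  \<open>u = v\<close>, \<open>m = 0\<close>; as r tends to 1 the general series becomes a
  coefficient of a co-analytic Toeplitz operator.\<close>

lemma circ_integral_pairing:
  assumes u: "u holomorphic_on unit_disk" and v: "v holomorphic_on unit_disk" and r: "0 \<le> r" "r < 1"
  shows "(\<lambda>j. of_real (2 * pi) * (cnj (tc u j) * tc v (m + j) * of_real r ^ (2 * j + m))) sums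
    cint (\<lambda>t. cnj (u (of_real r * cis t)) * v (of_real r * cis t) * cis (- (of_nat m * t)))"
proof -
  let ?F = "\<lambda>t. cnj (u (of_real r * cis t)) * cis (- (of_nat m * t))"
  define d where "d = (\<lambda>n. tc v n * of_real r ^ n)"
  define c where "c = (\<lambda>n. if n \<ge> m then of_real (2 * pi) * (cnj (tc u (n - m)) * of_real r ^ (n - m)) else 0)"
  have conti: "continuous_on {0..2*pi} (\<lambda>t. ?F t)"
    by (intro continuous_intros continuous_on_circle u r)
  have F: "integrable circ (\<lambda>t. ?F t)"
    by (rule integrable_circ_continuous[OF conti])
  have "cint (\<lambda>t. ?F t * cis (of_int (int n) * t)) = c n" for n
  proof -
    have "(\<lambda>t. ?F t * cis (of_int (int n) * t)) =
        (\<lambda>t. cnj (u (of_real r * cis t) * cis (of_int (- (int n - int m)) * t)))"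
    proof
      fix t
      have "- (real m * t) + of_int (int n) * t = - (of_int (- (int n - int m)) * t)"
        by (simp add: algebra_simps)
      then have "cis (- (of_nat m * t)) * cis (of_int (int n) * t) = cnj (cis (of_int (- (int n - int m)) * t))"
        by (simp only: cis_mult cis_cnj)
      then show "?F t * cis (of_int (int n) * t) =
          cnj (u (of_real r * cis t) * cis (of_int (- (int n - int m)) * t))"
        by (simp only: mult.assoc complex_cnj_mult)
    qed
    moreover have "cint (\<lambda>t. cnj (u (of_real r * cis t) * cis (of_int (- (int n - int m)) * t))) =
        cnj (cint (\<lambda>t. u (of_real r * cis t) * cis (of_int (- (int n - int m)) * t)))"
      by (rule Bochner_Integration.integral_cnj)
    moreover have "nat (int n - int m) = n - m" by simp
    ultimately show ?thesis
      by (simp only: circ_integral_fourier[OF u r]) (simp add: c_def)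
  qed
  moreover have "(\<lambda>n. d n * cint (\<lambda>t. ?F t * cis (of_int (int n) * t))) sums
      cint (\<lambda>t. ?F t * (\<Sum>n. d n * cis (of_int (int n) * t)))"
    by (rule circ_integral_series[OF F]) (simp only: d_def circle_series(2)[OF v r])
  ultimately have "(\<lambda>n. d n * c n) sums
     cint (\<lambda>t. ?F t * v (of_real r * cis t))"
    by (simp only: circle_series(1)[OF v r] d_def)
  then have "(\<lambda>j. d (j + m) * c (j + m)) sums
     cint (\<lambda>t. ?F t * v (of_real r * cis t))"
    by (subst sums_zero_iff_shift) (auto simp: c_def)
  moreover have "(\<lambda>j. d (j + m) * c (j + m)) =
      (\<lambda>j. of_real (2 * pi) * (cnj (tc u j) * tc v (m + j) * of_real r ^ (2 * j + m)))"
  proof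
    fix j
    have "of_real r ^ (2 * j + m) = of_real r ^ (j + m) * (of_real r ^ j :: complex)"
      by (simp only: power_add[symmetric] mult_2 add_ac)
    then show "d (j + m) * c (j + m) =
        of_real (2 * pi) * (cnj (tc u j) * tc v (m + j) * of_real r ^ (2 * j + m))"
      by (simp add: d_def c_def add.commute[of m j])
  qed
  moreover have "(\<lambda>t. ?F t * v (of_real r * cis t)) =
      (\<lambda>t. cnj (u (of_real r * cis t)) * v (of_real r * cis t) * cis (- (of_nat m * t)))"
    by (intro ext) (simp only: mult_ac)
  ultimately show ?thesis by (simp only:)
qed

lemma parseval:
  assumes "u holomorphic_on unit_disk" and r: "0 \<le> r" "r < 1"
  shows "(\<lambda>n. 2 * pi * ((cmod (tc u n))\<^sup>2 * r ^ (2 * n))) sums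
    cint (\<lambda>t. (cmod (u (of_real r * cis t)))\<^sup>2)"
proof -
  have "(\<lambda>j. of_real (2 * pi) * (cnj (tc u j) * tc u (0 + j) * of_real r ^ (2 * j + 0))) sums
    cint (\<lambda>t. cnj (u (of_real r * cis t)) * u (of_real r * cis t) * cis (- (of_nat 0 * t)))"
    by (rule circ_integral_pairing[OF assms(1,1) r])
  moreover have sq: "cnj z * z = of_real ((cmod z)\<^sup>2)" for z
    by (subst complex_norm_square) (rule mult.commute)
  have "(\<lambda>j. of_real (2 * pi) * (cnj (tc u j) * tc u (0 + j) * of_real r ^ (2 * j + 0))) =
      (\<lambda>j. complex_of_real (2 * pi * ((cmod (tc u j))\<^sup>2 * r ^ (2 * j))))"
    by (intro ext) (simp only: add_0 add_0_right sq of_real_mult of_real_power)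
  moreover have "(\<lambda>t. cnj (u (of_real r * cis t)) * u (of_real r * cis t) * cis (- (of_nat 0 * t))) =
      (\<lambda>t. complex_of_real ((cmod (u (of_real r * cis t)))\<^sup>2))"
    by (intro ext) (simp only: sq of_nat_0 mult_zero_left minus_zero cis_zero mult_1_right)
  ultimately have "(\<lambda>j. complex_of_real (2 * pi * ((cmod (tc u j))\<^sup>2 * r ^ (2 * j)))) sums
    complex_of_real (cint (\<lambda>t. (cmod (u (of_real r * cis t)))\<^sup>2))"
    by (simp only: integral_complex_of_real)
  then show ?thesis by (simp only: sums_of_real_iff)
qed

lemma partial_sum_le_circ_mean:
  assumes "u holomorphic_on unit_disk" and r: "0 \<le> r" "r < 1"
  shows "2 * pi * (\<Sum>n<N. (cmod (tc u n))\<^sup>2 * r ^ (2 * n)) \<le> cint (\<lambda>t. (cmod (u (of_real r * cis t)))\<^sup>2)"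
proof -
  note P = parseval[OF assms]
  have "(\<Sum>n<N. 2 * pi * ((cmod (tc u n))\<^sup>2 * r ^ (2 * n))) \<le> (\<Sum>n. 2 * pi * ((cmod (tc u n))\<^sup>2 * r ^ (2 * n)))"
    by (rule sum_le_suminf[OF sums_summable[OF P]]) (use r in auto)
  then show ?thesis by (simp only: sums_unique[OF P] sum_distrib_left)
qed

text \<open>For finitely many terms the limit r to 1 is a limit of polynomials; the bound uniform in
  \<open>N\<close> then yields the whole series.\<close>

lemma abel_sums_bounded_imp_l2_seq:
  assumes "\<And>r N. 0 \<le> r \<Longrightarrow> r < 1 \<Longrightarrow> (\<Sum>n<N. (cmod (x n))\<^sup>2 * r ^ (2 * n)) \<le> C"
  shows "l2_seq x" "energy x \<le> C"
proof -
  have "(\<Sum>n<N. (cmod (x n))\<^sup>2) \<le> C" for N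
  proof (rule tendsto_upperbound)
    show "((\<lambda>r. \<Sum>n<N. (cmod (x n))\<^sup>2 * r ^ (2 * n)) \<longlongrightarrow> (\<Sum>n<N. (cmod (x n))\<^sup>2)) (at_left (1 :: real))"
      by (rule tendsto_eq_intros refl | simp)+
    have "eventually (\<lambda>r. r \<in> {0<..<1}) (at_left (1 :: real))"
      by (rule eventually_at_left_real) auto
    then show "eventually (\<lambda>r. (\<Sum>n<N. (cmod (x n))\<^sup>2 * r ^ (2 * n)) \<le> C) (at_left (1 :: real))"
      by eventually_elim (auto intro: assms)
  qed simp
  from l2_seq_bounded_partial[OF this] show "l2_seq x" "energy x \<le> C" by auto
qed

lemma circ_means_bounded_imp_l2_seq:
  assumes u: "u holomorphic_on unit_disk"
    and le: "\<And>r. 0 \<le> r \<Longrightarrow> r < 1 \<Longrightarrow> cint (\<lambda>t. (cmod (u (of_real r * cis t)))\<^sup>2) \<le> 2 * pi * C"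
  shows "l2_seq (tc u)" "energy (tc u) \<le> C"
proof -
  have "(\<Sum>n<N. (cmod (tc u n))\<^sup>2 * r ^ (2 * n)) \<le> C" if r: "0 \<le> r" "r < 1" for r N
  proof -
    have "2 * pi * (\<Sum>n<N. (cmod (tc u n))\<^sup>2 * r ^ (2 * n)) \<le> 2 * pi * C"
      by (rule order_trans[OF partial_sum_le_circ_mean[OF u r] le[OF r]])
    then show ?thesis by simp
  qed
  from abel_sums_bounded_imp_l2_seq[OF this]
  show "l2_seq (tc u)" "energy (tc u) \<le> C" by auto
qed

lemma bounded_imp_l2_seq:
  assumes u: "u holomorphic_on unit_disk" and le: "\<And>z. cmod z < 1 \<Longrightarrow> cmod (u z) \<le> B"
  shows "l2_seq (tc u)" "energy (tc u) \<le> B\<^sup>2"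
proof -
  have "cint (\<lambda>t. (cmod (u (of_real r * cis t)))\<^sup>2) \<le> 2 * pi * B\<^sup>2" if r: "0 \<le> r" "r < 1" for r
  proof -
    have "cint (\<lambda>t. (cmod (u (of_real r * cis t)))\<^sup>2) \<le> cint (\<lambda>t. B\<^sup>2)"
      by (intro integral_mono circ_intros continuous_on_circle u r)
        (use r in \<open>auto intro!: power_mono le simp: norm_mult\<close>)
    then show ?thesis by simp
  qed
  from circ_means_bounded_imp_l2_seq[OF u this]
  show "l2_seq (tc u)" "energy (tc u) \<le> B\<^sup>2" by auto
qed

section \<open>The Poisson kernel and its reproducing formula\<close>

definition poisson :: "complex \<Rightarrow> real \<Rightarrow> real" where
  "poisson z t = (1 - (cmod z)\<^sup>2) / (cmod (cis t - z))\<^sup>2"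

lemma norm_cis_diff_ge: "1 - cmod z \<le> cmod (cis t - z)"
  using norm_triangle_ineq2[of "cis t" z] by simp

lemma poisson_pos:
  assumes "cmod z < 1" shows "0 < poisson z t"
proof -
  have "(cmod z)\<^sup>2 < 1" using assms by (simp add: abs_square_less_1)
  moreover have "0 < cmod (cis t - z)" using norm_cis_diff_ge[of z t] assms by linarith
  ultimately show ?thesis unfolding poisson_def by (intro divide_pos_pos zero_less_power) auto
qed

lemma poisson_le:
  assumes "cmod z < 1" shows "poisson z t \<le> 2 / (1 - cmod z)"
proof -
  define c where "c = cmod z"
  have c: "0 \<le> c" "c < 1" using assms by (auto simp: c_def)
  have eq: "1 - c\<^sup>2 = (1 + c) * (1 - c)" by (simp add: power2_eq_square algebra_simps)
  have "(1 - c)\<^sup>2 \<le> (cmod (cis t - z))\<^sup>2"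
    using norm_cis_diff_ge[of z t] c by (intro power_mono) (auto simp: c_def)
  then have "poisson z t \<le> (1 - c\<^sup>2) / (1 - c)\<^sup>2"
    unfolding poisson_def c_def[symmetric] eq using c by (intro frac_le) auto
  also have "\<dots> = (1 + c) / (1 - c)"
    using c unfolding eq power2_eq_square[of "1 - c"] by simp
  also have "\<dots> \<le> 2 / (1 - c)" using c by (intro divide_right_mono) auto
  finally show ?thesis by (simp add: c_def)
qed

lemma poisson_continuous:
  assumes "cmod z < 1" shows "continuous_on A (poisson z)"
proof -
  have "cmod (cis t - z) \<noteq> 0" for t using norm_cis_diff_ge[of z t] assms by linarith
  then have "\<forall>t\<in>A. (cmod (cis t - z))\<^sup>2 \<noteq> 0" by simp
  then show ?thesis unfolding poisson_def by (intro continuous_intros)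
qed

text \<open>Both sides depend only on \<open>r\<close> and on the cosine of \<open>s - t\<close>.
  This symmetry lets \<open>poisson_mean\<close> integrate the kernel over its other
  variable.\<close>

lemma poisson_commute: "poisson (of_real r * cis s) t = poisson (of_real r * cis t) s"
proof -
  have "cmod (cis a - of_real r * cis b) = cmod (1 - of_real r * cis (b - a))" for a b
  proof -
    have "cis a - of_real r * cis b = cis a * (1 - of_real r * cis (b - a))"
      by (simp add: algebra_simps cis_mult)
    then show ?thesis by (simp add: norm_mult)
  qed
  moreover have "cmod (1 - of_real r * cis (s - t)) = cmod (1 - of_real r * cis (t - s))"
  proof -
    have "1 - of_real r * cis (s - t) = cnj (1 - of_real r * cis (t - s))"
      by (simp add: cis_cnj)
    then show ?thesis by (simp only: complex_mod_cnj)
  qed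
  ultimately show ?thesis by (simp add: poisson_def norm_mult)
qed

lemma poisson_Re: "cmod z < 1 \<Longrightarrow> Re ((cis t + z) / (cis t - z)) = poisson z t"
proof -
  have "Re ((cis t + z) / (cis t - z)) = Re ((cis t + z) * cnj (cis t - z)) / (cmod (cis t - z))\<^sup>2"
    by (subst complex_div_cnj) (simp only: Re_divide_of_real)
  also have "Re ((cis t + z) * cnj (cis t - z)) = 1 - (cmod z)\<^sup>2"
    proof -
    have "Re ((cis t + z) * cnj (cis t - z)) = (cos t)\<^sup>2 + (sin t)\<^sup>2 - ((Re z)\<^sup>2 + (Im z)\<^sup>2)"
      by (simp add: power2_eq_square algebra_simps)
    then show ?thesis by (simp only: cmod_power2 sin_cos_squared_add2)
  qed
  finally show ?thesis by (simp add: poisson_def)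
qed

lemma poisson_series:
  assumes z: "cmod z < 1"
  shows "of_real (poisson z t) = (\<Sum>n. z ^ n * cis (of_int (- int n) * t))
     + (\<Sum>n. cnj z ^ Suc n * cis (of_int (int (Suc n)) * t))"
proof -
  have "(\<lambda>n. (z * cis (- t)) ^ n) sums (1 / (1 - z * cis (- t)))"
    by (rule geometric_sums) (use z in \<open>simp add: norm_mult\<close>)
  then have 1: "(\<Sum>n. z ^ n * cis (of_int (- int n) * t)) = 1 / (1 - z * cis (- t))"
    by (simp add: power_mult_distrib Complex.DeMoivre sums_iff)
  have "(\<lambda>n. (cnj z * cis t) * (cnj z * cis t) ^ n) sums ((cnj z * cis t) * (1 / (1 - cnj z * cis t)))"
    by (intro sums_mult geometric_sums) (use z in \<open>simp add: norm_mult\<close>)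
  then have "(\<lambda>n. (cnj z * cis t) ^ Suc n) sums ((cnj z * cis t) * (1 / (1 - cnj z * cis t)))"
    by simp
  then have 2: "(\<Sum>n. cnj z ^ Suc n * cis (of_int (int (Suc n)) * t)) = cnj z * cis t / (1 - cnj z * cis t)"
    unfolding power_mult_distrib Complex.DeMoivre by (simp add: sums_iff)
  have nz: "1 - z * cis (- t) \<noteq> 0"
  proof
    assume "1 - z * cis (- t) = 0"
    then have "cmod (z * cis (- t)) = 1" by (metis eq_iff_diff_eq_0 norm_one)
    with z show False by (simp add: norm_mult)
  qed
  \<comment> \<open>With this \<open>w\<close> the two geometric series are 1/(1 - w) and cnj w/(1 -
    cnj w), whose sum is (1 - |w|^2)/|1 - w|^2; the rotation does not change the moduli.\<close>
  define w where "w = z * cis (- t)"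
  have w: "cnj z * cis t = cnj w" "cmod w = cmod z" "cmod (cis t - z) = cmod (1 - w)"
  proof -
    show "cnj z * cis t = cnj w" "cmod w = cmod z" by (simp_all add: w_def cis_cnj norm_mult)
    have "cis t - z = cis t * (1 - w)" by (simp add: w_def algebra_simps cis_mult)
    then show "cmod (cis t - z) = cmod (1 - w)" by (simp add: norm_mult)
  qed
  have nw: "1 - w \<noteq> 0" using nz by (simp add: w_def)
  then have nw': "1 - cnj w \<noteq> 0" by (metis complex_cnj_diff complex_cnj_one complex_cnj_zero_iff)
  have "1 / (1 - w) + cnj w / (1 - cnj w) = (1 - w * cnj w) / ((1 - w) * cnj (1 - w))"
    using nw nw' by (simp add: field_simps)
  also have "\<dots> = of_real (1 - (cmod w)\<^sup>2) / of_real ((cmod (1 - w))\<^sup>2)"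
    by (simp only: complex_norm_square[symmetric] of_real_diff of_real_1)
  finally show ?thesis unfolding 1 2 w(1) w_def[symmetric] poisson_def w(2)[symmetric] w(3)
    by (simp add: mult.commute)
qed

text \<open>Of the two halves of \<open>poisson_series\<close>, the one with frequencies
  \<open>- n\<close> picks up the Taylor coefficients, while the other pairs \<open>f\<close> with
  its vanishing negative Fourier coefficients.\<close>

lemma poisson_formula:
  assumes f: "f holomorphic_on unit_disk" and R: "0 \<le> R" "R < 1" and z: "cmod z < 1"
  shows "cint (\<lambda>t. f (of_real R * cis t) * of_real (poisson z t)) = of_real (2 * pi) * f (of_real R * z)"
proof -
  let ?P = "\<lambda>t. (\<Sum>n. z ^ n * cis (of_int (- int n) * t))"
  let ?Q = "\<lambda>t. (\<Sum>n. cnj z ^ Suc n * cis (of_int (int (Suc n)) * t))"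
  define F where "F = (\<lambda>t. f (of_real R * cis t))"
  have F: "integrable circ F"
    unfolding F_def by (intro integrable_circ_continuous continuous_on_circle f R)
  have d1: "summable (\<lambda>n. cmod (z ^ n))" and d2: "summable (\<lambda>n. cmod (cnj z ^ Suc n))"
    using summable_geometric[of "cmod z"] z summable_mult[of "\<lambda>n. cmod z ^ n" "cmod z"]
    by (simp_all add: norm_power norm_mult)
  have Rz: "cmod (of_real R * z) < 1"
    using R z mult_strict_mono[of R 1 "cmod z" 1] by (cases "z = 0") (auto simp: norm_mult)
  have "(\<lambda>n. z ^ n * cint (\<lambda>t. F t * cis (of_int (- int n) * t))) sums
      cint (\<lambda>t. F t * ?P t)"
    by (rule circ_integral_series[OF F d1])
  moreover have "(\<lambda>n. z ^ n * cint (\<lambda>t. F t * cis (of_int (- int n) * t))) =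
      (\<lambda>n. of_real (2 * pi) * (tc f n * (of_real R * z) ^ n))"
    unfolding F_def by (simp only: circ_integral_fourier[OF f R]) (auto simp: power_mult_distrib mult_ac)
  ultimately have 1: "cint (\<lambda>t. F t * ?P t) = of_real (2 * pi) * f (of_real R * z)"
    using sums_unique2[OF _ sums_mult[OF tc_sums[OF f Rz], of "of_real (2 * pi)"]] by (simp only:)
  have "(\<lambda>n. cnj z ^ Suc n * cint (\<lambda>t. F t * cis (of_int (int (Suc n)) * t))) sums
      cint (\<lambda>t. F t * ?Q t)"
    by (rule circ_integral_series[OF F d2])
  moreover have "cint (\<lambda>t. F t * cis (of_int (int (Suc n)) * t)) = 0" for n
    using circ_integral_fourier[OF f R, of "- int (Suc n)"] unfolding F_def minus_minus by simp
  ultimately have 2: "cint (\<lambda>t. F t * ?Q t) = 0"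
    using sums_unique2[OF _ sums_zero] by (simp only: mult_zero_right)
  have "cint (\<lambda>t. F t * of_real (poisson z t)) =
     cint (\<lambda>t. F t * ?P t
       + F t * ?Q t)"
    by (simp only: poisson_series[OF z] distrib_left)
  also have "\<dots> = of_real (2 * pi) * f (of_real R * z) + 0"
    unfolding 1[symmetric] 2[symmetric]
    by (intro Bochner_Integration.integral_add circ_integral_series(2)[OF F d1] circ_integral_series(2)[OF F d2])
  finally show ?thesis by (simp add: F_def)
qed

lemma poisson_integral:
  assumes "cmod z < 1" shows "cint (poisson z) = 2 * pi"
proof -
  have "complex_of_real (cint (poisson z)) = of_real (2 * pi)"
    using poisson_formula[of "\<lambda>_. 1" 0 z] assms by simp
  then show ?thesis by (simp only: of_real_eq_iff)
qed

lemma poisson_formula_Re: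
  assumes f: "f holomorphic_on unit_disk" and R: "0 \<le> R" "R < 1" and z: "cmod z < 1"
  shows "cint (\<lambda>t. poisson z t * Re (f (of_real R * cis t))) = 2 * pi * Re (f (of_real R * z))"
proof -
  have "integrable circ (\<lambda>t. f (of_real R * cis t) * of_real (poisson z t))"
    by (intro circ_intros continuous_on_circle f R
        poisson_continuous z)
  from integral_Re[OF this] show ?thesis
    unfolding poisson_formula[OF assms] by (simp add: mult.commute)
qed

section \<open>Integrability of negative powers of the outer function\<close>

lemma poisson_kernel_integrable:
  assumes "integrable circ \<psi>" "cmod z < 1"
  shows "integrable circ (\<lambda>t. poisson z t * \<psi> t)"
proof (rule Bochner_Integration.integrable_bound)
  show "integrable circ (\<lambda>t. 2 / (1 - cmod z) * \<psi> t)"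
    using assms by (intro integrable_mult_right) auto
  have [measurable]: "poisson z \<in> borel_measurable circ"
    by (intro borel_measurable_integrable integrable_circ_continuous poisson_continuous assms)
  have [measurable]: "\<psi> \<in> borel_measurable circ" using assms by auto
  show "(\<lambda>t. poisson z t * \<psi> t) \<in> borel_measurable circ" by measurable
  show "AE t in circ. norm (poisson z t * \<psi> t) \<le> norm (2 / (1 - cmod z) * \<psi> t)"
    using poisson_le[OF assms(2)] poisson_pos[OF assms(2)] assms(2)
    by (intro AE_I2) (simp add: abs_mult less_imp_le mult_right_mono del: times_divide_eq_left)
qed

text \<open>Fubini and the symmetry of the kernel: for fixed \<open>t\<close> the integral over
  \<open>s\<close> is the mass \<open>2 * pi\<close>. This converts pointwise Poisson bounds into
  bounds on circle means.\<close>

lemma poisson_mean: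
  assumes \<psi>: "integrable circ \<psi>" and r: "0 \<le> r" "r < 1"
  shows "integrable circ (\<lambda>s. cint (\<lambda>t. poisson (of_real r * cis s) t * \<psi> t))"
    "cint (\<lambda>s. cint (\<lambda>t. poisson (of_real r * cis s) t * \<psi> t)) = 2 * pi * cint \<psi>"
proof -
  interpret C: finite_measure circ by (rule circ_measure)
  interpret CC: pair_sigma_finite circ circ by standard
  define f where "f = (\<lambda>t s. poisson (of_real r * cis t) s * \<psi> t)"
  have rc: "cmod (of_real r * cis t) < 1" for t using r by (simp add: norm_mult)
  have [measurable]: "cis \<in> borel_measurable circ"
    by (intro borel_measurable_integrable circ_intros)
  have [measurable]: "\<psi> \<in> borel_measurable circ" using \<psi> by auto
  have meas: "(\<lambda>(t,s). f t s) \<in> borel_measurable (circ \<Otimes>\<^sub>M circ)"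
    unfolding f_def poisson_def by measurable
  have inner: "cint (\<lambda>s. norm (f t s)) = 2 * pi * norm (\<psi> t)" for t
  proof -
    have "(\<lambda>s. norm (f t s)) = (\<lambda>s. norm (\<psi> t) * poisson (of_real r * cis t) s)"
      using poisson_pos[OF rc] by (auto simp: f_def abs_mult less_imp_le)
    then show ?thesis by (simp add: poisson_integral[OF rc])
  qed
  have int: "integrable (circ \<Otimes>\<^sub>M circ) (\<lambda>(t,s). f t s)"
  proof (rule CC.Fubini_integrable[OF meas])
    show "integrable circ (\<lambda>t. cint (\<lambda>s. norm (case (t, s) of (t, s) \<Rightarrow> f t s)))"
      using \<psi> by (simp only: prod.case inner) (intro integrable_mult_right integrable_norm)
    show "AE t in circ. integrable circ (\<lambda>s. case (t, s) of (t, s) \<Rightarrow> f t s)"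
      unfolding f_def prod.case
      by (intro AE_I2 integrable_mult_left integrable_circ_continuous poisson_continuous rc)
  qed
  have sw: "(\<lambda>s. cint (\<lambda>t. poisson (of_real r * cis s) t * \<psi> t)) = (\<lambda>s. cint (\<lambda>t. f t s))"
    unfolding f_def by (subst poisson_commute) (rule refl)
  show "integrable circ (\<lambda>s. cint (\<lambda>t. poisson (of_real r * cis s) t * \<psi> t))"
    unfolding sw by (rule CC.integrable_snd[OF int])
  have "cint (\<lambda>s. cint (\<lambda>t. f t s)) = cint (\<lambda>t. cint (\<lambda>s. f t s))"
    by (rule CC.Fubini_integral[OF int])
  also have "\<dots> = cint (\<lambda>t. 2 * pi * \<psi> t)"
    by (intro Bochner_Integration.integral_cong refl) (simp add: f_def poisson_integral[OF rc])
  finally show "cint (\<lambda>s. cint (\<lambda>t. poisson (of_real r * cis s) t * \<psi> t)) = 2 * pi * cint \<psi>"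
    unfolding sw by simp
qed

text \<open>Jensen's inequality for the probability density \<open>poisson z t / (2 * pi)\<close>,
  obtained by integrating the tangent line of \<open>exp\<close> at the mean
  \<open>m\<close>.\<close>

lemma poisson_jensen:
  assumes v: "continuous_on {0..2*pi} v" and z: "cmod z < 1"
  shows "exp (cint (\<lambda>t. poisson z t * v t) / (2 * pi)) \<le> cint (\<lambda>t. poisson z t * exp (v t)) / (2 * pi)"
proof -
  define m where "m = cint (\<lambda>t. poisson z t * v t) / (2 * pi)"
  have Pv: "integrable circ (\<lambda>t. poisson z t * v t)" and P: "integrable circ (poisson z)"
    by (intro circ_intros v poisson_continuous z)+
  have "cint (\<lambda>t. exp m * ((1 - m) * poisson z t + poisson z t * v t)) =
      exp m * ((1 - m) * (2 * pi) + cint (\<lambda>t. poisson z t * v t))"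
    using Pv P by (simp add: poisson_integral[OF z])
  also have "cint (\<lambda>t. poisson z t * v t) = m * (2 * pi)" by (simp add: m_def)
  finally have "exp m * (2 * pi) = cint (\<lambda>t. exp m * ((1 - m) * poisson z t + poisson z t * v t))"
    by (simp add: algebra_simps)
  also have "\<dots> \<le> cint (\<lambda>t. poisson z t * exp (v t))"
  proof (rule integral_mono)
    show "integrable circ (\<lambda>t. exp m * ((1 - m) * poisson z t + poisson z t * v t))"
      using Pv P by auto
    show "integrable circ (\<lambda>t. poisson z t * exp (v t))"
      by (intro circ_intros v poisson_continuous z)
    fix t
    have "exp m * (1 + (v t - m)) \<le> exp m * exp (v t - m)"
      by (intro mult_left_mono exp_ge_add_one_self) auto
    also have "\<dots> = exp (v t)" by (simp add: exp_add[symmetric])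
    finally have "poisson z t * (exp m * (1 + (v t - m))) \<le> poisson z t * exp (v t)"
      using poisson_pos[OF z, of t] by (intro mult_left_mono) auto
    then show "exp m * ((1 - m) * poisson z t + poisson z t * v t) \<le> poisson z t * exp (v t)"
      by (simp add: algebra_simps)
  qed
  finally have "exp m \<le> cint (\<lambda>t. poisson z t * exp (v t)) / (2 * pi)"
    by (subst pos_le_divide_eq) auto
  then show ?thesis by (simp only: m_def)
qed

lemma truncation_error_tendsto:
  fixes u :: "'a \<Rightarrow> real"
  assumes u: "integrable M u"
  shows "(\<lambda>N. integral\<^sup>L M (\<lambda>s. max (\<bar>u s\<bar> - real N) 0)) \<longlonglongrightarrow> 0"
proof -
  have [measurable]: "u \<in> borel_measurable M" using u by auto
  have "(\<lambda>N. integral\<^sup>L M (\<lambda>s. max (\<bar>u s\<bar> - real N) 0)) \<longlonglongrightarrow> integral\<^sup>L M (\<lambda>s. 0)"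
  proof (rule integral_dominated_convergence[where w="\<lambda>s. \<bar>u s\<bar>"])
    show "AE s in M. (\<lambda>N. max (\<bar>u s\<bar> - real N) 0) \<longlonglongrightarrow> 0"
    proof (rule AE_I2)
      fix s
      obtain N0 :: nat where "\<bar>u s\<bar> \<le> real N0" using real_arch_simple by blast
      then have "eventually (\<lambda>N. max (\<bar>u s\<bar> - real N) 0 = 0) sequentially"
        by (intro eventually_sequentiallyI[of N0]) auto
      then show "(\<lambda>N. max (\<bar>u s\<bar> - real N) 0) \<longlonglongrightarrow> 0" by (rule tendsto_eventually)
    qed
  qed (use u in auto)
  then show ?thesis by simp
qed

text \<open>Poisson extensions of an integrable function are uniformly integrable over the circles,
  which is what turns almost everywhere convergence into convergence in the mean.\<close>

lemma poisson_dominated_mean_tendsto: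
  fixes q :: "nat \<Rightarrow> real \<Rightarrow> real"
  assumes u: "integrable circ u" and R: "\<And>n. 0 \<le> R n" "\<And>n. R n < 1"
    and q: "\<And>n. continuous_on {0..2*pi} (q n)"
    and lim: "AE t in circ. (\<lambda>n. q n t) \<longlonglongrightarrow> 0"
    and le: "\<And>n t. \<bar>q n t\<bar> \<le> Q + \<bar>cint (\<lambda>s. poisson (of_real (R n) * cis t) s * u s)\<bar>"
  shows "(\<lambda>n. cint (\<lambda>t. \<bar>q n t\<bar>)) \<longlonglongrightarrow> 0"
proof (rule LIMSEQ_I)
  fix e :: real assume e: "e > 0"
  define \<epsilon> where "\<epsilon> = (\<lambda>N s. max (\<bar>u s\<bar> - real N) 0)"
  have \<epsilon>_int: "integrable circ (\<epsilon> N)" for N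
    unfolding \<epsilon>_def
    by (rule Bochner_Integration.integrable_bound[OF u]) (use u in auto)
  have "(\<lambda>N. 2 * pi * cint (\<epsilon> N)) \<longlonglongrightarrow> 2 * pi * 0"
    unfolding \<epsilon>_def by (intro tendsto_intros truncation_error_tendsto u)
  then have "eventually (\<lambda>N. 2 * pi * cint (\<epsilon> N) < e / 2) sequentially"
    by (rule order_tendstoD(2)) (use e in simp)
  then obtain N where N: "2 * pi * cint (\<epsilon> N) < e / 2"
    by (auto simp: eventually_sequentially)
  \<comment> \<open>Splitting \<open>\<bar>u s\<bar> \<le> N + \<epsilon> N s\<close> bounds the
    Poisson integral by \<open>2 * pi * N\<close> plus a remainder \<open>E\<close> whose integral
    over every circle is \<open>2 * pi * cint (\<epsilon> N)\<close>, small by choice of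
    \<open>N\<close>. The part of \<open>q\<close> below \<open>B\<close> is left to dominated
    convergence.\<close>
  define B where "B = \<bar>Q\<bar> + 2 * pi * real N"
  have B0: "B \<ge> 0" by (simp add: B_def)
  define E where "E = (\<lambda>n t. cint (\<lambda>s. poisson (of_real (R n) * cis t) s * \<epsilon> N s))"
  have rc: "cmod (of_real (R n) * cis t) < 1" for n t using R[of n] by (simp add: norm_mult)
  have [measurable]: "q n \<in> borel_measurable circ" for n
    by (intro borel_measurable_integrable integrable_circ_continuous q)
  have qle: "\<bar>q n t\<bar> \<le> B + E n t" for n t
  proof -
    define z where "z = of_real (R n) * cis t"
    have z: "cmod z < 1" using rc by (simp add: z_def)
    have P: "integrable circ (poisson z)" by (intro integrable_circ_continuous poisson_continuous z)
    note I = poisson_kernel_integrable[OF u z] poisson_kernel_integrable[OF \<epsilon>_int z, of N]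
    have "\<bar>cint (\<lambda>s. poisson z s * u s)\<bar> \<le> cint (\<lambda>s. \<bar>poisson z s * u s\<bar>)"
      by (rule integral_abs_bound)
    also have "\<dots> \<le> cint (\<lambda>s. real N * poisson z s + poisson z s * \<epsilon> N s)"
    proof (rule integral_mono)
      fix s
      have "\<bar>u s\<bar> \<le> real N + \<epsilon> N s" by (simp add: \<epsilon>_def)
      then have "poisson z s * \<bar>u s\<bar> \<le> poisson z s * (real N + \<epsilon> N s)"
        using poisson_pos[OF z, of s] by (intro mult_left_mono) auto
      then show "\<bar>poisson z s * u s\<bar> \<le> real N * poisson z s + poisson z s * \<epsilon> N s"
        using poisson_pos[OF z, of s] by (simp add: abs_mult algebra_simps)
    qed (use I P in auto)
    also have "\<dots> = 2 * pi * real N + E n t"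
      using I P by (simp add: poisson_integral[OF z] E_def z_def[symmetric])
    finally show ?thesis using le[of n t] unfolding B_def z_def by linarith
  qed
  have "(\<lambda>n. cint (\<lambda>t. min \<bar>q n t\<bar> B)) \<longlonglongrightarrow> cint (\<lambda>t. 0)"
  proof (rule integral_dominated_convergence[where w="\<lambda>_. B"])
    show "integrable circ (\<lambda>_. B)" by (intro circ_intros)
    show "AE t in circ. (\<lambda>n. min \<bar>q n t\<bar> B) \<longlonglongrightarrow> 0"
      using lim
    proof eventually_elim
      case (elim t)
      have "(\<lambda>n. min \<bar>q n t\<bar> B) \<longlonglongrightarrow> min \<bar>0\<bar> B" by (intro tendsto_intros elim)
      then show ?case using B0 by simp
    qed
  qed (use B0 in auto)
  then have "eventually (\<lambda>n. cint (\<lambda>t. min \<bar>q n t\<bar> B) < e / 2) sequentially"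
    using e by (intro order_tendstoD) auto
  then obtain n0 where n0: "\<And>n. n \<ge> n0 \<Longrightarrow> cint (\<lambda>t. min \<bar>q n t\<bar> B) < e / 2"
    by (auto simp: eventually_sequentially)
  have "norm (cint (\<lambda>t. \<bar>q n t\<bar>) - 0) < e" if n: "n \<ge> n0" for n
  proof -
    have iq: "integrable circ (\<lambda>t. \<bar>q n t\<bar>)"
      by (intro circ_intros q)
    have im: "integrable circ (\<lambda>t. min \<bar>q n t\<bar> B)"
      by (intro circ_intros q)
    have iE: "integrable circ (E n)"
      unfolding E_def by (rule poisson_mean(1)[OF \<epsilon>_int R])
    have E0: "E n t \<ge> 0" for t
      unfolding E_def using poisson_pos[OF rc] by (intro integral_nonneg_AE AE_I2) (auto simp: \<epsilon>_def less_imp_le)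
    have "cint (\<lambda>t. \<bar>q n t\<bar>) \<le> cint (\<lambda>t. min \<bar>q n t\<bar> B + E n t)"
    proof (rule integral_mono[OF iq])
      show "\<bar>q n t\<bar> \<le> min \<bar>q n t\<bar> B + E n t" for t
        using qle[of n t] E0[of t] by (simp add: min_def)
    qed (use im iE in auto)
    also have "\<dots> = cint (\<lambda>t. min \<bar>q n t\<bar> B) + 2 * pi * cint (\<epsilon> N)"
      using im iE poisson_mean(2)[OF \<epsilon>_int R] by (simp add: E_def)
    also have "\<dots> < e / 2 + e / 2" using n0[OF n] N by (intro add_strict_mono)
    finally have "cint (\<lambda>t. \<bar>q n t\<bar>) < e" by simp
    moreover have "cint (\<lambda>t. \<bar>q n t\<bar>) \<ge> 0" by (intro integral_nonneg_AE AE_I2) auto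
    ultimately show ?thesis by simp
  qed
  then show "\<exists>n0. \<forall>n\<ge>n0. norm (cint (\<lambda>t. \<bar>q n t\<bar>) - 0) < e" by blast
qed

text \<open>Used with \<open>x\<close> = |b/a|, where \<open>1 + x^2\<close> is (|a|^2 +
  |b|^2)/|a|^2: it passes from p-th power means of the quotient to those of 1/a. The factor 2 bounds
  \<open>2 powr (p / 2)\<close>.\<close>

lemma one_plus_square_powr_le:
  fixes x p :: real
  assumes "0 \<le> x" "0 < p" "p \<le> 2"
  shows "(1 + x\<^sup>2) powr (p / 2) \<le> 2 + 2 * x powr p"
proof -
  have two: "2 powr (p / 2) \<le> (2 :: real)"
    using powr_mono[of "p / 2" 1 "2 :: real"] assms by simp
  show ?thesis
  proof (cases "x \<le> 1")
    case True
    then have "(1 + x\<^sup>2) powr (p / 2) \<le> 2 powr (p / 2)"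
      using assms by (intro powr_mono2) (auto simp: abs_square_le_1)
    with two show ?thesis using powr_ge_zero[of x p] by linarith
  next
    case False
    then have "1 \<le> x\<^sup>2" by (intro one_le_power) auto
    then have "(1 + x\<^sup>2) powr (p / 2) \<le> (2 * x\<^sup>2) powr (p / 2)"
      using assms by (intro powr_mono2) auto
    also have "\<dots> = 2 powr (p / 2) * x powr p"
      using False by (simp add: powr_mult powr_powr powr_numeral[symmetric] del: powr_numeral)
    also have "\<dots> \<le> 2 * x powr p" using two by (intro mult_right_mono) auto
    finally show ?thesis by simp
  qed
qed

definition boundary_pythagorean :: "(complex \<Rightarrow> complex) \<Rightarrow> (complex \<Rightarrow> complex) \<Rightarrow> bool" where
  "boundary_pythagorean b a \<longleftrightarrow> (AE t in circ. \<exists>\<beta> \<alpha>. has_radial_limit b (cis t) \<beta> \<and> has_radial_limit a (cis t) \<alpha> \<and>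
    (cmod \<beta>)\<^sup>2 + (cmod \<alpha>)\<^sup>2 = 1)"

text \<open>Dominated convergence is applied along sequences, so radial limits are sampled on one
  sequence of radii.\<close>

lemma exists_radial_sequence:
  obtains R :: "nat \<Rightarrow> real" where "\<And>n. 0 \<le> R n" "\<And>n. R n < 1" "filterlim R (at_left 1) sequentially"
proof
  define R where "R = (\<lambda>n. 1 - inverse (real (Suc n)))"
  show R: "0 \<le> R n" "R n < 1" for n by (auto simp: R_def field_simps)
  have "R \<longlonglongrightarrow> 1 - 0" unfolding R_def by (intro tendsto_intros LIMSEQ_inverse_real_of_nat)
  then show "filterlim R (at_left 1) sequentially"
    using R by (auto simp: filterlim_at less_imp_neq)
qed

text \<open>For g = exp (- p/2 l) one has |g|^2 = exp (- p Re l), and on circles the exponent is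
  \<open>v - p / 2 * q\<close> with q = ln (|a|^2 + |b|^2). The Poisson formula and Jensen then
  bound |g|^2 by a Poisson integral of (1 + |b/a|^2)^(p/2), up to a factor governed by the mean of
  |q|, which tends to 0.\<close>

lemma outer_power_l2_seq:
  fixes a b l :: "complex \<Rightarrow> complex" and u :: "real \<Rightarrow> real"
  assumes l: "l holomorphic_on unit_disk" and b: "b holomorphic_on unit_disk"
    and a_exp: "\<And>z. cmod z < 1 \<Longrightarrow> a z = exp (l z)"
    and aA: "\<And>z. cmod z < 1 \<Longrightarrow> cmod (a z) \<le> A" and bA: "\<And>z. cmod z < 1 \<Longrightarrow> cmod (b z) \<le> A"
    and u: "integrable circ u"
    and outer: "\<And>z. cmod z < 1 \<Longrightarrow> 2 * pi * Re (l z) = cint (\<lambda>s. poisson z s * u s)"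
    and bdry: "boundary_pythagorean b a"
    and p: "0 < p" "p \<le> 2"
    and M: "\<And>r. 0 \<le> r \<Longrightarrow> r < 1 \<Longrightarrow> cint (\<lambda>t. cmod (b (of_real r * cis t) / a (of_real r * cis t)) powr p) \<le> 2 * pi * M"
  shows "l2_seq (tc (\<lambda>z. exp (- of_real (p / 2) * l z)))"
proof -
  define g where "g = (\<lambda>z. exp (- of_real (p / 2) * l z))"
  have g: "g holomorphic_on unit_disk" unfolding g_def by (intro holomorphic_intros l)
  obtain R :: "nat \<Rightarrow> real" where R: "\<And>n. 0 \<le> R n" "\<And>n. R n < 1" and R_at: "filterlim R (at_left 1) sequentially"
    using exists_radial_sequence by blast
  have R1: "R \<longlonglongrightarrow> 1" using R_at by (simp add: filterlim_at)
  have a: "a holomorphic_on unit_disk"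
    by (rule holomorphic_transform[OF holomorphic_on_exp'[OF l]]) (simp add: a_exp)
  have "0 < cmod (a 0)" using a_exp[of 0] by simp
  also have "\<dots> \<le> A" using aA[of 0] by simp
  finally have A0: "A > 0" .
  have na: "cmod (a z) = exp (Re (l z))" if "cmod z < 1" for z using a_exp[OF that] by simp
  define x where "x = (\<lambda>n t. of_real (R n) * cis t)"
  have x1: "cmod (x n t) < 1" for n t using R[of n] by (simp add: x_def norm_mult)
  have cx: "continuous_on S (\<lambda>t. f (x n t))" if "f holomorphic_on unit_disk" for f n S
    unfolding x_def by (intro continuous_on_circle that R)
  have apos: "(cmod (a (x n t)))\<^sup>2 > 0" for n t using na[OF x1] by simp
  define q where "q = (\<lambda>n t. ln ((cmod (a (x n t)))\<^sup>2 + (cmod (b (x n t)))\<^sup>2))"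
  have spos: "(cmod (a (x n t)))\<^sup>2 + (cmod (b (x n t)))\<^sup>2 > 0" for n t
    using apos[of n t] by (simp add: add_pos_nonneg)
  have qc: "continuous_on S (q n)" for n S
    unfolding q_def by (intro continuous_intros cx a b) (use spos in \<open>metis less_irrefl\<close>)
  have Dq: "(\<lambda>n. cint (\<lambda>t. \<bar>q n t\<bar>)) \<longlonglongrightarrow> 0"
  proof (rule poisson_dominated_mean_tendsto[OF u R qc])
    show "AE t in circ. (\<lambda>n. q n t) \<longlonglongrightarrow> 0"
      using bdry[unfolded boundary_pythagorean_def]
    proof eventually_elim
      case (elim t)
      then obtain \<beta> \<alpha> where lims: "has_radial_limit b (cis t) \<beta>" "has_radial_limit a (cis t) \<alpha>"
        and one: "(cmod \<beta>)\<^sup>2 + (cmod \<alpha>)\<^sup>2 = 1" by blast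
      have "(\<lambda>n. b (x n t)) \<longlonglongrightarrow> \<beta>" "(\<lambda>n. a (x n t)) \<longlonglongrightarrow> \<alpha>"
        using lims unfolding has_radial_limit_def x_def by (auto intro: filterlim_compose[OF _ R_at])
      then have "(\<lambda>n. q n t) \<longlonglongrightarrow> ln ((cmod \<alpha>)\<^sup>2 + (cmod \<beta>)\<^sup>2)"
        unfolding q_def using one by (intro tendsto_intros) (auto simp: add.commute)
      then show ?case using one by (simp add: add.commute)
    qed
    show "\<bar>q n t\<bar> \<le> \<bar>ln (2 * A\<^sup>2)\<bar> + \<bar>cint (\<lambda>s. poisson (of_real (R n) * cis t) s * u s)\<bar>" for n t
    proof -
      have w: "cint (\<lambda>s. poisson (of_real (R n) * cis t) s * u s) = 2 * pi * Re (l (x n t))"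
        using outer[OF x1[of n t]] by (simp add: x_def)
      have "(cmod (a (x n t)))\<^sup>2 + (cmod (b (x n t)))\<^sup>2 \<le> A\<^sup>2 + A\<^sup>2"
        by (intro add_mono power_mono aA bA x1) auto
      then have up: "q n t \<le> ln (2 * A\<^sup>2)"
        unfolding q_def using spos[of n t] A0 by (intro ln_mono) auto
      have "ln ((cmod (a (x n t)))\<^sup>2) \<le> q n t"
        unfolding q_def using apos[of n t] spos[of n t] by (intro ln_mono) auto
      moreover have "ln ((cmod (a (x n t)))\<^sup>2) = 2 * Re (l (x n t))"
        using na[OF x1] by (simp add: ln_realpow)
      \<comment> \<open>The 2 stems from the squared modulus. It is absorbed because the Poisson
        integral in \<open>outer\<close> is unnormalized and equals
        \<open>2 * pi * Re l\<close>.\<close>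
      moreover have "2 * \<bar>Re (l (x n t))\<bar> \<le> 2 * pi * \<bar>Re (l (x n t))\<bar>"
        using pi_gt3 by (intro mult_right_mono) auto
      ultimately show ?thesis unfolding w using up by (simp add: abs_mult)
    qed
  qed
  define v where "v = (\<lambda>n t. p / 2 * ln (1 + (cmod (b (x n t) / a (x n t)))\<^sup>2))"
  have anz: "a (x n t) \<noteq> 0" for n t using a_exp[OF x1] by simp
  have vc: "continuous_on S (v n)" for n S
    unfolding v_def
    by (intro continuous_intros cx a b) (use anz in \<open>auto simp: add_pos_nonneg intro!: less_imp_neq[THEN not_sym]\<close>)
  have vq: "- p * Re (l (x n t)) = v n t - p / 2 * q n t" for n t
  proof -
    have "1 + (cmod (b (x n t) / a (x n t)))\<^sup>2 = ((cmod (a (x n t)))\<^sup>2 + (cmod (b (x n t)))\<^sup>2) / (cmod (a (x n t)))\<^sup>2"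
      using anz by (simp add: norm_divide power_divide field_simps)
    then have "ln (1 + (cmod (b (x n t) / a (x n t)))\<^sup>2) = q n t - ln ((cmod (a (x n t)))\<^sup>2)"
      using spos[of n t] apos[of n t] by (simp only: ln_div q_def less_imp_neq[THEN not_sym] simp_thms if_True)
    moreover have "ln ((cmod (a (x n t)))\<^sup>2) = 2 * Re (l (x n t))"
      using na[OF x1] by (simp add: ln_realpow)
    ultimately have "ln (1 + (cmod (b (x n t) / a (x n t)))\<^sup>2) = q n t - 2 * Re (l (x n t))"
      by (simp only:)
    then show ?thesis by (simp only: v_def) (simp add: algebra_simps)
  qed
  define \<psi> where "\<psi> = (\<lambda>n t. cmod (b (x n t) / a (x n t)) powr p)"
  have \<psi>c: "continuous_on S (\<psi> n)" for n S
    unfolding \<psi>_def by (intro continuous_on_powr' continuous_intros cx a b) (use anz p in auto)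
  have \<psi>i: "integrable circ (\<lambda>t. 2 + 2 * \<psi> n t)" for n
    by (intro circ_intros \<psi>c)
  define D where "D = (\<lambda>n. cint (\<lambda>t. \<bar>q n t\<bar>))"
  \<comment> \<open>For fixed \<open>z\<close> the kernel is at most 2/(1 - |z|), so the
    contribution of \<open>q\<close> is at most a constant times \<open>D n\<close> inside the
    exponential.\<close>
  have point: "(cmod (g (of_real (R n) * z)))\<^sup>2 \<le>
      exp (p / 2 * (2 / (1 - cmod z)) * D n / (2 * pi)) * (cint (\<lambda>t. poisson z t * (2 + 2 * \<psi> n t)) / (2 * pi))"
    if z: "cmod z < 1" for n z
  proof -
    define K where "K = 2 / (1 - cmod z)"
    have K: "poisson z t \<le> K" for t unfolding K_def by (rule poisson_le[OF z])
    have "(\<lambda>z. - of_real p * l z) holomorphic_on unit_disk" by (intro holomorphic_intros l)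
    from poisson_formula_Re[OF this R z, of n]
    have "2 * pi * (- p * Re (l (of_real (R n) * z))) = cint (\<lambda>t. poisson z t * (v n t - p / 2 * q n t))"
      unfolding vq[symmetric] x_def by simp
    also have "\<dots> \<le> cint (\<lambda>t. poisson z t * v n t + p / 2 * K * \<bar>q n t\<bar>)"
    proof (rule integral_mono)
      fix t
      have "p / 2 * - q n t \<le> p / 2 * \<bar>q n t\<bar>" by (rule mult_left_mono) (use p in auto)
      then have "poisson z t * (p / 2 * - q n t) \<le> poisson z t * (p / 2 * \<bar>q n t\<bar>)"
        by (rule mult_left_mono) (use poisson_pos[OF z, of t] in simp)
      also have "\<dots> \<le> K * (p / 2 * \<bar>q n t\<bar>)" using K p by (intro mult_right_mono) auto
      finally show "poisson z t * (v n t - p / 2 * q n t) \<le> poisson z t * v n t + p / 2 * K * \<bar>q n t\<bar>"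
        by (simp add: algebra_simps)
    qed (intro circ_intros vc qc poisson_continuous z)+
    also have "\<dots> = cint (\<lambda>t. poisson z t * v n t) + p / 2 * K * D n"
      unfolding D_def
      by (subst Bochner_Integration.integral_add)
        (auto intro!: circ_intros vc qc poisson_continuous z)
    finally have "- p * Re (l (of_real (R n) * z)) \<le> p / 2 * K * D n / (2 * pi) + cint (\<lambda>t. poisson z t * v n t) / (2 * pi)"
      by (simp add: field_simps)
    then have "exp (- p * Re (l (of_real (R n) * z))) \<le> exp (p / 2 * K * D n / (2 * pi)) * exp (cint (\<lambda>t. poisson z t * v n t) / (2 * pi))"
      by (simp add: exp_add[symmetric])
    also have "\<dots> \<le> exp (p / 2 * K * D n / (2 * pi)) * (cint (\<lambda>t. poisson z t * exp (v n t)) / (2 * pi))"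
      by (intro mult_left_mono poisson_jensen vc z) auto
    also have "\<dots> \<le> exp (p / 2 * K * D n / (2 * pi)) * (cint (\<lambda>t. poisson z t * (2 + 2 * \<psi> n t)) / (2 * pi))"
    proof (intro mult_left_mono divide_right_mono integral_mono)
      fix t
      have "exp (v n t) = (1 + (cmod (b (x n t) / a (x n t)))\<^sup>2) powr (p / 2)"
        by (simp add: v_def powr_def add_pos_nonneg add_nonneg_eq_0_iff)
      also have "\<dots> \<le> 2 + 2 * \<psi> n t" unfolding \<psi>_def by (rule one_plus_square_powr_le) (use p in auto)
      finally show "exp (v n t) \<le> 2 + 2 * \<psi> n t" .
      show "0 \<le> poisson z t" using poisson_pos[OF z] by (simp add: less_imp_le)
    qed (auto intro!: circ_intros vc \<psi>c poisson_continuous z)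
    also have "exp (- p * Re (l (of_real (R n) * z))) = (cmod (g (of_real (R n) * z)))\<^sup>2"
      by (simp add: g_def exp_double[symmetric])
    finally show ?thesis by (simp add: K_def)
  qed
  \<comment> \<open>Two radii are kept apart: with \<open>r\<close> fixed, \<open>R n\<close> tends
    to 1 and so does the error factor \<open>?X r n\<close>; only afterwards does \<open>r\<close>
    tend to 1, the remaining bound \<open>2 + 2 * M\<close> being independent of it.\<close>
  let ?X = "\<lambda>r n. exp (p / 2 * (2 / (1 - r)) * D n / (2 * pi))"
  have mean: "cint (\<lambda>s. (cmod (g (of_real (R n * r) * cis s)))\<^sup>2) \<le>
      2 * pi * (?X r n * (2 + 2 * M))" if r: "0 \<le> r" "r < 1" for n r
  proof -
    define X where "X = ?X r n"
    have rc: "cmod (of_real r * cis s) < 1" for s using r by (simp add: norm_mult)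
    have Rr: "0 \<le> R n * r" "R n * r < 1"
      using R[of n] r mult_strict_mono'[of "R n" 1 r 1] by auto
    have "cint (\<lambda>s. (cmod (g (of_real (R n * r) * cis s)))\<^sup>2) \<le>
       cint (\<lambda>s. X / (2 * pi) * cint (\<lambda>t. poisson (of_real r * cis s) t * (2 + 2 * \<psi> n t)))"
    proof (rule integral_mono)
      show "integrable circ (\<lambda>s. (cmod (g (of_real (R n * r) * cis s)))\<^sup>2)"
        by (intro circ_intros continuous_on_circle g Rr)
      show "integrable circ (\<lambda>s. X / (2 * pi) * cint (\<lambda>t. poisson (of_real r * cis s) t * (2 + 2 * \<psi> n t)))"
        by (intro integrable_mult_right poisson_mean(1) \<psi>i r)
      show "(cmod (g (of_real (R n * r) * cis s)))\<^sup>2 \<le>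
          X / (2 * pi) * cint (\<lambda>t. poisson (of_real r * cis s) t * (2 + 2 * \<psi> n t))" for s
        using point[OF rc, of n s] r by (simp add: X_def norm_mult mult.assoc)
    qed
    also have "\<dots> = X * cint (\<lambda>t. 2 + 2 * \<psi> n t)"
      using poisson_mean(2)[OF \<psi>i[of n] r] by simp
    also have "cint (\<lambda>t. 2 + 2 * \<psi> n t) = 2 * (2 * pi) + 2 * cint (\<psi> n)"
      by (subst Bochner_Integration.integral_add)
        (auto intro!: circ_intros \<psi>c)
    also have "X * \<dots> \<le> X * (2 * (2 * pi) + 2 * (2 * pi * M))"
      using M[OF R, of n] by (intro mult_left_mono add_left_mono) (auto simp: X_def \<psi>_def x_def)
    finally show ?thesis by (simp add: X_def algebra_simps)
  qed
  have part: "(\<Sum>k<N. (cmod (tc g k))\<^sup>2 * r ^ (2 * k)) \<le> 2 + 2 * M" if r: "0 \<le> r" "r < 1" for r N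
  proof (rule LIMSEQ_le)
    show "(\<lambda>n. \<Sum>k<N. (cmod (tc g k))\<^sup>2 * (R n * r) ^ (2 * k)) \<longlonglongrightarrow> (\<Sum>k<N. (cmod (tc g k))\<^sup>2 * r ^ (2 * k))"
      by (rule tendsto_eq_intros R1 refl | simp)+
    have "(\<lambda>n. ?X r n * (2 + 2 * M)) \<longlonglongrightarrow>
        exp (p / 2 * (2 / (1 - r)) * 0 / (2 * pi)) * (2 + 2 * M)"
      using Dq unfolding D_def by (intro tendsto_intros) auto
    then show "(\<lambda>n. ?X r n * (2 + 2 * M)) \<longlonglongrightarrow> 2 + 2 * M"
      by simp
    have "(\<Sum>k<N. (cmod (tc g k))\<^sup>2 * (R n * r) ^ (2 * k)) \<le> ?X r n * (2 + 2 * M)" for n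
    proof -
      have Rr: "0 \<le> R n * r" "R n * r < 1"
        using R[of n] r mult_strict_mono'[of "R n" 1 r 1] by auto
      have "2 * pi * (\<Sum>k<N. (cmod (tc g k))\<^sup>2 * (R n * r) ^ (2 * k)) \<le> 2 * pi * (?X r n * (2 + 2 * M))"
        by (rule order_trans[OF partial_sum_le_circ_mean[OF g Rr] mean[OF r]])
      then show ?thesis by (rule mult_left_le_imp_le) auto
    qed
    then show "\<exists>n0. \<forall>n\<ge>n0. (\<Sum>k<N. (cmod (tc g k))\<^sup>2 * (R n * r) ^ (2 * k)) \<le> ?X r n * (2 + 2 * M)"
      by blast
  qed
  from abel_sums_bounded_imp_l2_seq(1)[OF part] show ?thesis unfolding g_def .
qed

section \<open>Weighted coefficient norms\<close>

abbreviation gamma_kernel :: "real \<Rightarrow> real \<Rightarrow> real \<Rightarrow> real" where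
  "gamma_kernel \<sigma> \<alpha> t \<equiv> indicator {0<..} t * (t powr (\<sigma> - 1) * exp (- (\<alpha> * t)))"

abbreviation gamma_weight :: "real \<Rightarrow> real \<Rightarrow> real" where
  "gamma_weight \<sigma> \<alpha> \<equiv> Gamma \<sigma> / \<alpha> powr \<sigma>"

text \<open>Euler's integral after the substitution of \<open>\<alpha> * t\<close>. It writes the
  power \<open>\<alpha> powr (- \<sigma>)\<close> as an average of exponentials, which links
  coefficient weights to circle means.\<close>

lemma nn_integral_Gamma_scaled:
  fixes \<sigma> \<alpha> :: real
  assumes "\<sigma> > 0" "\<alpha> > 0"
  shows "(\<integral>\<^sup>+t. ennreal (gamma_kernel \<sigma> \<alpha> t) \<partial>lborel) = ennreal (gamma_weight \<sigma> \<alpha>)"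
proof -
  define G where "G = (\<lambda>t. ennreal (indicator {0<..} t * (t powr (\<sigma> - 1) * exp (- t))))"
  have [measurable]: "G \<in> borel_measurable borel" unfolding G_def by measurable
  have "ennreal (Gamma \<sigma>) = (\<integral>\<^sup>+t. ennreal (indicator {0..} t * t powr (\<sigma> - 1) / exp t) \<partial>lborel)"
    by (rule Gamma_conv_nn_integral_real[OF assms(1)])
  also have "\<dots> = (\<integral>\<^sup>+t. G t \<partial>lborel)"
    by (intro nn_integral_cong) (auto simp: G_def exp_minus field_simps indicator_def)
  also have "\<dots> = ennreal \<alpha> * (\<integral>\<^sup>+t. G (0 + \<alpha> * t) \<partial>lborel)"
    using nn_integral_real_affine[of G \<alpha> 0] assms by simp
  also have "(\<integral>\<^sup>+t. G (0 + \<alpha> * t) \<partial>lborel) =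
      (\<integral>\<^sup>+t. ennreal (\<alpha> powr (\<sigma> - 1)) * ennreal (gamma_kernel \<sigma> \<alpha> t) \<partial>lborel)"
    using assms
    by (intro nn_integral_cong) (auto simp: G_def indicator_def powr_mult zero_less_mult_iff ennreal_mult' mult.assoc)
  also have "\<dots> = ennreal (\<alpha> powr (\<sigma> - 1)) * (\<integral>\<^sup>+t. ennreal (gamma_kernel \<sigma> \<alpha> t) \<partial>lborel)"
    by (intro nn_integral_cmult) measurable
  finally have "ennreal (Gamma \<sigma>) = ennreal (\<alpha> powr \<sigma>) *
      (\<integral>\<^sup>+t. ennreal (gamma_kernel \<sigma> \<alpha> t) \<partial>lborel)"
    using assms by (simp add: mult.assoc[symmetric] ennreal_mult'[symmetric] powr_mult_base)
  moreover have "ennreal (gamma_weight \<sigma> \<alpha>) = ennreal (Gamma \<sigma>) / ennreal (\<alpha> powr \<sigma>)"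
    using assms by (intro divide_ennreal[symmetric]) (auto intro: less_imp_le Gamma_real_pos)
  ultimately have "ennreal (gamma_weight \<sigma> \<alpha>) =
      (\<integral>\<^sup>+t. ennreal (gamma_kernel \<sigma> \<alpha> t) \<partial>lborel) * ennreal (\<alpha> powr \<sigma>) / ennreal (\<alpha> powr \<sigma>)"
    by (simp only: mult.commute)
  also have "\<dots> = (\<integral>\<^sup>+t. ennreal (gamma_kernel \<sigma> \<alpha> t) \<partial>lborel)"
    by (rule mult_divide_eq_ennreal) (use assms in auto)
  finally show ?thesis by (rule sym)
qed

lemma nn_integral_laplace_series:
  fixes A \<alpha> :: "nat \<Rightarrow> real" and \<sigma> :: real
  assumes A: "\<And>n. A n \<ge> 0" and \<alpha>: "\<And>n. \<alpha> n > 0" and \<sigma>: "\<sigma> > 0"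
    and s: "\<And>t. t > 0 \<Longrightarrow> summable (\<lambda>n. A n * exp (- (\<alpha> n * t)))"
  shows "(\<integral>\<^sup>+t. ennreal (indicator {0<..} t * (t powr (\<sigma> - 1) * (\<Sum>n. A n * exp (- (\<alpha> n * t))))) \<partial>lborel) =
    (\<Sum>n. ennreal (A n * gamma_weight \<sigma> (\<alpha> n)))"
proof -
  have "ennreal (indicator {0<..} t * (t powr (\<sigma> - 1) * (\<Sum>n. A n * exp (- (\<alpha> n * t))))) =
     (\<Sum>n. ennreal (A n) * ennreal (gamma_kernel \<sigma> (\<alpha> n) t))" for t
  proof (cases "t > 0")
    case True
    have "(\<Sum>n. ennreal (A n) * ennreal (gamma_kernel \<sigma> (\<alpha> n) t)) =
        (\<Sum>n. ennreal (t powr (\<sigma> - 1) * (A n * exp (- (\<alpha> n * t)))))"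
      using True A by (simp add: ennreal_mult'[symmetric] mult_ac)
    also have "\<dots> = ennreal (\<Sum>n. t powr (\<sigma> - 1) * (A n * exp (- (\<alpha> n * t))))"
      using A by (intro suminf_ennreal2 summable_mult s True) auto
    also have "(\<Sum>n. t powr (\<sigma> - 1) * (A n * exp (- (\<alpha> n * t)))) = t powr (\<sigma> - 1) * (\<Sum>n. A n * exp (- (\<alpha> n * t)))"
      by (intro suminf_mult s True)
    finally show ?thesis using True by simp
  qed simp
  then have "(\<integral>\<^sup>+t. ennreal (indicator {0<..} t * (t powr (\<sigma> - 1) * (\<Sum>n. A n * exp (- (\<alpha> n * t))))) \<partial>lborel) =
    (\<integral>\<^sup>+t. (\<Sum>n. ennreal (A n) * ennreal (gamma_kernel \<sigma> (\<alpha> n) t)) \<partial>lborel)"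
    by (simp only:)
  also have "\<dots> = (\<Sum>n. \<integral>\<^sup>+t. ennreal (A n) * ennreal (gamma_kernel \<sigma> (\<alpha> n) t) \<partial>lborel)"
    by (intro nn_integral_suminf) measurable
  also have "\<dots> = (\<Sum>n. ennreal (A n) * ennreal (gamma_weight \<sigma> (\<alpha> n)))"
  proof (intro suminf_cong)
    fix n
    show "(\<integral>\<^sup>+t. ennreal (A n) * ennreal (gamma_kernel \<sigma> (\<alpha> n) t) \<partial>lborel) =
        ennreal (A n) * ennreal (gamma_weight \<sigma> (\<alpha> n))"
      unfolding nn_integral_Gamma_scaled[OF \<sigma> \<alpha>, symmetric] by (intro nn_integral_cmult) measurable
  qed
  finally show ?thesis using A by (simp add: ennreal_mult'[symmetric])
qed

text \<open>With radius \<open>exp (- (t / 2))\<close> a circle mean is a series of exponentials in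
  \<open>t\<close>. Integrating an inequality between two such series against powers of
  \<open>t\<close> compares weighted coefficient sums. The exponents \<open>\<alpha>\<close> and
  \<open>\<beta>\<close> may differ, so that an extra exponential factor can be absorbed.\<close>

lemma laplace_series_compare:
  fixes A B \<alpha> \<beta> :: "nat \<Rightarrow> real" and \<sigma> \<tau> :: real
  assumes A: "\<And>n. A n \<ge> 0" and B: "\<And>n. B n \<ge> 0" and \<alpha>: "\<And>n. \<alpha> n > 0" and \<beta>: "\<And>n. \<beta> n > 0"
    and \<sigma>: "\<sigma> > 0" and \<tau>: "\<tau> > 0"
    and sA: "\<And>t. t > 0 \<Longrightarrow> summable (\<lambda>n. A n * exp (- (\<alpha> n * t)))"
    and sB: "\<And>t. t > 0 \<Longrightarrow> summable (\<lambda>n. B n * exp (- (\<beta> n * t)))"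
    and le: "\<And>t. t > 0 \<Longrightarrow> t powr (\<sigma> - 1) * (\<Sum>n. A n * exp (- (\<alpha> n * t))) \<le> t powr (\<tau> - 1) * (\<Sum>n. B n * exp (- (\<beta> n * t)))"
    and fin: "summable (\<lambda>n. B n * gamma_weight \<tau> (\<beta> n))"
  shows "summable (\<lambda>n. A n * gamma_weight \<sigma> (\<alpha> n))"
    "(\<Sum>n. A n * gamma_weight \<sigma> (\<alpha> n)) \<le> (\<Sum>n. B n * gamma_weight \<tau> (\<beta> n))"
proof -
  have posA: "A n * gamma_weight \<sigma> (\<alpha> n) \<ge> 0" and posB: "B n * gamma_weight \<tau> (\<beta> n) \<ge> 0" for n
    using A B Gamma_real_pos[OF \<sigma>] Gamma_real_pos[OF \<tau>] by auto
  have "(\<Sum>n. ennreal (A n * gamma_weight \<sigma> (\<alpha> n))) \<le> (\<Sum>n. ennreal (B n * gamma_weight \<tau> (\<beta> n)))"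
  proof -
    have "(\<Sum>n. ennreal (A n * gamma_weight \<sigma> (\<alpha> n))) =
        (\<integral>\<^sup>+t. ennreal (indicator {0<..} t * (t powr (\<sigma> - 1) * (\<Sum>n. A n * exp (- (\<alpha> n * t))))) \<partial>lborel)"
      by (rule nn_integral_laplace_series[OF A \<alpha> \<sigma> sA, symmetric])
    also have "\<dots> \<le> (\<integral>\<^sup>+t. ennreal (indicator {0<..} t * (t powr (\<tau> - 1) * (\<Sum>n. B n * exp (- (\<beta> n * t))))) \<partial>lborel)"
      by (intro nn_integral_mono ennreal_leI) (auto simp: indicator_def le)
    also have "\<dots> = (\<Sum>n. ennreal (B n * gamma_weight \<tau> (\<beta> n)))"
      by (rule nn_integral_laplace_series[OF B \<beta> \<tau> sB])
    finally show ?thesis .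
  qed
  also have "\<dots> = ennreal (\<Sum>n. B n * gamma_weight \<tau> (\<beta> n))"
    by (intro suminf_ennreal2 posB fin)
  finally have *: "(\<Sum>n. ennreal (A n * gamma_weight \<sigma> (\<alpha> n))) \<le> ennreal (\<Sum>n. B n * gamma_weight \<tau> (\<beta> n))" .
  show 1: "summable (\<lambda>n. A n * gamma_weight \<sigma> (\<alpha> n))"
    by (rule summable_suminf_not_top[OF posA]) (use * in \<open>auto simp: top_unique\<close>)
  show "(\<Sum>n. A n * gamma_weight \<sigma> (\<alpha> n)) \<le> (\<Sum>n. B n * gamma_weight \<tau> (\<beta> n))"
    using *[unfolded suminf_ennreal2[OF posA 1]] suminf_nonneg[OF fin posB] by (subst (asm) ennreal_le_iff)
qed

text \<open>The base \<open>Suc n\<close> keeps the weight positive at index 0, so that negative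
  exponents are allowed and \<open>wt (-\<kappa>)\<close> inverts
  \<open>wt \<kappa>\<close>.\<close>

definition wt :: "real \<Rightarrow> (nat \<Rightarrow> complex) \<Rightarrow> nat \<Rightarrow> complex" where
  "wt \<kappa> x n = of_real (real (Suc n) powr \<kappa>) * x n"

lemma wt_zero [simp]: "wt 0 x = x"
  by (simp add: wt_def fun_eq_iff)

lemma wt_norm_square: "(cmod (wt \<kappa> x n))\<^sup>2 = real (Suc n) powr (2 * \<kappa>) * (cmod (x n))\<^sup>2"
proof -
  have "(real (Suc n) powr \<kappa>)\<^sup>2 = real (Suc n) powr (2 * \<kappa>)"
    by (simp only: power2_eq_square powr_add[symmetric] mult_2)
  then show ?thesis by (simp only: wt_def norm_mult norm_of_real power_mult_distrib) simp
qed

abbreviation circle_energy :: "(complex \<Rightarrow> complex) \<Rightarrow> real \<Rightarrow> real" where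
  "circle_energy u r \<equiv> \<Sum>n. (cmod (tc u n))\<^sup>2 * r ^ (2 * n)"

lemma circle_mean_mono:
  assumes u: "u holomorphic_on unit_disk" and v: "v holomorphic_on unit_disk"
    and le: "\<And>z. cmod z < 1 \<Longrightarrow> cmod (v z) \<le> C * cmod (u z)" and r: "0 \<le> r" "r < 1"
  shows "summable (\<lambda>n. (cmod (tc v n))\<^sup>2 * r ^ (2 * n))" "summable (\<lambda>n. (cmod (tc u n))\<^sup>2 * r ^ (2 * n))"
    "circle_energy v r \<le> C\<^sup>2 * circle_energy u r"
proof -
  have s: "summable (\<lambda>n. (cmod (tc f n))\<^sup>2 * r ^ (2 * n))"
    "2 * pi * circle_energy f r = cint (\<lambda>t. (cmod (f (of_real r * cis t)))\<^sup>2)"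
    if f: "f holomorphic_on unit_disk" for f
  proof -
    note P = parseval[OF f r]
    show 1: "summable (\<lambda>n. (cmod (tc f n))\<^sup>2 * r ^ (2 * n))"
      using sums_summable[OF P] by (subst (asm) summable_cmult_iff) auto
    show "2 * pi * circle_energy f r = cint (\<lambda>t. (cmod (f (of_real r * cis t)))\<^sup>2)"
      using sums_unique[OF P] by (simp only: suminf_mult[OF 1])
  qed
  show "summable (\<lambda>n. (cmod (tc v n))\<^sup>2 * r ^ (2 * n))" "summable (\<lambda>n. (cmod (tc u n))\<^sup>2 * r ^ (2 * n))"
    by (rule s(1)[OF v], rule s(1)[OF u])
  have "2 * pi * circle_energy v r \<le> cint (\<lambda>t. C\<^sup>2 * (cmod (u (of_real r * cis t)))\<^sup>2)"
    unfolding s(2)[OF v]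
  proof (rule integral_mono)
    show "(cmod (v (of_real r * cis t)))\<^sup>2 \<le> C\<^sup>2 * (cmod (u (of_real r * cis t)))\<^sup>2" for t
      unfolding power_mult_distrib[symmetric] using r by (intro power_mono le) (auto simp: norm_mult)
  qed (intro circ_intros continuous_on_circle u v r)+
  also have "\<dots> = C\<^sup>2 * (2 * pi * circle_energy u r)"
    unfolding s(2)[OF u] by simp
  finally have "2 * pi * circle_energy v r \<le> 2 * pi * (C\<^sup>2 * circle_energy u r)"
    by (simp only: mult_ac)
  then show "circle_energy v r \<le> C\<^sup>2 * circle_energy u r"
    by (rule mult_left_le_imp_le) auto
qed

lemma exp_half_power: "exp (- (t / 2)) ^ (2 * n) = exp (- (real n * t))"
  by (simp add: exp_of_nat_mult[symmetric])

text \<open>For \<kappa> > 0 the squared weighted norm is, up to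
  \<open>Gamma (2 * \<kappa>)\<close>, an integral over \<open>t\<close> of circle means, and each
  circle mean respects pointwise domination. In particular bounded multipliers preserve negative
  weights.\<close>

lemma weighted_domination:
  assumes u: "u holomorphic_on unit_disk" and v: "v holomorphic_on unit_disk"
    and le: "\<And>z. cmod z < 1 \<Longrightarrow> cmod (v z) \<le> C * cmod (u z)" and \<kappa>: "\<kappa> \<ge> 0"
    and su: "l2_seq (wt (-\<kappa>) (tc u))"
  shows "l2_seq (wt (-\<kappa>) (tc v))" "energy (wt (-\<kappa>) (tc v)) \<le> C\<^sup>2 * energy (wt (-\<kappa>) (tc u))"
proof -
  have "l2_seq (wt (-\<kappa>) (tc v)) \<and> energy (wt (-\<kappa>) (tc v)) \<le> C\<^sup>2 * energy (wt (-\<kappa>) (tc u))"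
  proof (cases "\<kappa> = 0")
    \<comment> \<open>The Gamma integral degenerates at exponent 0; the unweighted energy is bounded
      through the circle means directly.\<close>
    case True
    with su have su: "l2_seq (tc u)" by simp
    have "cint (\<lambda>t. (cmod (v (of_real r * cis t)))\<^sup>2) \<le> 2 * pi * (C\<^sup>2 * energy (tc u))"
      if r: "0 \<le> r" "r < 1" for r
    proof -
      note m = circle_mean_mono[OF u v le r]
      have "cint (\<lambda>t. (cmod (v (of_real r * cis t)))\<^sup>2) = 2 * pi * circle_energy v r"
        using sums_unique[OF parseval[OF v r]] by (simp only: suminf_mult[OF m(1)])
      also have "\<dots> \<le> 2 * pi * (C\<^sup>2 * circle_energy u r)"
        using m(3) by (intro mult_left_mono) auto
      also have "circle_energy u r \<le> energy (tc u)"
        unfolding energy_def using r m(2) su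
        by (intro suminf_le) (auto simp: l2_seq_def intro!: mult_right_le_one_le power_le_one)
      finally show ?thesis by (simp add: mult_left_mono)
    qed
    from circ_means_bounded_imp_l2_seq[OF v this] True show ?thesis by simp
  next
    case False
    with \<kappa> have \<sigma>: "2 * \<kappa> > 0" by simp
    define A where "A = (\<lambda>n. (cmod (tc v n))\<^sup>2)"
    define B where "B = (\<lambda>n. C\<^sup>2 * (cmod (tc u n))\<^sup>2)"
    have AB: "A n \<ge> 0" "B n \<ge> 0" for n by (auto simp: A_def B_def)
    have Gp: "Gamma (2 * \<kappa>) > 0" by (rule Gamma_real_pos[OF \<sigma>])
    have w: "(cmod (wt (-\<kappa>) x n))\<^sup>2 = (cmod (x n))\<^sup>2 * gamma_weight (2 * \<kappa>) (real (Suc n)) / Gamma (2 * \<kappa>)" for x n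
      using Gp unfolding wt_norm_square by (simp add: powr_minus field_simps)
    \<comment> \<open>The weight calls for exponent \<open>Suc n\<close> where the circle mean has
      \<open>n\<close>; the discrepancy is the common factor \<open>exp (- t)\<close>.\<close>
    have ex: "x * exp (- (real (Suc n) * t)) = exp (- t) * (x * exp (- (t / 2)) ^ (2 * n))" for x t n
      unfolding exp_half_power by (simp add: exp_add[symmetric] algebra_simps)
    have r: "0 \<le> exp (- (t / 2))" "exp (- (t / 2)) < 1" if "t > 0" for t :: real using that by auto
    have m: "summable (\<lambda>n. (cmod (tc v n))\<^sup>2 * exp (- (t / 2)) ^ (2 * n))"
      "summable (\<lambda>n. (cmod (tc u n))\<^sup>2 * exp (- (t / 2)) ^ (2 * n))"
      "circle_energy v (exp (- (t / 2))) \<le> C\<^sup>2 * circle_energy u (exp (- (t / 2)))"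
      if "t > 0" for t :: real
      by (rule circle_mean_mono[OF u v le r[OF that]]; assumption)+
    have sA: "summable (\<lambda>n. A n * exp (- (real (Suc n) * t)))" if "t > 0" for t
      unfolding ex A_def by (intro summable_mult m(1) that)
    have sB: "summable (\<lambda>n. B n * exp (- (real (Suc n) * t)))" if "t > 0" for t
      unfolding ex B_def mult.assoc by (intro summable_mult m(2) that)
    have fin: "summable (\<lambda>n. B n * gamma_weight (2 * \<kappa>) (real (Suc n)))"
    proof -
      have "B n * gamma_weight (2 * \<kappa>) (real (Suc n)) =
          (C\<^sup>2 * Gamma (2 * \<kappa>)) * (cmod (wt (-\<kappa>) (tc u) n))\<^sup>2" for n
        unfolding w B_def using Gp by simp
      then show ?thesis
        using su unfolding l2_seq_def by (simp only: summable_mult)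
    qed
    have cmp: "t powr (2 * \<kappa> - 1) * (\<Sum>n. A n * exp (- (real (Suc n) * t))) \<le> t powr (2 * \<kappa> - 1) * (\<Sum>n. B n * exp (- (real (Suc n) * t)))"
      if t: "t > 0" for t
    proof (intro mult_left_mono)
      have "(\<Sum>n. A n * exp (- (real (Suc n) * t))) = exp (- t) * circle_energy v (exp (- (t / 2)))"
        unfolding ex A_def by (intro suminf_mult m(1) t)
      also have "\<dots> \<le> exp (- t) * (C\<^sup>2 * circle_energy u (exp (- (t / 2))))"
        by (intro mult_left_mono m(3) t) auto
      also have "\<dots> = (\<Sum>n. B n * exp (- (real (Suc n) * t)))"
        unfolding ex B_def mult.assoc
        by (simp only: suminf_mult[OF m(2)[OF t]] suminf_mult[OF summable_mult[OF m(2)[OF t]]])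
      finally show "(\<Sum>n. A n * exp (- (real (Suc n) * t))) \<le> (\<Sum>n. B n * exp (- (real (Suc n) * t)))" .
    qed auto
    note L = laplace_series_compare[of A B "\<lambda>n. real (Suc n)" "\<lambda>n. real (Suc n)", OF AB(1) AB(2) _ _ \<sigma> \<sigma> sA sB cmp fin]
    have 1: "summable (\<lambda>n. A n * gamma_weight (2 * \<kappa>) (real (Suc n)))" by (rule L(1)) auto
    have 2: "(\<Sum>n. A n * gamma_weight (2 * \<kappa>) (real (Suc n))) \<le> (\<Sum>n. B n * gamma_weight (2 * \<kappa>) (real (Suc n)))"
      by (rule L(2)) auto
    have "l2_seq (wt (-\<kappa>) (tc v))"
      unfolding l2_seq_def w using 1 unfolding A_def by (rule summable_divide)
    moreover have "energy (wt (-\<kappa>) (tc v)) \<le> C\<^sup>2 * energy (wt (-\<kappa>) (tc u))"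
    proof -
      have "energy (wt (-\<kappa>) (tc v)) = (\<Sum>n. A n * gamma_weight (2 * \<kappa>) (real (Suc n))) / Gamma (2 * \<kappa>)"
        unfolding energy_def w using 1 unfolding A_def by (rule suminf_divide)
      also have "\<dots> \<le> (\<Sum>n. B n * gamma_weight (2 * \<kappa>) (real (Suc n))) / Gamma (2 * \<kappa>)"
        using 2 Gp by (intro divide_right_mono) auto
      also have "\<dots> = (\<Sum>n. B n * gamma_weight (2 * \<kappa>) (real (Suc n)) / Gamma (2 * \<kappa>))"
        by (rule suminf_divide[OF fin, symmetric])
      also have "\<dots> = (\<Sum>n. C\<^sup>2 * (cmod (wt (-\<kappa>) (tc u) n))\<^sup>2)"
        unfolding B_def w by (simp only: mult.assoc times_divide_eq_right)
      also have "\<dots> = C\<^sup>2 * energy (wt (-\<kappa>) (tc u))"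
        using su unfolding energy_def l2_seq_def by (rule suminf_mult)
      finally show ?thesis .
    qed
    ultimately show ?thesis ..
  qed
  then show "l2_seq (wt (-\<kappa>) (tc v))" "energy (wt (-\<kappa>) (tc v)) \<le> C\<^sup>2 * energy (wt (-\<kappa>) (tc u))" by auto
qed

text \<open>Cauchy-Schwarz against the powers \<open>z ^ n\<close>, whose energy is a geometric
  series.\<close>

lemma point_evaluation_bound:
  assumes g: "g holomorphic_on unit_disk" and sg: "l2_seq (tc g)" and z: "cmod z < 1"
  shows "(cmod (g z))\<^sup>2 \<le> energy (tc g) / (1 - (cmod z)\<^sup>2)"
proof -
  have z2: "(cmod z)\<^sup>2 < 1" using z by (simp add: abs_square_less_1)
  have "(\<lambda>n. ((cmod z)\<^sup>2) ^ n) sums (1 / (1 - (cmod z)\<^sup>2))" by (rule geometric_sums) (use z2 in auto)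
  then have "(\<lambda>n. (cmod (z ^ n))\<^sup>2) sums (1 / (1 - (cmod z)\<^sup>2))"
    by (simp add: norm_power power_mult[symmetric] mult.commute)
  then have y: "l2_seq (\<lambda>n. z ^ n)" "energy (\<lambda>n. z ^ n) = 1 / (1 - (cmod z)\<^sup>2)"
    by (auto simp: l2_seq_def energy_def sums_iff)
  have "cmod (g z) \<le> sqrt (energy (tc g)) * sqrt (energy (\<lambda>n. z ^ n))"
    using l2_pairing_bound(2)[OF sg y(1)] sums_unique[OF tc_sums[OF g z]] by simp
  then have "(cmod (g z))\<^sup>2 \<le> (sqrt (energy (tc g)) * sqrt (energy (\<lambda>n. z ^ n)))\<^sup>2"
    by (intro power_mono) auto
  also have "\<dots> = energy (tc g) * energy (\<lambda>n. z ^ n)"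
    using energy_nonneg[OF sg] energy_nonneg[OF y(1)] by (simp add: power_mult_distrib)
  finally show ?thesis by (simp add: y(2))
qed

text \<open>The factor \<open>z\<close> keeps coefficient indices in place, so derivatives are
  compared without shifting.\<close>

lemma tc_euler_derivative:
  assumes "u holomorphic_on unit_disk"
  shows "(\<lambda>z. z * deriv u z) holomorphic_on unit_disk" "tc (\<lambda>z. z * deriv u z) n = of_nat n * tc u n"
proof -
  show "(\<lambda>z. z * deriv u z) holomorphic_on unit_disk"
    by (intro holomorphic_intros holomorphic_deriv assms) auto
  have "(\<lambda>z. z * deriv u z) has_fps_expansion fps_X * fps_deriv (fps_expansion u 0)"
    by (intro fps_expansion_intros holomorphic_has_fps_expansion assms)
  then show "tc (\<lambda>z. z * deriv u z) n = of_nat n * tc u n"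
    by (subst fps_expansion_eqI) (cases n; simp)+
qed

text \<open>The Hardy--Littlewood embedding for zero-free functions: comparing the derivatives of
  \<open>exp (s k)\<close> and \<open>exp k\<close> reduces the weighted norm of the former to the plain norm of the
  latter via the Littlewood--Paley form of both norms.\<close>

lemma hardy_littlewood_exp:
  fixes s :: real
  assumes k: "k holomorphic_on unit_disk" and s: "s \<ge> 1"
    and sg: "l2_seq (tc (\<lambda>z. exp (k z)))"
  shows "l2_seq (wt (- ((s - 1) / 2)) (tc (\<lambda>z. exp (of_real s * k z))))"
proof -
  define g where "g = (\<lambda>z. exp (k z))"
  define h where "h = (\<lambda>z. exp (of_real s * k z))"
  have g: "g holomorphic_on unit_disk" and h: "h holomorphic_on unit_disk"
    unfolding g_def h_def by (intro holomorphic_intros k)+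
  define G where "G = energy (tc g)"
  have sg: "l2_seq (tc g)" using sg by (simp add: g_def)
  have G0: "G \<ge> 0" unfolding G_def by (rule energy_nonneg[OF sg])
  define u where "u = (\<lambda>z. z * deriv g z)"
  define v where "v = (\<lambda>z. z * deriv h z)"
  have u: "u holomorphic_on unit_disk" "\<And>n. tc u n = of_nat n * tc g n"
    and v: "v holomorphic_on unit_disk" "\<And>n. tc v n = of_nat n * tc h n"
    unfolding u_def v_def by (rule tc_euler_derivative g h)+
  \<comment> \<open>Since \<open>h\<close> is \<open>g\<close> to the power \<open>s\<close>, formed
    through the common logarithm \<open>k\<close>, the chain rule gives |h'| = s |g|^(s-1)
    |g'|.\<close>
  have der: "cmod (v z) = s * (cmod (g z)) powr (s - 1) * cmod (u z)" if z: "cmod z < 1" for z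
  proof -
    have dk: "(k has_field_derivative deriv k z) (at z)"
      using k z by (intro holomorphic_derivI[of _ unit_disk]) auto
    have "deriv g z = exp (k z) * deriv k z" "deriv h z = exp (of_real s * k z) * (of_real s * deriv k z)"
      unfolding g_def h_def by (auto intro!: DERIV_imp_deriv derivative_eq_intros dk)
    moreover have "cmod (exp (of_real s * k z)) = (cmod (g z)) powr (s - 1) * cmod (exp (k z))"
      by (simp add: g_def powr_def exp_add[symmetric] algebra_simps)
    ultimately show ?thesis using s unfolding u_def v_def by (simp add: norm_mult)
  qed
  \<comment> \<open>Arises from |g|^2 \<le> G/(1 - exp (-t)) and 1/(1 - exp (-t)) \<le> 2 s exp
    (t/(2 s))/t, raised to the power s - 1, together with s^2 from the chain rule.\<close>
  define D where "D = s\<^sup>2 * (G * (2 * s)) powr (s - 1)"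
  have D0: "D \<ge> 0" by (simp add: D_def)
  have key: "(cmod (v z))\<^sup>2 \<le> D * (t powr (1 - s) * exp (t / 2)) * (cmod (u z))\<^sup>2"
    if t: "t > 0" and z: "cmod z = exp (- (t / 2))" for z t
  proof -
    have z1: "cmod z < 1" using t z by simp
    have "exp (- t) \<le> 1 / (1 + t)"
      using exp_ge_add_one_self[of t] t by (simp add: exp_minus inverse_eq_divide frac_le)
    then have e: "1 - exp (- t) \<ge> t / (1 + t)" using t by (simp add: field_simps)
    \<comment> \<open>The rate 1/(2 s) is chosen so that the power s - 1 of the exponential stays
      below \<open>exp (t / 2)\<close>, a growth that the decay of the series can absorb.\<close>
    have "1 + t \<le> 2 * s * (1 + t / (2 * s))" using s by (simp add: field_simps)
    also have "\<dots> \<le> 2 * s * exp (t / (2 * s))"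
      using s by (intro mult_left_mono exp_ge_add_one_self) auto
    finally have f: "1 + t \<le> 2 * s * exp (t / (2 * s))" .
    have "(cmod (g z))\<^sup>2 \<le> G / (1 - (cmod z)\<^sup>2)"
      unfolding G_def by (rule point_evaluation_bound[OF g sg z1])
    also have "(cmod z)\<^sup>2 = exp (- t)" unfolding z by (simp add: power2_eq_square exp_add[symmetric])
    also have "G / (1 - exp (- t)) \<le> G / (t / (1 + t))"
      using e t G0 by (intro divide_left_mono mult_pos_pos) (auto simp: field_simps)
    also have "\<dots> = G * (1 + t) / t" using t by (simp add: field_simps)
    also have "\<dots> \<le> G * (2 * s * exp (t / (2 * s))) / t"
      using f t G0 by (intro divide_right_mono mult_left_mono) auto
    finally have g2: "(cmod (g z))\<^sup>2 \<le> (G * (2 * s)) * (exp (t / (2 * s)) * (1 / t))" by (simp add: mult_ac)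
    have "((cmod (g z)) powr (s - 1))\<^sup>2 = ((cmod (g z))\<^sup>2) powr (s - 1)"
      by (simp add: power2_eq_square powr_mult)
    also have "\<dots> \<le> ((G * (2 * s)) * (exp (t / (2 * s)) * (1 / t))) powr (s - 1)"
      using g2 s by (intro powr_mono2) auto
    also have "\<dots> = (G * (2 * s)) powr (s - 1) * (exp (t / (2 * s)) powr (s - 1) * (1 / t) powr (s - 1))"
      using G0 s t by (simp only: powr_mult)
    also have "(1 / t) powr (s - 1) = t powr (1 - s)"
      using t by (simp add: powr_divide powr_diff powr_minus field_simps)
    also have "exp (t / (2 * s)) powr (s - 1) \<le> exp (t / 2)"
    proof -
      have "t / (2 * s) * (s - 1) \<le> t / 2" using s t by (simp add: field_simps)
      then show ?thesis by (simp add: powr_def mult.commute)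
    qed
    finally have "((cmod (g z)) powr (s - 1))\<^sup>2 \<le> (G * (2 * s)) powr (s - 1) * (exp (t / 2) * t powr (1 - s))"
      by (simp add: mult_left_mono mult_right_mono)
    then have "s\<^sup>2 * ((cmod (g z)) powr (s - 1))\<^sup>2 \<le> D * (t powr (1 - s) * exp (t / 2))"
      unfolding D_def mult.assoc by (intro mult_left_mono) (auto simp: mult_ac)
    then have "s\<^sup>2 * ((cmod (g z)) powr (s - 1))\<^sup>2 * (cmod (u z))\<^sup>2 \<le> D * (t powr (1 - s) * exp (t / 2)) * (cmod (u z))\<^sup>2"
      by (rule mult_right_mono) auto
    then show ?thesis unfolding der[OF z1] by (simp only: power_mult_distrib)
  qed
  \<comment> \<open>The zeroth coefficients of \<open>u\<close> and \<open>v\<close> vanish, so the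
    series start at index 1 and all exponents are positive, as the Gamma integral requires.\<close>
  define A where "A = (\<lambda>n. (cmod (tc v (Suc n)))\<^sup>2)"
  define B where "B = (\<lambda>n. D * (cmod (tc u (Suc n)))\<^sup>2)"
  have AB: "A n \<ge> 0" "B n \<ge> 0" for n using D0 by (auto simp: A_def B_def)
  have r: "0 \<le> exp (- (t / 2))" "exp (- (t / 2)) < 1" if "t > 0" for t :: real using that by auto
  have ser: "(\<lambda>n. (cmod (tc f (Suc n)))\<^sup>2 * exp (- (real (Suc n) * t))) sums
      (cint (\<lambda>\<theta>. (cmod (f (of_real (exp (- (t / 2))) * cis \<theta>)))\<^sup>2) / (2 * pi))"
    if f: "f holomorphic_on unit_disk" "tc f 0 = 0" and t: "t > 0" for f t
  proof -
    have "(\<lambda>n. 2 * pi * ((cmod (tc f n))\<^sup>2 * exp (- (real n * t))) / (2 * pi)) sums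
      (cint (\<lambda>\<theta>. (cmod (f (of_real (exp (- (t / 2))) * cis \<theta>)))\<^sup>2) / (2 * pi))"
      using parseval[OF f(1) r[OF t]] unfolding exp_half_power by (rule sums_divide)
    then have "(\<lambda>n. (cmod (tc f n))\<^sup>2 * exp (- (real n * t))) sums
      (cint (\<lambda>\<theta>. (cmod (f (of_real (exp (- (t / 2))) * cis \<theta>)))\<^sup>2) / (2 * pi))"
      by simp
    then show ?thesis by (subst sums_Suc_iff) (simp add: f(2))
  qed
  have u0: "tc u 0 = 0" "tc v 0 = 0" by (simp_all add: u v)
  note serv = ser[OF v(1) u0(2)] and seru = ser[OF u(1) u0(1)]
  \<comment> \<open>The factor \<open>exp (t / 2)\<close> from \<open>key\<close> lowers the
    exponent \<open>n + 1\<close> to \<open>n + 1 / 2\<close>, which is still positive.\<close>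
  have eB: "B n * exp (- ((real n + 1 / 2) * t)) = D * exp (t / 2) * ((cmod (tc u (Suc n)))\<^sup>2 * exp (- (real (Suc n) * t)))" for n t
  proof -
    have "- ((real n + 1 / 2) * t) = t / 2 + - (real (Suc n) * t)" by (simp add: algebra_simps)
    then have "exp (- ((real n + 1 / 2) * t)) = exp (t / 2) * exp (- (real (Suc n) * t))"
      by (simp only: exp_add)
    then show ?thesis by (simp only: B_def mult_ac)
  qed
  have sA: "summable (\<lambda>n. A n * exp (- (real (Suc n) * t)))" if "t > 0" for t
    unfolding A_def by (rule sums_summable[OF serv[OF that]])
  have sB: "summable (\<lambda>n. B n * exp (- ((real n + 1 / 2) * t)))" if "t > 0" for t
    unfolding eB by (intro summable_mult sums_summable[OF seru[OF that]])
  \<comment> \<open>The factor \<open>t powr (1 - s)\<close> of \<open>key\<close> is compensated by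
    \<open>t powr s\<close> on the left. After integration, parameter s + 1 turns the n^2 of the
    derivative into n^(1 - s), whereas parameter 2 on the right cancels n^2 up to a constant and
    leaves the plain energy of \<open>g\<close>.\<close>
  have cmp: "t powr ((s + 1) - 1) * (\<Sum>n. A n * exp (- (real (Suc n) * t))) \<le>
      t powr (2 - 1) * (\<Sum>n. B n * exp (- ((real n + 1 / 2) * t)))" if t: "t > 0" for t
  proof -
    let ?U = "\<lambda>t. (\<Sum>n. (cmod (tc u (Suc n)))\<^sup>2 * exp (- (real (Suc n) * t)))"
    let ?x = "\<lambda>\<theta>. of_real (exp (- (t / 2))) * cis \<theta>"
    define E where "E = D * (t powr (1 - s) * exp (t / 2))"
    have "cint (\<lambda>\<theta>. (cmod (v (?x \<theta>)))\<^sup>2) \<le> cint (\<lambda>\<theta>. E * (cmod (u (?x \<theta>)))\<^sup>2)"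
    proof (rule integral_mono)
      show "(cmod (v (?x \<theta>)))\<^sup>2 \<le> E * (cmod (u (?x \<theta>)))\<^sup>2" for \<theta>
        unfolding E_def by (rule key[OF t]) (simp add: norm_mult)
    qed (intro circ_intros continuous_on_circle u v r[OF t])+
    then have "cint (\<lambda>\<theta>. (cmod (v (?x \<theta>)))\<^sup>2) / (2 * pi) \<le> E * (cint (\<lambda>\<theta>. (cmod (u (?x \<theta>)))\<^sup>2) / (2 * pi))"
      by (simp add: divide_right_mono)
    then have "(\<Sum>n. A n * exp (- (real (Suc n) * t))) \<le> E * ?U t"
      unfolding A_def sums_unique[OF serv[OF t], symmetric] sums_unique[OF seru[OF t], symmetric] .
    then have "t powr s * (\<Sum>n. A n * exp (- (real (Suc n) * t))) \<le>
        t powr s * (E * ?U t)"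
      by (rule mult_left_mono) auto
    also have "\<dots> = (t powr s * t powr (1 - s)) * (D * exp (t / 2) * ?U t)"
      by (simp only: E_def mult_ac)
    also have "t powr s * t powr (1 - s) = t powr (2 - 1)" using t by (simp add: powr_add[symmetric])
    also have "D * exp (t / 2) * ?U t = (\<Sum>n. B n * exp (- ((real n + 1 / 2) * t)))"
      unfolding eB by (rule suminf_mult[symmetric, OF sums_summable[OF seru[OF t]]])
    finally show ?thesis by simp
  qed
  have fin: "summable (\<lambda>n. B n * gamma_weight 2 (real n + 1 / 2))"
  proof (rule summable_comparison_test'[where N=0])
    show "summable (\<lambda>n. 4 * D * Gamma 2 * (cmod (tc g (Suc n)))\<^sup>2)"
      using sg unfolding l2_seq_def by (intro summable_mult) (subst summable_Suc_iff)
    show "norm (B n * gamma_weight 2 (real n + 1 / 2)) \<le> 4 * D * Gamma 2 * (cmod (tc g (Suc n)))\<^sup>2" for n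
    proof -
      have "(real (Suc n))\<^sup>2 / (real n + 1 / 2) powr 2 \<le> 4"
      proof -
        have "(real (Suc n))\<^sup>2 \<le> (2 * (real n + 1 / 2))\<^sup>2" by (intro power_mono) auto
        then show ?thesis by (simp add: powr_numeral field_simps power_mult_distrib)
      qed
      then have "(D * Gamma 2 * (cmod (tc g (Suc n)))\<^sup>2) * ((real (Suc n))\<^sup>2 / (real n + 1 / 2) powr 2) \<le> (D * Gamma 2 * (cmod (tc g (Suc n)))\<^sup>2) * 4"
        using D0 Gamma_real_pos[of 2] by (intro mult_left_mono) auto
      moreover have "B n * gamma_weight 2 (real n + 1 / 2) = (D * Gamma 2 * (cmod (tc g (Suc n)))\<^sup>2) * ((real (Suc n))\<^sup>2 / (real n + 1 / 2) powr 2)"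
        by (simp add: B_def u(2) norm_mult power_mult_distrib del: of_nat_Suc)
      ultimately have "B n * gamma_weight 2 (real n + 1 / 2) \<le> 4 * D * Gamma 2 * (cmod (tc g (Suc n)))\<^sup>2"
        by (simp only: mult_ac)
      moreover have "B n * gamma_weight 2 (real n + 1 / 2) \<ge> 0"
        using AB(2)[of n] Gamma_real_pos[of 2] by simp
      ultimately show ?thesis by (simp only: real_norm_def abs_of_nonneg)
    qed
  qed
  have "summable (\<lambda>n. A n * (Gamma (s + 1) / real (Suc n) powr (s + 1)))"
    by (rule laplace_series_compare(1)[of A B "\<lambda>n. real (Suc n)" "\<lambda>n. real n + 1 / 2", OF AB(1) AB(2) _ _ _ _ sA sB cmp fin])
      (use s in auto)
  then have "summable (\<lambda>n. Gamma (s + 1) * (A n / real (Suc n) powr (s + 1)))"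
    by (simp add: mult.commute mult.left_commute)
  then have S: "summable (\<lambda>n. A n / real (Suc n) powr (s + 1))"
    using Gamma_real_pos[of "s + 1"] s by (subst (asm) summable_cmult_iff) (auto simp: less_le)
  have "summable (\<lambda>n. (cmod (wt (- ((s - 1) / 2)) (tc h) (Suc n)))\<^sup>2)"
  proof (rule summable_comparison_test'[OF S, where N=0])
    show "norm ((cmod (wt (- ((s - 1) / 2)) (tc h) (Suc n)))\<^sup>2) \<le> A n / real (Suc n) powr (s + 1)" for n
    proof -
      have e: "2 * (- ((s - 1) / 2)) = 1 - s" by (simp add: field_simps)
      have "(cmod (wt (- ((s - 1) / 2)) (tc h) (Suc n)))\<^sup>2 = real (Suc (Suc n)) powr (1 - s) * (cmod (tc h (Suc n)))\<^sup>2"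
        by (simp only: wt_norm_square e)
      also have "\<dots> \<le> real (Suc n) powr (1 - s) * (cmod (tc h (Suc n)))\<^sup>2"
        using s by (intro mult_right_mono powr_mono2') auto
      also have "real (Suc n) powr (1 - s) = (real (Suc n))\<^sup>2 / real (Suc n) powr (s + 1)"
      proof -
        have "(real (Suc n))\<^sup>2 = real (Suc n) powr 2" by (simp add: powr_numeral)
        then show ?thesis by (simp only: powr_diff[symmetric]) (simp add: algebra_simps)
      qed
      also have "(real (Suc n))\<^sup>2 / real (Suc n) powr (s + 1) * (cmod (tc h (Suc n)))\<^sup>2 = A n / real (Suc n) powr (s + 1)"
        by (simp add: A_def v(2) norm_mult power_mult_distrib del: of_nat_Suc)
      finally show ?thesis by simp
    qed
  qed
  then have "summable (\<lambda>n. (cmod (wt (- ((s - 1) / 2)) (tc h) n))\<^sup>2)"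
    by (subst (asm) summable_Suc_iff)
  then show ?thesis by (simp add: l2_seq_def h_def)
qed

section \<open>Co-analytic Toeplitz operators\<close>

lemma wt_inverse_mult: "wt (-\<kappa>) x n * wt \<kappa> y n = x n * y n"
proof -
  have "complex_of_real (real (Suc n) powr - \<kappa>) * complex_of_real (real (Suc n) powr \<kappa>) = 1"
    by (simp add: of_real_mult[symmetric] powr_add[symmetric] del: of_real_mult of_nat_Suc)
  then show ?thesis unfolding wt_def by (simp add: mult_ac)
qed

lemma wt_shift:
  assumes f: "l2_seq (wt \<kappa> f)" and \<kappa>: "\<kappa> \<ge> 0"
  shows "l2_seq (wt \<kappa> (\<lambda>n. f (m + n)))" "energy (wt \<kappa> (\<lambda>n. f (m + n))) \<le> energy (wt \<kappa> f)"
proof -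
  have le: "cmod (wt \<kappa> (\<lambda>n. f (m + n)) n) \<le> cmod (wt \<kappa> f (m + n))" for n
    unfolding wt_def norm_mult norm_of_real using \<kappa>
    by (intro mult_right_mono) (auto intro!: powr_mono2)
  note s = l2_seq_shift[OF f, of m]
  note t = l2_seq_mono[OF s(1) le]
  show "l2_seq (wt \<kappa> (\<lambda>n. f (m + n)))" by (rule t(1))
  show "energy (wt \<kappa> (\<lambda>n. f (m + n))) \<le> energy (wt \<kappa> f)" using t(2) s(2) by linarith
qed

text \<open>The two weights are dual, and shifting \<open>f\<close> does not increase its weighted
  energy because the weights grow. Uniformity in \<open>m\<close> is what makes the double series in
  \<open>dilated_pairing_tendsto\<close> converge.\<close>

lemma weighted_pairing:
  assumes x: "l2_seq (wt (-\<kappa>) x)" and f: "l2_seq (wt \<kappa> f)" and \<kappa>: "\<kappa> \<ge> 0"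
  shows "summable (\<lambda>n. cmod (x n * f (m + n)))"
    "(\<Sum>n. cmod (x n * f (m + n))) \<le> sqrt (energy (wt (-\<kappa>) x)) * sqrt (energy (wt \<kappa> f))"
proof -
  note s = wt_shift[OF f \<kappa>, of m]
  note cs = l2_Cauchy_Schwarz[OF x s(1), unfolded wt_inverse_mult]
  show "summable (\<lambda>n. cmod (x n * f (m + n)))" by (rule cs(1))
  have "sqrt (energy (wt (-\<kappa>) x)) * sqrt (energy (wt \<kappa> (\<lambda>n. f (m + n)))) \<le> sqrt (energy (wt (-\<kappa>) x)) * sqrt (energy (wt \<kappa> f))"
    using s(2) by (intro mult_left_mono real_sqrt_le_mono) (auto intro: energy_nonneg x)
  then show "(\<Sum>n. cmod (x n * f (m + n))) \<le> sqrt (energy (wt (-\<kappa>) x)) * sqrt (energy (wt \<kappa> f))"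
    using cs(2) by linarith
qed

lemma eventually_at_left_1: "eventually (\<lambda>r::real. 0 < r \<and> r < 1) (at_left 1)"
  using eventually_at_left_real[of 0 "1::real"] by (auto elim: eventually_mono)

lemma abel_pairing_tendsto:
  assumes a: "l2_seq a" and y: "l2_seq y"
  shows "((\<lambda>r::real. \<Sum>k. a k * of_real r ^ k * y k) \<longlongrightarrow> (\<Sum>k. a k * y k)) (at_left 1)"
proof -
  have "((\<lambda>r::real. \<Sum>k. y k * (a k * of_real r ^ k)) \<longlongrightarrow> (\<Sum>k. y k * (a k * of_real 1 ^ k))) (at_left 1)"
  proof (rule bounded_imp_weak_convergence(3)[OF y])
    show "eventually (\<lambda>r::real. l2_seq (\<lambda>k. a k * of_real r ^ k) \<and> energy (\<lambda>k. a k * of_real r ^ k) \<le> energy a) (at_left 1)"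
      using eventually_at_left_1
    proof eventually_elim
      case (elim r)
      then have "cmod (a k * of_real r ^ k) \<le> cmod (a k)" for k
        by (auto simp: norm_mult norm_power intro!: mult_right_le_one_le power_le_one)
      from l2_seq_mono[OF a this] show ?case by auto
    qed
    show "((\<lambda>r::real. a k * of_real r ^ k) \<longlongrightarrow> a k * of_real 1 ^ k) (at_left 1)" for k
      by (intro tendsto_intros)
  qed simp
  then show ?thesis by (simp add: mult_ac)
qed

text \<open>For r < 1 the coefficients \<open>a k * r ^ k\<close> are absolutely summable, so
  \<open>conv_pairing_sums\<close> rearranges the double series. The bound \<open>C\<close>, uniform
  in r, then gives the limit on the convolution side weakly, without absolute convergence at r =
  1.\<close>

lemma dilated_pairing_tendsto:
  fixes a x f :: "nat \<Rightarrow> complex"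
  assumes a: "\<And>r. 0 < r \<Longrightarrow> r < 1 \<Longrightarrow> summable (\<lambda>k. cmod (a k) * r ^ k)"
    and x: "l2_seq (wt (-\<kappa>) x)" and f: "l2_seq (wt \<kappa> f)" and \<kappa>: "\<kappa> \<ge> 0"
    and bd: "\<And>r. 0 < r \<Longrightarrow> r < 1 \<Longrightarrow> l2_seq (wt (-\<kappa>) (conv (\<lambda>k. a k * of_real r ^ k) x)) \<and>
        energy (wt (-\<kappa>) (conv (\<lambda>k. a k * of_real r ^ k) x)) \<le> C"
  shows "((\<lambda>r. \<Sum>k. a k * of_real r ^ k * (\<Sum>l. x l * f (m + k + l))) \<longlongrightarrow> (\<Sum>n. conv a x n * f (m + n))) (at_left 1)"
proof -
  define F where "F = wt \<kappa> (\<lambda>n. f (m + n))"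
  have F: "l2_seq F" unfolding F_def by (rule wt_shift[OF f \<kappa>])
  define c where "c = (\<lambda>r. conv (\<lambda>k. a k * of_real r ^ k) x)"
  have lim: "((\<lambda>r. \<Sum>n. F n * wt (-\<kappa>) (c r) n) \<longlongrightarrow> (\<Sum>n. F n * wt (-\<kappa>) (conv a x) n)) (at_left 1)"
  proof (rule bounded_imp_weak_convergence(3)[OF F])
    show "eventually (\<lambda>r. l2_seq (wt (-\<kappa>) (c r)) \<and> energy (wt (-\<kappa>) (c r)) \<le> C) (at_left 1)"
      using eventually_at_left_1 by eventually_elim (use bd in \<open>auto simp: c_def\<close>)
    show "((\<lambda>r. wt (-\<kappa>) (c r) n) \<longlongrightarrow> wt (-\<kappa>) (conv a x) n) (at_left 1)" for n
    proof -
      have "((\<lambda>r. wt (-\<kappa>) (c r) n) \<longlongrightarrow> of_real (real (Suc n) powr (-\<kappa>)) * (\<Sum>i\<le>n. a i * of_real 1 ^ i * x (n - i))) (at_left 1)"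
        unfolding wt_def c_def conv_def by (intro tendsto_intros)
      then show ?thesis by (simp add: wt_def conv_def)
    qed
  qed simp
  have "F n * wt (-\<kappa>) z n = z n * f (m + n)" for z n
    unfolding F_def by (subst mult.commute) (rule wt_inverse_mult)
  with lim have "((\<lambda>r. \<Sum>n. c r n * f (m + n)) \<longlongrightarrow> (\<Sum>n. conv a x n * f (m + n))) (at_left 1)"
    by simp
  then show ?thesis
  proof (rule Lim_transform_eventually)
    show "eventually (\<lambda>r. (\<Sum>n. c r n * f (m + n)) = (\<Sum>k. a k * of_real r ^ k * (\<Sum>l. x l * f (m + k + l)))) (at_left 1)"
      using eventually_at_left_1
    proof eventually_elim
      case (elim r)
      define B where "B = sqrt (energy (wt (-\<kappa>) x)) * sqrt (energy (wt \<kappa> f))"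
      note wp = weighted_pairing[OF x f \<kappa>]
      have "summable (\<lambda>k. cmod (a k * of_real r ^ k) * (\<Sum>l. cmod (x l * f (m + (k + l)))))"
      proof (rule summable_comparison_test'[where N=0])
        show "summable (\<lambda>k. cmod (a k) * r ^ k * B)"
          using elim by (intro summable_mult2 a) auto
        show "norm (cmod (a k * of_real r ^ k) * (\<Sum>l. cmod (x l * f (m + (k + l))))) \<le> cmod (a k) * r ^ k * B" for k
        proof -
          have "0 \<le> (\<Sum>l. cmod (x l * f (m + k + l)))" by (rule suminf_nonneg[OF wp(1)]) auto
          moreover have "(\<Sum>l. cmod (x l * f (m + k + l))) \<le> B" unfolding B_def by (rule wp(2))
          ultimately show ?thesis using elim
            by (auto simp: norm_mult norm_power abs_mult add.assoc intro!: mult_left_mono)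
        qed
      qed
      moreover have "summable (\<lambda>l. cmod (x l * f (m + (k + l))))" for k
        using wp(1)[of "m + k"] by (simp add: add.assoc)
      ultimately have "(\<lambda>n. c r n * f (m + n)) sums (\<Sum>k. a k * of_real r ^ k * (\<Sum>l. x l * f (m + (k + l))))"
        unfolding c_def by (intro conv_pairing_sums[where f="\<lambda>n. f (m + n)"])
      then show ?case by (simp add: sums_iff add.assoc)
    qed
  qed
qed

lemma wt_cnj: "wt \<kappa> (\<lambda>n. cnj (x n)) = (\<lambda>n. cnj (wt \<kappa> x n))"
  by (simp add: wt_def fun_eq_iff)

text \<open>Reads a damped convolution as the coefficients of a(r z) x(z), so that
  \<open>weighted_domination\<close> can supply the bounds uniform in \<open>r\<close>.\<close>

lemma dilated_product_coeffs:
  assumes "a holomorphic_on unit_disk" "x holomorphic_on unit_disk" "0 < r" "r < 1"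
  shows "conv (\<lambda>k. cnj (tc a k) * of_real r ^ k) (\<lambda>n. cnj (tc x n)) = (\<lambda>n. cnj (tc (\<lambda>z. a (of_real r * z) * x z) n))"
proof
  fix n
  have "tc (\<lambda>z. a (of_real r * z) * x z) n = conv (tc (\<lambda>z. a (of_real r * z))) (tc x) n"
    by (intro tc_mult dilate_holomorphic assms) (use assms in auto)
  also have "tc (\<lambda>z. a (of_real r * z)) = (\<lambda>k. of_real r ^ k * tc a k)"
    by (intro ext tc_dilate assms) (use assms in auto)
  finally show "conv (\<lambda>k. cnj (tc a k) * of_real r ^ k) (\<lambda>n. cnj (tc x n)) n = cnj (tc (\<lambda>z. a (of_real r * z) * x z) n)"
    by (simp add: cnj_conv mult.commute)
qed

text \<open>In operator terms: if \<open>y\<close> is the image of \<open>F\<close> under the co-analytic Toeplitz operator with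
  symbol conjugate to \<open>\<phi>\<close>, and \<open>b = a \<phi>\<close>, then the operators with symbols conjugate to \<open>a\<close>
  and \<open>b\<close> agree on \<open>y\<close> and \<open>F\<close>.\<close>

lemma coanalytic_toeplitz_product:
  assumes a: "a holomorphic_on unit_disk" and \<phi>: "\<phi> holomorphic_on unit_disk"
    and aA: "\<And>z. cmod z < 1 \<Longrightarrow> cmod (a z) \<le> A"
    and s\<phi>: "l2_seq (wt (-\<kappa>) (tc \<phi>))" and sF: "l2_seq (wt \<kappa> F)" and \<kappa>: "\<kappa> \<ge> 0"
    and sy: "l2_seq (\<lambda>k. \<Sum>l. cnj (tc \<phi> l) * F (k + l))"
  shows "(\<Sum>k. cnj (tc a k) * (\<Sum>l. cnj (tc \<phi> l) * F (m + k + l))) = (\<Sum>n. cnj (tc (\<lambda>z. a z * \<phi> z) n) * F (m + n))"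
proof (rule tendsto_unique)
  define y where "y = (\<lambda>k. \<Sum>l. cnj (tc \<phi> l) * F (k + l))"
  have sa: "l2_seq (tc a)" by (rule bounded_imp_l2_seq[OF a aA])
  \<comment> \<open>The two sides are limits of one and the same expression. This side is Abel
    summation against the square summable \<open>y\<close>; the other comes from the dilated
    products below.\<close>
  have "((\<lambda>r. \<Sum>k. cnj (tc a k) * of_real r ^ k * y (m + k)) \<longlongrightarrow> (\<Sum>k. cnj (tc a k) * y (m + k))) (at_left 1)"
    by (rule abel_pairing_tendsto) (use sa sy l2_seq_shift(1) in \<open>auto simp: y_def[symmetric]\<close>)
  then show "((\<lambda>r. \<Sum>k. cnj (tc a k) * of_real r ^ k * (\<Sum>l. cnj (tc \<phi> l) * F (m + k + l))) \<longlongrightarrow>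
      (\<Sum>k. cnj (tc a k) * (\<Sum>l. cnj (tc \<phi> l) * F (m + k + l)))) (at_left 1)"
    by (simp add: y_def)
  have bd: "l2_seq (wt (-\<kappa>) (conv (\<lambda>k. cnj (tc a k) * of_real r ^ k) (\<lambda>n. cnj (tc \<phi> n)))) \<and>
      energy (wt (-\<kappa>) (conv (\<lambda>k. cnj (tc a k) * of_real r ^ k) (\<lambda>n. cnj (tc \<phi> n)))) \<le> A\<^sup>2 * energy (wt (-\<kappa>) (tc \<phi>))"
    if r: "0 < r" "r < 1" for r
  proof -
    have h: "(\<lambda>z. a (of_real r * z) * \<phi> z) holomorphic_on unit_disk"
      by (intro holomorphic_intros dilate_holomorphic a \<phi>) (use r in auto)
    have "cmod (a (of_real r * z) * \<phi> z) \<le> A * cmod (\<phi> z)" if z: "cmod z < 1" for z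
    proof -
      have "cmod (of_real r * z) < 1"
        using r z mult_strict_mono'[of r 1 "cmod z" 1] by (simp add: norm_mult)
      from aA[OF this] show ?thesis by (simp add: norm_mult mult_right_mono)
    qed
    from weighted_domination[OF \<phi> h this \<kappa> s\<phi>] show ?thesis
      unfolding dilated_product_coeffs[OF a \<phi> r] wt_cnj by auto
  qed
  have "((\<lambda>r. \<Sum>k. cnj (tc a k) * of_real r ^ k * (\<Sum>l. cnj (tc \<phi> l) * F (m + k + l))) \<longlongrightarrow>
      (\<Sum>n. conv (\<lambda>k. cnj (tc a k)) (\<lambda>l. cnj (tc \<phi> l)) n * F (m + n))) (at_left 1)"
    by (rule dilated_pairing_tendsto[OF _ _ sF \<kappa> bd]) (use tc_abs_summable[OF a] s\<phi> in \<open>auto simp: wt_cnj\<close>)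
  then show "((\<lambda>r. \<Sum>k. cnj (tc a k) * of_real r ^ k * (\<Sum>l. cnj (tc \<phi> l) * F (m + k + l))) \<longlongrightarrow>
      (\<Sum>n. cnj (tc (\<lambda>z. a z * \<phi> z) n) * F (m + n))) (at_left 1)"
    by (simp add: tc_mult[OF a \<phi>] cnj_conv)
qed simp

text \<open>Formally the operator of \<open>v u\<close> is that of \<open>v\<close> after that of
  \<open>u\<close>, but \<open>v\<close> is only in H^2. Dilating \<open>v\<close> makes the
  rearrangement legitimate, and the bound of the product by B times the norm of \<open>v\<close>
  persists as r tends to 1.\<close>

lemma coanalytic_toeplitz_zero_mult:
  assumes u: "u holomorphic_on unit_disk" and v: "v holomorphic_on unit_disk"
    and uB: "\<And>z. cmod z < 1 \<Longrightarrow> cmod (u z) \<le> B"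
    and sv: "l2_seq (tc v)" and sy: "l2_seq y"
    and zero: "\<And>m. (\<Sum>l. cnj (tc u l) * y (m + l)) = 0"
  shows "(\<Sum>n. cnj (tc (\<lambda>z. v z * u z) n) * y (m + n)) = 0"
proof (rule tendsto_unique)
  have su: "l2_seq (tc u)" by (rule bounded_imp_l2_seq[OF u uB])
  have bd: "l2_seq (wt (-0) (conv (\<lambda>k. cnj (tc v k) * of_real r ^ k) (\<lambda>n. cnj (tc u n)))) \<and>
      energy (wt (-0) (conv (\<lambda>k. cnj (tc v k) * of_real r ^ k) (\<lambda>n. cnj (tc u n)))) \<le> B\<^sup>2 * energy (tc v)"
    if r: "0 < r" "r < 1" for r
  proof -
    have vr: "(\<lambda>z. v (of_real r * z)) holomorphic_on unit_disk"
      by (intro dilate_holomorphic v) (use r in auto)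
    have h: "(\<lambda>z. v (of_real r * z) * u z) holomorphic_on unit_disk"
      by (intro holomorphic_intros vr u)
    have "cmod (tc (\<lambda>z. v (of_real r * z)) n) \<le> cmod (tc v n)" for n
      using r by (subst tc_dilate[OF v]) (auto simp: norm_mult norm_power intro!: mult_left_le_one_le power_le_one)
    note svr = l2_seq_mono[OF sv this]
    have "cmod (v (of_real r * z) * u z) \<le> B * cmod (v (of_real r * z))" if "cmod z < 1" for z
      using uB[OF that] by (simp add: norm_mult mult.commute mult_right_mono)
    note wd = weighted_domination[OF vr h this, of 0, simplified, OF svr(1)]
    have "l2_seq (tc (\<lambda>z. v (of_real r * z) * u z))" by (rule wd(1))
    moreover have "energy (tc (\<lambda>z. v (of_real r * z) * u z)) \<le> B\<^sup>2 * energy (tc v)"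
    proof -
      have "energy (tc (\<lambda>z. v (of_real r * z) * u z)) \<le> B\<^sup>2 * energy (tc (\<lambda>z. v (of_real r * z)))" by (rule wd(2))
      also have "\<dots> \<le> B\<^sup>2 * energy (tc v)" using svr(2) by (intro mult_left_mono) auto
      finally show ?thesis .
    qed
    ultimately show ?thesis unfolding dilated_product_coeffs[OF v u r] by simp
  qed
  have "((\<lambda>r. \<Sum>k. cnj (tc v k) * of_real r ^ k * (\<Sum>l. cnj (tc u l) * y (m + k + l))) \<longlongrightarrow>
      (\<Sum>n. conv (\<lambda>k. cnj (tc v k)) (\<lambda>l. cnj (tc u l)) n * y (m + n))) (at_left 1)"
    by (rule dilated_pairing_tendsto[where \<kappa>=0, OF _ _ _ _ bd]) (use tc_abs_summable[OF v] su sy in auto)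
  then show "((\<lambda>r::real. 0::complex) \<longlongrightarrow> (\<Sum>n. cnj (tc (\<lambda>z. v z * u z) n) * y (m + n))) (at_left 1)"
    by (simp add: tc_mult[OF v u] cnj_conv zero)
qed simp_all

lemma exp_scaled_bound:
  assumes "0 \<le> \<theta>" "\<theta> \<le> 1" "exp x \<le> A" shows "exp (\<theta> * x) \<le> max 1 (A :: real)"
proof (cases "x \<le> 0")
  case True
  then have "exp (\<theta> * x) \<le> 1" using assms by (simp add: mult_nonneg_nonpos)
  then show ?thesis by (rule order_trans) simp
next
  case False
  then have "\<theta> * x \<le> x" using assms by (intro mult_left_le_one_le) auto
  then have "exp (\<theta> * x) \<le> A" using assms(3) by (meson exp_le_cancel_iff order_trans)
  then show ?thesis by (rule order_trans) simp
qed

text \<open>A sequence annihilated by the operator with symbol \<open>exp l\<close> stays annihilated while the symbol is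
  stripped of one factor \<open>exp (l / N)\<close> after the other.\<close>

lemma coanalytic_toeplitz_exp_injective:
  assumes l: "l holomorphic_on unit_disk" and bd: "\<And>z. cmod z < 1 \<Longrightarrow> cmod (exp (l z)) \<le> A"
    and N: "N > 0" and sv: "l2_seq (tc (\<lambda>z. exp (- of_real (1 / real N) * l z)))"
    and sy: "l2_seq y" and zero: "\<And>m. (\<Sum>k. cnj (tc (\<lambda>z. exp (l z)) k) * y (m + k)) = 0"
  shows "y m = 0"
proof -
  define v where "v = (\<lambda>z. exp (- of_real (1 / real N) * l z))"
  \<comment> \<open>With a = exp l these are the powers a^(1 - j/N), from a at j = 0 to 1 at j = N,
    all bounded by \<open>max 1 A\<close>; each step multiplies by \<open>v\<close> = a^(-1/N), for
    which membership in H^2 is enough.\<close>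
  define u where "u = (\<lambda>j z. exp (of_real (1 - real j / real N) * l z))"
  have v: "v holomorphic_on unit_disk" and u: "u j holomorphic_on unit_disk" for j
    unfolding v_def u_def by (intro holomorphic_intros l)+
  have uB: "cmod (u j z) \<le> max 1 A" if j: "j \<le> N" and z: "cmod z < 1" for j z
  proof -
    define \<theta> where "\<theta> = 1 - real j / real N"
    have \<theta>: "0 \<le> \<theta>" "\<theta> \<le> 1" using j N by (auto simp: \<theta>_def field_simps)
    have "cmod (u j z) = exp (\<theta> * Re (l z))" by (simp add: u_def \<theta>_def[symmetric])
    also have "\<dots> \<le> max 1 A" using bd[OF z] by (intro exp_scaled_bound \<theta>) simp
    finally show ?thesis .
  qed
  have step: "(\<lambda>z. v z * u j z) = u (Suc j)" for j
    unfolding v_def u_def exp_add[symmetric] using N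
    by (intro ext arg_cong[of _ _ exp]) (simp add: field_simps)
  have u0: "u 0 = (\<lambda>z. exp (l z))" by (simp add: u_def)
  have "j \<le> N \<Longrightarrow> (\<Sum>k. cnj (tc (u j) k) * y (m + k)) = 0" for j m
  proof (induction j arbitrary: m)
    case 0
    then show ?case using zero by (simp add: u0)
  next
    case (Suc j)
    have "(\<Sum>n. cnj (tc (\<lambda>z. v z * u j z) n) * y (m + n)) = 0"
      by (rule coanalytic_toeplitz_zero_mult[OF u v uB _ sy]) (use Suc sv in \<open>auto simp: v_def\<close>)
    then show ?case by (simp add: step)
  qed
  then have "(\<Sum>k. cnj (tc (u N) k) * y (m + k)) = 0" by simp
  moreover have "u N = (\<lambda>z. 1)" using N by (simp add: u_def)
  moreover have "tc (\<lambda>z. 1) = (\<lambda>k. if k = 0 then 1 else 0)"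
  proof
    fix k
    have "(\<lambda>n. (if n = 0 then 1 else 0) * z ^ n) sums 1" for z :: complex
      using sums_single[of 0 "\<lambda>_. 1 :: complex"] by (simp add: if_distrib[of "\<lambda>x. x * _"] cong: if_cong)
    then show "tc (\<lambda>z. 1) k = (if k = 0 then 1 else 0)" by (intro tc_eqI) auto
  qed
  moreover have "(\<Sum>k. cnj (if k = 0 then 1 else 0) * y (m + k)) = y m"
    by (subst suminf_finite[of "{0}"]) auto
  ultimately show ?thesis by simp
qed

section \<open>Identification of reproducing kernel Hilbert spaces\<close>

context hilbert_function_space
begin

lemma ip_zero_left: "f \<in> H \<Longrightarrow> ip (\<lambda>x\<in>X. 0) f = 0"
  using ip_scale[OF zero_mem, of f 0] by simp

lemma ip_self: "f \<in> H \<Longrightarrow> ip f f = of_real ((hnorm ip f)\<^sup>2)"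
  using ip_commute[of f f] ip_nonneg[of f]
  by (auto simp: hnorm_def complex_eq_iff)

lemma ip_add_right:
  assumes "f \<in> H" "g \<in> H" "h \<in> H"
  shows "ip h (\<lambda>x\<in>X. f x + g x) = ip h f + ip h g"
  using ip_commute[of "\<lambda>x\<in>X. f x + g x" h] ip_add[OF assms] add_mem[OF assms(1,2)] assms
    ip_commute[of f h] ip_commute[of g h] by simp

lemma ip_scale_right:
  assumes "f \<in> H" "h \<in> H"
  shows "ip h (\<lambda>x\<in>X. c * f x) = cnj c * ip h f"
  using ip_commute[of "\<lambda>x\<in>X. c * f x" h] ip_scale[OF assms, of c] scale_mem[of f c] assms
    ip_commute[of f h] by simp

lemma diff_eq: "(\<lambda>x\<in>X. f x - (g x :: complex)) = (\<lambda>x\<in>X. f x + (\<lambda>x\<in>X. (-1) * g x) x)"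
  by (auto simp: fun_eq_iff)

lemma diff_mem: "f \<in> H \<Longrightarrow> g \<in> H \<Longrightarrow> (\<lambda>x\<in>X. f x - g x) \<in> H"
  unfolding diff_eq by (intro add_mem scale_mem)

lemma ip_diff_left:
  "f \<in> H \<Longrightarrow> g \<in> H \<Longrightarrow> h \<in> H \<Longrightarrow> ip (\<lambda>x\<in>X. f x - g x) h = ip f h - ip g h"
  unfolding diff_eq by (subst ip_add) (simp_all only: scale_mem ip_scale, simp_all)

lemma ip_diff_right:
  "f \<in> H \<Longrightarrow> g \<in> H \<Longrightarrow> h \<in> H \<Longrightarrow> ip h (\<lambda>x\<in>X. f x - g x) = ip h f - ip h g"
  unfolding diff_eq by (subst ip_add_right) (simp_all only: scale_mem ip_scale_right, simp_all)

lemma Cauchy_Schwarz: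
  assumes f: "f \<in> H" and g: "g \<in> H"
  shows "cmod (ip f g) \<le> hnorm ip f * hnorm ip g"
proof (cases "ip g g = 0")
  case True
  then have "g = (\<lambda>x\<in>X. 0)" by (rule ip_definite[OF g])
  then have "ip f g = 0" using ip_zero_left[OF f] ip_commute[OF zero_mem f] by simp
  then show ?thesis by (simp add: hnorm_def ip_nonneg f g)
next
  case False
  define G where "G = (hnorm ip g)\<^sup>2"
  have G: "ip g g = of_real G" unfolding G_def by (rule ip_self[OF g])
  with False have G0: "G > 0" using ip_nonneg[OF g] by (auto simp: less_le)
  define p where "p = ip f g"
  define c where "c = p / of_real G"
  have gf: "ip g f = cnj p" unfolding p_def by (rule ip_commute[OF f g])
  define h where "h = (\<lambda>x\<in>X. c * g x)"
  have h: "h \<in> H" unfolding h_def by (rule scale_mem[OF g])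
  have d: "(\<lambda>x\<in>X. f x - h x) \<in> H" by (rule diff_mem[OF f h])
  have "ip (\<lambda>x\<in>X. f x - h x) (\<lambda>x\<in>X. f x - h x) = (ip f f - ip h f) - (ip f h - ip h h)"
    by (simp only: ip_diff_left[OF f h d] ip_diff_right[OF f h f] ip_diff_right[OF f h h]) simp
  also have "ip h f = c * cnj p" unfolding h_def by (simp only: ip_scale[OF g f] gf)
  also have "ip f h = cnj c * p" unfolding h_def by (simp only: ip_scale_right[OF g f] p_def)
  also have "ip h h = c * (cnj c * of_real G)"
    unfolding h_def by (simp only: ip_scale[OF g scale_mem[OF g]] ip_scale_right[OF g g] G)
  also have "(ip f f - c * cnj p) - (cnj c * p - c * (cnj c * of_real G)) = ip f f - of_real ((cmod p)\<^sup>2 / G)"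
    using G0 by (simp add: c_def complex_norm_square[symmetric] field_simps)
  finally have E: "ip (\<lambda>x\<in>X. f x - h x) (\<lambda>x\<in>X. f x - h x) = ip f f - of_real ((cmod p)\<^sup>2 / G)" .
  have "Re (ip f f - of_real ((cmod p)\<^sup>2 / G)) \<ge> 0" using ip_nonneg[OF d] by (simp only: E)
  then have "(cmod p)\<^sup>2 / G \<le> (hnorm ip f)\<^sup>2" using ip_self[OF f] by simp
  then have "(cmod p)\<^sup>2 \<le> (hnorm ip f * hnorm ip g)\<^sup>2"
    using G0 by (simp add: G_def field_simps power_mult_distrib)
  then show ?thesis unfolding p_def
    by (rule power2_le_imp_le) (simp add: hnorm_def ip_nonneg f g)
qed

end

lemma closure_subspace:
  fixes S :: "'a :: real_normed_vector set"
  assumes S: "subspace S" shows "subspace (closure S)"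
proof (rule subspaceI)
  show "0 \<in> closure S" using subspace_0[OF S] closure_subset by blast
next
  fix x y assume "x \<in> closure S" "y \<in> closure S"
  then obtain X Y where "\<forall>n. X n \<in> S" "X \<longlonglongrightarrow> x" "\<forall>n. Y n \<in> S" "Y \<longlonglongrightarrow> y"
    by (auto simp: closure_sequential)
  then show "x + y \<in> closure S"
    unfolding closure_sequential by (intro exI[of _ "\<lambda>n. X n + Y n"]) (auto intro: tendsto_add subspace_add[OF S])
next
  fix c x assume "x \<in> closure S"
  then obtain X where "\<forall>n. X n \<in> S" "X \<longlonglongrightarrow> x" by (auto simp: closure_sequential)
  then show "c *\<^sub>R x \<in> closure S"
    unfolding closure_sequential by (intro exI[of _ "\<lambda>n. c *\<^sub>R X n"]) (auto intro!: tendsto_scaleR subspace_scale[OF S])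
qed

text \<open>The complex inner product of the direct sum; its real part is the class operation
  \<open>inner\<close>, see \<open>inner_hip\<close>.\<close>

definition hip :: "ell2 \<times> ell2 \<Rightarrow> ell2 \<times> ell2 \<Rightarrow> complex" where
  "hip v w = pair (Rep_ell2 (fst v)) (Rep_ell2 (fst w)) + pair (Rep_ell2 (snd v)) (Rep_ell2 (snd w))"

lift_definition cscale :: "complex \<Rightarrow> ell2 \<Rightarrow> ell2" is "\<lambda>c x n. c * x n"
  by (rule l2_seq_scale)

definition csc :: "complex \<Rightarrow> ell2 \<times> ell2 \<Rightarrow> ell2 \<times> ell2" where
  "csc c v = (cscale c (fst v), cscale c (snd v))"

text \<open>The conjugate on \<open>z\<close> undoes the one built into \<open>pair\<close>, so this
  is a power series in \<open>z\<close>.\<close>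

definition ev :: "ell2 \<times> ell2 \<Rightarrow> complex \<Rightarrow> complex" where
  "ev v z = pair (Rep_ell2 (fst v)) (\<lambda>n. cnj z ^ n)"

lemma l2_seq_geometric: "cmod w < 1 \<Longrightarrow> l2_seq (\<lambda>n. w ^ n)"
proof -
  assume "cmod w < 1"
  then have "(cmod w)\<^sup>2 < 1" by (simp add: abs_square_less_1)
  then have "summable (\<lambda>n. ((cmod w)\<^sup>2) ^ n)" by (intro summable_geometric) auto
  then show ?thesis by (simp add: l2_seq_def norm_power power_mult[symmetric] mult.commute)
qed

lemma hip_add_left: "hip (u + v) w = hip u w + hip v w"
  by (simp add: hip_def plus_ell2.rep_eq pair_add_left)

lemma hip_commute: "hip w v = cnj (hip v w)"
  by (simp add: hip_def pair_commute[of "Rep_ell2 (fst v)"] pair_commute[of "Rep_ell2 (snd v)"])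

lemma hip_add_right: "hip w (u + v) = hip w u + hip w v"
  using hip_commute[of w "u + v"] hip_commute[of w u] hip_commute[of w v] by (simp add: hip_add_left)

lemma hip_csc_left: "hip (csc c v) w = c * hip v w"
  by (simp add: hip_def csc_def cscale.rep_eq pair_scale_left distrib_left)

lemma hip_csc_right: "hip w (csc c v) = cnj c * hip w v"
  using hip_commute[of w "csc c v"] hip_commute[of w v] by (simp add: hip_csc_left)

lemma hip_zero_right: "hip w 0 = 0"
  using hip_add_right[of w 0 0] by simp

lemma inner_hip: "inner v w = Re (hip v w)"
  by (simp add: hip_def inner_prod_def inner_ell2_def)

lemma scaleR_csc: "r *\<^sub>R v = csc (of_real r) v"
proof -
  have "r *\<^sub>R x = cscale (of_real r) x" for x :: ell2 by transfer simp
  then show ?thesis by (simp add: csc_def scaleR_prod_def)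
qed

lemma hip_bound: "cmod (hip v w) \<le> 2 * norm v * norm w"
proof -
  have n: "norm (fst x) \<le> norm x" "norm (snd x) \<le> norm x" for x :: "ell2 \<times> ell2"
    using norm_fst_le[of "fst x" "snd x"] norm_snd_le[of "snd x" "fst x"] by simp_all
  have "cmod (hip v w) \<le> norm (fst v) * norm (fst w) + norm (snd v) * norm (snd w)"
    unfolding hip_def by (rule norm_triangle_le) (intro add_mono norm_pair_le)
  also have "\<dots> \<le> norm v * norm w + norm v * norm w"
    by (intro add_mono mult_mono n) auto
  finally show ?thesis by simp
qed

lemma ev_linear:
  assumes "cmod z < 1"
  shows "ev (u + v) z = ev u z + ev v z" "ev (csc c v) z = c * ev v z" "ev (r *\<^sub>R v) z = of_real r * ev v z"
proof -
  have g: "l2_seq (\<lambda>n. cnj z ^ n)" by (rule l2_seq_geometric) (use assms in simp)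
  show "ev (u + v) z = ev u z + ev v z" "ev (csc c v) z = c * ev v z"
    by (simp_all add: ev_def plus_ell2.rep_eq csc_def cscale.rep_eq pair_add_left pair_scale_left g)
  show "ev (r *\<^sub>R v) z = of_real r * ev v z"
    by (simp add: scaleR_csc ev_def csc_def cscale.rep_eq pair_scale_left g)
qed

lemma ev_diff: "cmod z < 1 \<Longrightarrow> ev (u - v) z = ev u z - ev v z"
  using ev_linear(1)[of z "u - v" v] by simp

text \<open>A reproducing kernel Hilbert space is recovered from any isometric model \<open>G\<close> of its kernel
  functions in which point evaluations separate points: the kernels then span a dense subspace.\<close>

lemma rkhs_identification:
  assumes rk: "reproducing_kernel_hilbert_space unit_disk K H ip"
    and G: "subspace G" "closed G"
    and \<kappa>G: "\<And>c w. cmod w < 1 \<Longrightarrow> csc c (\<kappa> w) \<in> G"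
    and rep: "\<And>v w. v \<in> G \<Longrightarrow> cmod w < 1 \<Longrightarrow> hip v (\<kappa> w) = ev v w"
    and ker: "\<And>z w. cmod z < 1 \<Longrightarrow> cmod w < 1 \<Longrightarrow> ev (\<kappa> w) z = K z w"
    and inj: "\<And>v. v \<in> G \<Longrightarrow> (\<And>w. cmod w < 1 \<Longrightarrow> ev v w = 0) \<Longrightarrow> v = 0"
    and v: "v \<in> G"
  shows "restrict (ev v) unit_disk \<in> H" "(hnorm ip (restrict (ev v) unit_disk))\<^sup>2 = (norm v)\<^sup>2"
proof -
  interpret reproducing_kernel_hilbert_space unit_disk K H ip by (rule rk)
  define J where "J = (\<lambda>v. restrict (ev v) unit_disk)"
  \<comment> \<open>\<open>span\<close> is taken over the reals; admitting every complex multiple of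
    a kernel as a generator makes it the complex span.\<close>
  define S0 where "S0 = span {csc c (\<kappa> w) | c w. cmod w < 1}"
  have J_add: "J (u + v) = (\<lambda>z\<in>unit_disk. J u z + J v z)" for u v
    by (auto simp: J_def fun_eq_iff ev_linear)
  have J_csc: "J (csc c u) = (\<lambda>z\<in>unit_disk. c * J u z)" for c u
    by (auto simp: J_def fun_eq_iff ev_linear)
  have J_scale: "J (r *\<^sub>R u) = (\<lambda>z\<in>unit_disk. of_real r * J u z)" for r u
    unfolding scaleR_csc by (rule J_csc)
  have J_zero: "J 0 = (\<lambda>z\<in>unit_disk. 0)" using J_scale[of 0 0] by simp
  have J_ker: "J (csc c (\<kappa> w)) = (\<lambda>z\<in>unit_disk. c * (\<lambda>z\<in>unit_disk. K z w) z)" if "cmod w < 1" for c w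
    unfolding J_csc using that by (auto simp: J_def fun_eq_iff ker)
  have S0: "s \<in> G \<and> J s \<in> H" if "s \<in> S0" for s
    using that unfolding S0_def
  proof (induction s rule: span_induct)
    show "subspace {s. s \<in> G \<and> J s \<in> H}"
      by (rule subspaceI) (auto simp: J_zero J_add J_scale G zero_mem
          intro!: subspace_0[OF G(1)] subspace_add[OF G(1)] subspace_scale[OF G(1)] add_mem scale_mem)
    fix s assume "s \<in> {csc c (\<kappa> w) | c w. cmod w < 1}"
    then obtain c w where s: "s = csc c (\<kappa> w)" and w: "cmod w < 1" by blast
    have "J s \<in> H" unfolding s J_ker[OF w] using w by (intro scale_mem kernel_mem) auto
    then show "s \<in> G \<and> J s \<in> H" using \<kappa>G[OF w] s by simp
  qed
  have iso: "ip (J s) (J t) = hip s t" if s: "s \<in> S0" and t: "t \<in> S0" for s t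
  proof -
    \<comment> \<open>Up to \<open>cnj c\<close> both sides are the value of \<open>s\<close> at
      \<open>w\<close>: in \<open>H\<close> by the reproducing property, in the model by
      \<open>rep\<close>. Induction over the span extends this to all \<open>t\<close>.\<close>
    have gen: "ip (J s) (J (csc c (\<kappa> w))) = hip s (csc c (\<kappa> w))" if w: "cmod w < 1" for c w
    proof -
      have sG: "s \<in> G" "J s \<in> H" using S0[OF s] by auto
      have Kw: "(\<lambda>z\<in>unit_disk. K z w) \<in> H" using w by (intro kernel_mem) auto
      have "ip (J s) (J (csc c (\<kappa> w))) = cnj c * ip (J s) (\<lambda>z\<in>unit_disk. K z w)"
        unfolding J_ker[OF w] by (rule ip_scale_right[OF Kw sG(2)])
      also have "ip (J s) (\<lambda>z\<in>unit_disk. K z w) = J s w"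
        using reproducing[OF sG(2), of w] w by simp
      also have "J s w = hip s (\<kappa> w)" using w rep[OF sG(1) w] by (simp add: J_def)
      finally show ?thesis by (simp add: hip_csc_right)
    qed
    have "J t \<in> H \<and> ip (J s) (J t) = hip s t"
      using t unfolding S0_def
    proof (induction t rule: span_induct_alt)
      case base
      have "ip (\<lambda>z\<in>unit_disk. 0) (J s) = 0" using S0[OF s] by (intro ip_zero_left) auto
      then have "ip (J s) (\<lambda>z\<in>unit_disk. 0) = 0"
        using ip_commute[OF zero_mem, of "J s"] S0[OF s] by simp
      then show ?case using zero_mem by (simp only: J_zero hip_zero_right)
    next
      case (step r x y)
      then obtain c w where x: "x = csc c (\<kappa> w)" and w: "cmod w < 1" by auto
      have xH: "J x \<in> H" unfolding x J_ker[OF w] using w by (intro scale_mem kernel_mem) auto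
      have rH: "J (r *\<^sub>R x) \<in> H" unfolding J_scale by (rule scale_mem[OF xH])
      have yH: "J y \<in> H" and sH: "J s \<in> H" using step S0[OF s] by auto
      have "J (r *\<^sub>R x + y) \<in> H" unfolding J_add by (rule add_mem[OF rH yH])
      moreover have "ip (J s) (J (r *\<^sub>R x + y)) = hip s (r *\<^sub>R x + y)"
      proof -
        have "ip (J s) (J (r *\<^sub>R x + y)) = ip (J s) (J (r *\<^sub>R x)) + ip (J s) (J y)"
          unfolding J_add by (rule ip_add_right[OF rH yH sH])
        also have "ip (J s) (J (r *\<^sub>R x)) = cnj (of_real r) * ip (J s) (J x)"
          unfolding J_scale by (rule ip_scale_right[OF xH sH])
        also have "ip (J s) (J x) = hip s x" unfolding x by (rule gen[OF w])
        also have "cnj (of_real r) * hip s x = hip s (r *\<^sub>R x)"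
          by (simp only: scaleR_csc hip_csc_right)
        finally show ?thesis using step by (simp add: hip_add_right)
      qed
      ultimately show ?case ..
    qed
    then show ?thesis ..
  qed
  have norm_J: "hnorm ip (J s) = norm s" if "s \<in> S0" for s
    unfolding hnorm_def iso[OF that that] inner_hip[symmetric] by (rule norm_eq_sqrt_inner[symmetric])
  define S where "S = closure S0"
  have sub0: "subspace S0" unfolding S0_def by (rule subspace_span)
  have S: "subspace S" "closed S" unfolding S_def by (auto intro: closure_subspace sub0)
  have "S0 \<subseteq> G" using S0 by blast
  then have SG: "S \<subseteq> G" unfolding S_def by (rule closure_minimal[OF _ G(2)])
  obtain s where s: "s \<in> S" "\<And>t. t \<in> S \<Longrightarrow> inner (v - s) t = 0"
    using hilbert_projection[OF S] by blast
  have vs: "v - s \<in> G" using v s(1) SG by (auto intro: subspace_diff[OF G(1)])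
  have "v - s = 0"
  proof (rule inj[OF vs])
    fix w :: complex assume w: "cmod w < 1"
    \<comment> \<open>Scaling the test kernel by \<open>e\<close> itself turns the real inner
      product into |e|^2, so real orthogonality already kills the complex value.\<close>
    define e where "e = ev (v - s) w"
    have "csc e (\<kappa> w) \<in> S"
      unfolding S_def S0_def using w by (intro subsetD[OF closure_subset] span_base) auto
    from s(2)[OF this] have "Re (cnj e * e) = 0"
      unfolding inner_hip hip_csc_right rep[OF vs w] e_def .
    then have "(Re e)\<^sup>2 + (Im e)\<^sup>2 = 0" by (simp add: power2_eq_square)
    then have "e = 0" by (simp add: complex_eq_iff sum_power2_eq_zero_iff)
    then show "ev (v - s) w = 0" by (simp add: e_def)
  qed
  with s(1) have "v \<in> closure S0" by (simp add: S_def)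
  then obtain \<sigma> where \<sigma>: "\<And>n. \<sigma> n \<in> S0" "\<sigma> \<longlonglongrightarrow> v" by (auto simp: closure_sequential)
  have JH: "J (\<sigma> n) \<in> H" for n using S0[OF \<sigma>(1)] by blast
  have J_diff: "(\<lambda>z\<in>unit_disk. J x z - J y z) = J (x - y)" for x y
    by (auto simp: J_def fun_eq_iff ev_diff)
  \<comment> \<open>\<open>J\<close> is isometric on the span, so the images of a convergent
    sequence are Cauchy and completeness of \<open>H\<close> yields \<open>F\<close>. Point
    evaluations are continuous for both norms, which will identify \<open>F\<close> with
    \<open>J v\<close>.\<close>
  have "\<exists>F\<in>H. (\<lambda>n. hnorm ip (\<lambda>z\<in>unit_disk. J (\<sigma> n) z - F z)) \<longlonglongrightarrow> 0"
  proof (rule complete[OF JH])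
    fix e :: real assume "e > 0"
    then obtain N where "\<forall>m\<ge>N. \<forall>n\<ge>N. norm (\<sigma> m - \<sigma> n) < e"
      using CauchyD[OF LIMSEQ_imp_Cauchy[OF \<sigma>(2)]] by blast
    moreover have "hnorm ip (\<lambda>z\<in>unit_disk. J (\<sigma> m) z - J (\<sigma> n) z) = norm (\<sigma> m - \<sigma> n)" for m n
      unfolding J_diff by (rule norm_J) (intro subspace_diff[OF sub0] \<sigma>)
    ultimately show "\<exists>N. \<forall>m\<ge>N. \<forall>n\<ge>N. hnorm ip (\<lambda>z\<in>unit_disk. J (\<sigma> m) z - J (\<sigma> n) z) < e"
      by auto
  qed
  then obtain F where F: "F \<in> H" and lim: "(\<lambda>n. hnorm ip (\<lambda>z\<in>unit_disk. J (\<sigma> n) z - F z)) \<longlonglongrightarrow> 0"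
    by blast
  define D where "D = (\<lambda>n. (\<lambda>z\<in>unit_disk. J (\<sigma> n) z - F z))"
  have DH: "D n \<in> H" for n unfolding D_def by (rule diff_mem[OF JH F])
  have D0: "(\<lambda>n. hnorm ip (D n)) \<longlonglongrightarrow> 0" using lim by (simp add: D_def)
  have "F z = J v z" for z
  proof (cases "cmod z < 1")
    case z: True
    have Kz: "(\<lambda>x\<in>unit_disk. K x z) \<in> H" using z by (intro kernel_mem) auto
    have "(\<lambda>n. D n z) \<longlonglongrightarrow> 0"
    proof (rule Lim_null_comparison)
      show "(\<lambda>n. hnorm ip (D n) * hnorm ip (\<lambda>x\<in>unit_disk. K x z)) \<longlonglongrightarrow> 0"
        using tendsto_mult_right[OF D0] by simp
      have "D n z = ip (D n) (\<lambda>x\<in>unit_disk. K x z)" for n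
        using reproducing[OF DH, of z] z by simp
      then show "eventually (\<lambda>n. norm (D n z) \<le> hnorm ip (D n) * hnorm ip (\<lambda>x\<in>unit_disk. K x z)) sequentially"
        using Cauchy_Schwarz[OF DH Kz] by simp
    qed
    moreover have "D n z = ev (\<sigma> n) z - F z" for n using z by (simp add: D_def J_def)
    ultimately have "(\<lambda>n. ev (\<sigma> n) z) \<longlonglongrightarrow> F z"
      by (simp add: LIM_zero_iff)
    moreover have "(\<lambda>n. ev (\<sigma> n) z) \<longlonglongrightarrow> ev v z"
    proof -
      have "(\<lambda>n. ev (\<sigma> n) z - ev v z) \<longlonglongrightarrow> 0"
      proof (rule Lim_null_comparison)
        have "(\<lambda>n. norm (\<sigma> n - v)) \<longlonglongrightarrow> 0" using \<sigma>(2) by (simp add: LIM_zero tendsto_norm_zero)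
        from tendsto_mult_right[OF tendsto_mult_left[OF this, of 2], of "norm (\<kappa> z)"]
        show "(\<lambda>n. 2 * norm (\<sigma> n - v) * norm (\<kappa> z)) \<longlonglongrightarrow> 0" by simp
        have "\<sigma> n - v \<in> G" for n using S0[OF \<sigma>(1)] v by (auto intro: subspace_diff[OF G(1)])
        from rep[OF this z] have "ev (\<sigma> n) z - ev v z = hip (\<sigma> n - v) (\<kappa> z)" for n
          using ev_diff[OF z] by simp
        then show "eventually (\<lambda>n. norm (ev (\<sigma> n) z - ev v z) \<le> 2 * norm (\<sigma> n - v) * norm (\<kappa> z)) sequentially"
          using hip_bound by simp
      qed
      then show ?thesis by (simp add: LIM_zero_iff)
    qed
    ultimately have "F z = ev v z" by (rule LIMSEQ_unique)
    then show ?thesis using z by (simp add: J_def)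
  next
    \<comment> \<open>Off the disk both functions take the default value
      \<open>undefined\<close>.\<close>
    case False
    then show ?thesis using F functions_on by (auto simp: J_def extensional_def)
  qed
  then have FJ: "F = J v" by (rule ext)
  show "restrict (ev v) unit_disk \<in> H" using F FJ by (simp add: J_def)
  have "(\<lambda>n. (norm (\<sigma> n))\<^sup>2) \<longlonglongrightarrow> (hnorm ip F)\<^sup>2"
  proof -
    have eq: "(norm (\<sigma> n))\<^sup>2 - (hnorm ip F)\<^sup>2 = Re (ip (D n) (J (\<sigma> n))) + Re (ip F (D n))" for n
    proof -
      have "ip (D n) (J (\<sigma> n)) + ip F (D n) = ip (J (\<sigma> n)) (J (\<sigma> n)) - ip F F"
        unfolding D_def by (simp only: ip_diff_left[OF JH F JH] ip_diff_right[OF JH F F]) simp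
      also have "\<dots> = of_real ((norm (\<sigma> n))\<^sup>2 - (hnorm ip F)\<^sup>2)"
        by (simp only: ip_self[OF JH] ip_self[OF F] norm_J[OF \<sigma>(1)] of_real_diff)
      finally show ?thesis by (metis Re_complex_of_real plus_complex.simps(1))
    qed
    have "(\<lambda>n. (norm (\<sigma> n))\<^sup>2 - (hnorm ip F)\<^sup>2) \<longlonglongrightarrow> 0"
    proof (rule Lim_null_comparison)
      have "(\<lambda>n. hnorm ip (D n) * norm (\<sigma> n) + hnorm ip F * hnorm ip (D n)) \<longlonglongrightarrow> 0 * norm v + hnorm ip F * 0"
        by (intro tendsto_intros D0 \<sigma>(2))
      then show "(\<lambda>n. hnorm ip (D n) * norm (\<sigma> n) + hnorm ip F * hnorm ip (D n)) \<longlonglongrightarrow> 0" by simp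
      have "\<bar>(norm (\<sigma> n))\<^sup>2 - (hnorm ip F)\<^sup>2\<bar> \<le> hnorm ip (D n) * norm (\<sigma> n) + hnorm ip F * hnorm ip (D n)" for n
        unfolding eq
        using Cauchy_Schwarz[OF DH JH, of n n] Cauchy_Schwarz[OF F DH, of n] norm_J[OF \<sigma>(1), of n]
          abs_Re_le_cmod[of "ip (D n) (J (\<sigma> n))"] abs_Re_le_cmod[of "ip F (D n)"] by simp
      then show "eventually (\<lambda>n. norm ((norm (\<sigma> n))\<^sup>2 - (hnorm ip F)\<^sup>2) \<le> hnorm ip (D n) * norm (\<sigma> n) + hnorm ip F * hnorm ip (D n)) sequentially"
        by simp
    qed
    then show ?thesis by (simp add: LIM_zero_iff)
  qed
  moreover have "(\<lambda>n. (norm (\<sigma> n))\<^sup>2) \<longlonglongrightarrow> (norm v)\<^sup>2" by (intro tendsto_intros \<sigma>(2))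
  ultimately have "(hnorm ip F)\<^sup>2 = (norm v)\<^sup>2" by (rule LIMSEQ_unique)
  then show "(hnorm ip (restrict (ev v) unit_disk))\<^sup>2 = (norm v)\<^sup>2" by (simp add: FJ J_def)
qed

section \<open>The model of the de Branges--Rovnyak space\<close>

lemma tc_cong:
  assumes "\<And>z. cmod z < 1 \<Longrightarrow> u z = v z" shows "tc u = tc v"
proof -
  have "eventually (\<lambda>z. z \<in> unit_disk) (nhds (0 :: complex))"
    by (rule eventually_nhds_in_open) auto
  then have "eventually (\<lambda>z. u z = v z) (nhds 0)" by eventually_elim (simp add: assms)
  then show ?thesis by (simp only: fps_expansion_cong)
qed

lemma szego_kernel:
  assumes "cmod w < 1"
  shows "(\<lambda>z. 1 / (1 - w * z)) holomorphic_on unit_disk" "tc (\<lambda>z. 1 / (1 - w * z)) = (\<lambda>n. w ^ n)"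
    "\<And>z. cmod z \<le> 1 \<Longrightarrow> 1 - cmod w \<le> cmod (1 - w * z)"
proof -
  show lb: "1 - cmod w \<le> cmod (1 - w * z)" if "cmod z \<le> 1" for z
  proof -
    have "cmod (w * z) \<le> cmod w" using that by (simp add: norm_mult mult_left_le)
    with norm_triangle_ineq2[of 1 "w * z"] show ?thesis by simp
  qed
  have "1 - w * z \<noteq> 0" if "cmod z \<le> 1" for z using lb[OF that] assms by auto
  then show "(\<lambda>z. 1 / (1 - w * z)) holomorphic_on unit_disk"
    by (intro holomorphic_intros) auto
  show "tc (\<lambda>z. 1 / (1 - w * z)) = (\<lambda>n. w ^ n)"
  proof (rule ext, rule tc_eqI)
    fix z :: complex assume z: "cmod z < 1"
    have "cmod (w * z) < 1" using assms z mult_strict_mono'[of "cmod w" 1 "cmod z" 1] by (simp add: norm_mult)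
    from geometric_sums[OF this] show "(\<lambda>n. w ^ n * z ^ n) sums (1 / (1 - w * z))"
      by (simp add: power_mult_distrib)
  qed
qed

lemma circ_integral_szego:
  assumes "cmod w < 1"
  shows "cint (\<lambda>t. 1 / (1 - w * cis t) * cis (- (real m * t))) = of_real (2 * pi) * w ^ m"
proof -
  \<comment> \<open>A radius strictly between |w| and 1 turns the boundary integral into one over
    the circle of radius \<rho> for the kernel with parameter \<open>w / \<rho>\<close>, still in
    the disk, so that \<open>circ_integral_fourier\<close> applies.\<close>
  define \<rho> where "\<rho> = (1 + cmod w) / 2"
  have \<rho>: "cmod w < \<rho>" "\<rho> < 1" "0 < \<rho>" using assms by (auto simp: \<rho>_def add_pos_nonneg)
  define w' where "w' = w / of_real \<rho>"
  have w': "cmod w' < 1" using \<rho> by (simp add: w'_def norm_divide)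
  have ww: "w' * of_real \<rho> = w" using \<rho> by (simp add: w'_def)
  have "cint (\<lambda>t. 1 / (1 - w' * (of_real \<rho> * cis t)) * cis (of_int (- int m) * t)) =
      of_real (2 * pi) * tc (\<lambda>z. 1 / (1 - w' * z)) m * of_real \<rho> ^ m"
    using circ_integral_fourier[OF szego_kernel(1)[OF w'], of \<rho> "int m"] \<rho> by simp
  then show ?thesis
    by (simp add: szego_kernel(2)[OF w'] mult.assoc[symmetric] ww) (simp add: mult.assoc power_mult_distrib[symmetric] ww)
qed

text \<open>The identity \<open>|b|\<^sup>2 + |a|\<^sup>2 = 1\<close> on the circle, tested against the Szego kernels.\<close>

lemma boundary_toeplitz_identity:
  assumes a: "a holomorphic_on unit_disk" and b: "b holomorphic_on unit_disk"
    and aA: "\<And>z. cmod z < 1 \<Longrightarrow> cmod (a z) \<le> A" and bA: "\<And>z. cmod z < 1 \<Longrightarrow> cmod (b z) \<le> A"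
    and bdry: "boundary_pythagorean b a"
    and w: "cmod w < 1"
  shows "(\<Sum>j. cnj (tc b j) * conv (tc b) (\<lambda>n. w ^ n) (m + j)) +
    (\<Sum>j. cnj (tc a j) * conv (tc a) (\<lambda>n. w ^ n) (m + j)) = w ^ m"
proof -
  obtain R :: "nat \<Rightarrow> real" where R: "\<And>n. 0 \<le> R n" "\<And>n. R n < 1" and R_at: "filterlim R (at_left 1) sequentially"
    using exists_radial_sequence by blast
  have R1: "R \<longlonglongrightarrow> 1" using R_at by (simp add: filterlim_at)
  define k where "k = (\<lambda>z. 1 / (1 - w * z))"
  note k = szego_kernel[OF w, folded k_def]
  have A0: "0 \<le> A" using order_trans[OF norm_ge_zero aA[of 0]] by simp
  have kb: "cmod (k z) \<le> 1 / (1 - cmod w)" if "cmod z \<le> 1" for z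
    using k(3)[OF that] w by (simp add: k_def norm_divide frac_le)
  \<comment> \<open>Each \<open>I f\<close> tends to \<open>2 * pi\<close> times a co-analytic
    Toeplitz coefficient of \<open>f * k\<close>. The sum over f = b and f = a carries |b|^2 + |a|^2
    in its integrand, which tends to 1 almost everywhere.\<close>
  define I where "I = (\<lambda>f n. cint (\<lambda>t. cnj (f (of_real (R n) * cis t)) *
      (f (of_real (R n) * cis t) * k (of_real (R n) * cis t)) * cis (- (real m * t))))"
  have conv_lim: "I f \<longlonglongrightarrow> of_real (2 * pi) * (\<Sum>j. cnj (tc f j) * conv (tc f) (\<lambda>n. w ^ n) (m + j))"
    if f: "f holomorphic_on unit_disk" and fA: "\<And>z. cmod z < 1 \<Longrightarrow> cmod (f z) \<le> A" for f
  proof -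
    define v where "v = (\<lambda>z. f z * k z)"
    have v: "v holomorphic_on unit_disk" unfolding v_def by (intro holomorphic_intros f k)
    have tv: "tc v = conv (tc f) (\<lambda>n. w ^ n)"
      unfolding v_def by (rule ext) (simp add: tc_mult[OF f k(1)] k(2))
    have "cmod (v z) \<le> A * (1 / (1 - cmod w))" if "cmod z < 1" for z
      unfolding v_def norm_mult using A0 that by (intro mult_mono fA kb) auto
    then have sv: "l2_seq (tc v)" by (rule bounded_imp_l2_seq[OF v])
    have sf: "l2_seq (tc f)" by (rule bounded_imp_l2_seq[OF f fA])
    have In: "I f n = (\<Sum>j. of_real (2 * pi) * (cnj (tc f j) * tc v (m + j) * of_real (R n) ^ (2 * j + m)))" for n
      using sums_unique[OF circ_integral_pairing[OF f v R, of m n]] by (simp add: I_def v_def)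
    have damp: "cmod (cnj (tc f j) * of_real (R n) ^ (2 * j + m)) \<le> cmod (tc f j)" for j n
    proof -
      have "cmod (cnj (tc f j) * of_real (R n) ^ (2 * j + m)) = cmod (tc f j) * R n ^ (2 * j + m)"
        using R(1) by (simp add: norm_mult norm_power)
      also have "\<dots> \<le> cmod (tc f j)"
        using R[of n] by (intro mult_right_le_one_le zero_le_power power_le_one) auto
      finally show ?thesis .
    qed
    have "(\<lambda>n. \<Sum>j. tc v (m + j) * (cnj (tc f j) * of_real (R n) ^ (2 * j + m))) \<longlonglongrightarrow>
        (\<Sum>j. tc v (m + j) * cnj (tc f j))"
    proof (rule bounded_imp_weak_convergence(3))
      show "l2_seq (\<lambda>j. tc v (m + j))" by (rule l2_seq_shift[OF sv])
      have "l2_seq (\<lambda>j. cnj (tc f j) * of_real (R n) ^ (2 * j + m)) \<and>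
          energy (\<lambda>j. cnj (tc f j) * of_real (R n) ^ (2 * j + m)) \<le> energy (tc f)" for n
      proof -
        from l2_seq_mono[OF sf damp[of _ n]] show ?thesis by auto
      qed
      then show "eventually (\<lambda>n. l2_seq (\<lambda>j. cnj (tc f j) * of_real (R n) ^ (2 * j + m)) \<and>
          energy (\<lambda>j. cnj (tc f j) * of_real (R n) ^ (2 * j + m)) \<le> energy (tc f)) sequentially" by simp
      have "(\<lambda>n. cnj (tc f j) * of_real (R n) ^ (2 * j + m)) \<longlonglongrightarrow> cnj (tc f j) * of_real 1 ^ (2 * j + m)" for j
        by (intro tendsto_intros R1)
      then show "(\<lambda>n. cnj (tc f j) * of_real (R n) ^ (2 * j + m)) \<longlonglongrightarrow> cnj (tc f j)" for j by simp
    qed simp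
    moreover have "I f n = of_real (2 * pi) * (\<Sum>j. tc v (m + j) * (cnj (tc f j) * of_real (R n) ^ (2 * j + m)))" for n
    proof -
      have "l2_seq (\<lambda>j. cnj (tc f j) * of_real (R n) ^ (2 * j + m))"
        by (rule l2_seq_mono(1)[OF sf damp])
      from l2_pairing_bound(1)[OF l2_seq_shift(1)[OF sv] this]
      show ?thesis unfolding In by (subst suminf_mult[symmetric]) (auto simp: mult_ac)
    qed
    then have "I f = (\<lambda>n. of_real (2 * pi) * (\<Sum>j. tc v (m + j) * (cnj (tc f j) * of_real (R n) ^ (2 * j + m))))"
      by (rule ext)
    ultimately have "I f \<longlonglongrightarrow> of_real (2 * pi) * (\<Sum>j. tc v (m + j) * cnj (tc f j))"
      by (simp only: tendsto_mult_left)
    then show ?thesis by (simp only: tv mult.commute)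
  qed
  let ?J = "\<lambda>n t. of_real ((cmod (b (of_real (R n) * cis t)))\<^sup>2 + (cmod (a (of_real (R n) * cis t)))\<^sup>2) * k (of_real (R n) * cis t) * cis (- (real m * t))"
  have "(\<lambda>n. cint (?J n)) \<longlonglongrightarrow> cint (\<lambda>t. k (cis t) * cis (- (real m * t)))"
  proof (rule integral_dominated_convergence[where w="\<lambda>_. (A\<^sup>2 + A\<^sup>2) * (1 / (1 - cmod w))"])
    have "1 - w * cis t \<noteq> 0" for t using k(3)[of "cis t"] w by auto
    then show "(\<lambda>t. k (cis t) * cis (- (real m * t))) \<in> borel_measurable circ"
      unfolding k_def
      by (intro borel_measurable_integrable circ_intros) auto
    show "(?J n) \<in> borel_measurable circ" for n
      by (intro borel_measurable_integrable circ_intros continuous_on_circle a b k R)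
    show "integrable circ (\<lambda>_. (A\<^sup>2 + A\<^sup>2) * (1 / (1 - cmod w)))"
      by (intro circ_intros)
    show "AE t in circ. norm (?J n t) \<le> (A\<^sup>2 + A\<^sup>2) * (1 / (1 - cmod w))" for n
    proof (rule AE_I2)
      fix t
      define z where "z = of_real (R n) * cis t"
      have z: "cmod z < 1" using R[of n] by (simp add: z_def norm_mult)
      have "norm (of_real ((cmod (b z))\<^sup>2 + (cmod (a z))\<^sup>2) * k z * cis (- (real m * t))) = ((cmod (b z))\<^sup>2 + (cmod (a z))\<^sup>2) * cmod (k z)"
        by (simp add: norm_mult del: of_real_add)
      also have "\<dots> \<le> (A\<^sup>2 + A\<^sup>2) * (1 / (1 - cmod w))"
        using z A0 by (intro mult_mono add_mono power_mono aA bA kb) auto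
      finally show "norm (?J n t) \<le> (A\<^sup>2 + A\<^sup>2) * (1 / (1 - cmod w))" by (simp only: z_def)
    qed
    show "AE t in circ. (\<lambda>n. ?J n t) \<longlonglongrightarrow> k (cis t) * cis (- (real m * t))"
      using bdry[unfolded boundary_pythagorean_def]
    proof eventually_elim
      case (elim t)
      then obtain \<beta> \<alpha> where lims: "has_radial_limit b (cis t) \<beta>" "has_radial_limit a (cis t) \<alpha>"
        and one: "(cmod \<beta>)\<^sup>2 + (cmod \<alpha>)\<^sup>2 = 1" by blast
      have L: "(\<lambda>n. b (of_real (R n) * cis t)) \<longlonglongrightarrow> \<beta>" "(\<lambda>n. a (of_real (R n) * cis t)) \<longlonglongrightarrow> \<alpha>"
        using lims unfolding has_radial_limit_def by (auto intro: filterlim_compose[OF _ R_at])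
      have nz: "1 - w * (of_real 1 * cis t) \<noteq> 0" using k(3)[of "cis t"] w by auto
      have "(\<lambda>n. ?J n t) \<longlonglongrightarrow>
          of_real ((cmod \<beta>)\<^sup>2 + (cmod \<alpha>)\<^sup>2) * (1 / (1 - w * (of_real 1 * cis t))) * cis (- (real m * t))"
        unfolding k_def by (intro tendsto_intros L R1 nz)
      then show ?case unfolding one by (simp add: k_def)
    qed
  qed
  moreover have "cint (?J n) = I b n + I a n" for n
  proof -
    have sq: "cnj z * (z * c) = of_real ((cmod z)\<^sup>2) * c" for z c
      unfolding complex_norm_square by (simp add: mult_ac)
    show ?thesis unfolding I_def sq
      by (subst Bochner_Integration.integral_add[symmetric])
        (auto intro!: circ_intros continuous_on_circle a b k R simp: distrib_right)
  qed
  ultimately have "(\<lambda>n. I b n + I a n) \<longlonglongrightarrow> of_real (2 * pi) * w ^ m"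
    by (simp only: k_def circ_integral_szego[OF w])
  from LIMSEQ_unique[OF this tendsto_add[OF conv_lim[OF b bA] conv_lim[OF a aA]]]
  have "of_real (2 * pi) * ((\<Sum>j. cnj (tc b j) * conv (tc b) (\<lambda>n. w ^ n) (m + j)) +
    (\<Sum>j. cnj (tc a j) * conv (tc a) (\<lambda>n. w ^ n) (m + j))) = of_real (2 * pi) * w ^ m"
    by (simp only: distrib_left)
  then show ?thesis by simp
qed

lemma conv_commute: "conv x y = conv y x"
proof
  show "conv x y n = conv y x n" for n
    unfolding conv_def
    by (rule sum.reindex_bij_witness[of _ "\<lambda>i. n - i" "\<lambda>i. n - i"]) (auto simp: mult.commute)
qed

text \<open>\<open>toep c m x\<close> is the \<open>m\<close>-th coefficient of the co-analytic Toeplitz operator with coefficients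
  \<open>cnj c\<close> applied to \<open>x\<close>.\<close>

definition toep :: "(nat \<Rightarrow> complex) \<Rightarrow> nat \<Rightarrow> ell2 \<Rightarrow> complex" where
  "toep c m x = (\<Sum>k. cnj (c k) * Rep_ell2 x (m + k))"

lemma toep_pair: "toep c m x = pair (\<lambda>k. Rep_ell2 x (m + k)) c"
  by (simp add: toep_def pair_def mult.commute)

lemma toep_linear:
  assumes "l2_seq c"
  shows "toep c m (x + y) = toep c m x + toep c m y" "toep c m (cscale r x) = r * toep c m x"
  using assms l2_seq_shift(1)[of "Rep_ell2 _" m]
  by (simp_all add: toep_pair plus_ell2.rep_eq cscale.rep_eq pair_add_left pair_scale_left)

lemma toep_bounded_linear:
  assumes "l2_seq c" shows "bounded_linear (toep c m)"
proof (rule bounded_linear_intro[where K="sqrt (energy c)"])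
  show "toep c m (x + y) = toep c m x + toep c m y" for x y by (rule toep_linear[OF assms])
  show "toep c m (r *\<^sub>R x) = r *\<^sub>R toep c m x" for r x
  proof -
    have "r *\<^sub>R x = cscale (of_real r) x" by transfer simp
    then show ?thesis by (simp add: toep_linear[OF assms] scaleR_conv_of_real)
  qed
  show "norm (toep c m x) \<le> norm x * sqrt (energy c)" for x
  proof -
    have s: "l2_seq (\<lambda>k. Rep_ell2 x (m + k))" "energy (\<lambda>k. Rep_ell2 x (m + k)) \<le> energy (Rep_ell2 x)"
      using l2_seq_shift[of "Rep_ell2 x" m] by auto
    have "norm (toep c m x) \<le> sqrt (energy (\<lambda>k. Rep_ell2 x (m + k))) * sqrt (energy c)"
      unfolding toep_pair by (rule pair_bound[OF s(1) assms])
    also have "\<dots> \<le> norm x * sqrt (energy c)"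
      unfolding norm_ell2_sqrt using s(2) by (intro mult_right_mono real_sqrt_le_mono) (auto simp: energy_nonneg assms)
    finally show ?thesis .
  qed
qed

text \<open>The convolution is the coefficient sequence of the symbol times the Szego kernel at
  \<open>w\<close>; by adjunction, pairing with it evaluates the co-analytic Toeplitz image of
  \<open>x\<close> at \<open>w\<close>.\<close>

lemma pair_conv_geometric:
  assumes c: "l2_seq c" and w: "cmod w < 1"
  shows "pair (Rep_ell2 x) (conv c (\<lambda>n. cnj w ^ n)) = (\<Sum>k. w ^ k * toep c k x)"
proof -
  define B where "B = sqrt (energy c) * sqrt (energy (Rep_ell2 x))"
  have CS: "summable (\<lambda>l. cmod (cnj (c l) * Rep_ell2 x (k + l)))"
    "(\<Sum>l. cmod (cnj (c l) * Rep_ell2 x (k + l))) \<le> B" for k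
    using weighted_pairing[of 0 "\<lambda>l. cnj (c l)" "Rep_ell2 x" k] c by (auto simp: B_def)
  have "summable (\<lambda>k. cmod (w ^ k) * (\<Sum>l. cmod (cnj (c l) * Rep_ell2 x (k + l))))"
  proof (rule summable_comparison_test'[where N=0])
    show "summable (\<lambda>k. cmod w ^ k * B)" using w by (intro summable_mult2 summable_geometric) auto
    show "norm (cmod (w ^ k) * (\<Sum>l. cmod (cnj (c l) * Rep_ell2 x (k + l)))) \<le> cmod w ^ k * B" for k
      using CS(2)[of k] suminf_nonneg[OF CS(1)[of k]] by (simp add: norm_power abs_mult mult_left_mono)
  qed
  from conv_pairing_sums[OF CS(1) this]
  have "(\<lambda>n. conv (\<lambda>k. w ^ k) (\<lambda>l. cnj (c l)) n * Rep_ell2 x n) sums (\<Sum>k. w ^ k * toep c k x)"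
    by (simp add: toep_def)
  moreover have "conv (\<lambda>k. w ^ k) (\<lambda>l. cnj (c l)) n * Rep_ell2 x n = Rep_ell2 x n * cnj (conv c (\<lambda>n. cnj w ^ n) n)" for n
    unfolding cnj_conv by (subst conv_commute) (simp add: mult.commute)
  ultimately show ?thesis by (simp add: pair_def sums_iff)
qed

text \<open>The space is modelled by the pairs \<open>(f, f\<^sup>+)\<close> of square summable sequences on which the
  co-analytic Toeplitz operators of \<open>b\<close> and \<open>a\<close> agree; the kernel at \<open>w\<close> corresponds to
  \<open>(K\<^sub>w, cnj (b w) a k\<^sub>w)\<close> with \<open>k\<^sub>w\<close> the Szego kernel.\<close>

lemma de_branges_rovnyak_membership:
  assumes a: "a holomorphic_on unit_disk" and b: "b holomorphic_on unit_disk"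
    and aA: "\<And>z. cmod z < 1 \<Longrightarrow> cmod (a z) \<le> A" and bA: "\<And>z. cmod z < 1 \<Longrightarrow> cmod (b z) \<le> A"
    and bdry: "boundary_pythagorean b a"
    and inj: "\<And>y. l2_seq y \<Longrightarrow> (\<And>m. (\<Sum>k. cnj (tc a k) * y (m + k)) = 0) \<Longrightarrow> y = (\<lambda>_. 0)"
    and f: "f holomorphic_on unit_disk" and sf: "l2_seq (tc f)" and sy: "l2_seq y"
    and rel: "\<And>m. (\<Sum>k. cnj (tc a k) * y (m + k)) = (\<Sum>k. cnj (tc b k) * tc f (m + k))"
    and dBR: "is_de_branges_rovnyak_space b H ip"
  shows "restrict f unit_disk \<in> H" "(hnorm ip (restrict f unit_disk))\<^sup>2 = energy (tc f) + energy y"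
proof -
  have sa: "l2_seq (tc a)" by (rule bounded_imp_l2_seq[OF a aA])
  have sb: "l2_seq (tc b)" by (rule bounded_imp_l2_seq[OF b bA])
  define G where "G = {v. \<forall>m. toep (tc b) m (fst v) = toep (tc a) m (snd v)}"
  define k where "k = (\<lambda>w n. cnj w ^ n :: complex)"
  define K where "K = (\<lambda>w n. k w n - cnj (b w) * conv (tc b) (k w) n)"
  define K' where "K' = (\<lambda>w n. cnj (b w) * conv (tc a) (k w) n)"
  define \<kappa> where "\<kappa> = (\<lambda>w. (Abs_ell2 (K w), Abs_ell2 (K' w)))"
  have prod: "l2_seq (conv (tc u) (k w))"
    "cmod z < 1 \<Longrightarrow> (\<lambda>n. conv (tc u) (k w) n * z ^ n) sums (u z * (1 / (1 - cnj w * z)))"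
    if u: "u holomorphic_on unit_disk" and uA: "\<And>z. cmod z < 1 \<Longrightarrow> cmod (u z) \<le> A" and w: "cmod w < 1" for u w z
  proof -
    have cw: "cmod (cnj w) < 1" using w by simp
    note sz = szego_kernel[OF cw]
    have h: "(\<lambda>z. u z * (1 / (1 - cnj w * z))) holomorphic_on unit_disk" by (intro holomorphic_on_mult u sz)
    have t: "tc (\<lambda>z. u z * (1 / (1 - cnj w * z))) = conv (tc u) (k w)"
      by (rule ext) (simp only: tc_mult[OF u sz(1)] sz(2) k_def)
    have A0: "0 \<le> A" using order_trans[OF norm_ge_zero uA[of 0]] by simp
    have "cmod (u z * (1 / (1 - cnj w * z))) \<le> A * (1 / (1 - cmod w))" if z: "cmod z < 1" for z
      unfolding norm_mult norm_divide norm_one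
      using sz(3)[of z] w z A0 uA[OF z] by (intro mult_mono frac_le) auto
    from bounded_imp_l2_seq(1)[OF h this] show "l2_seq (conv (tc u) (k w))"
      by (simp only: t)
    show "cmod z < 1 \<Longrightarrow> (\<lambda>n. conv (tc u) (k w) n * z ^ n) sums (u z * (1 / (1 - cnj w * z)))"
      using tc_sums[OF h] by (simp only: t)
  qed
  have sk: "l2_seq (k w)" if "cmod w < 1" for w
    unfolding k_def using that by (intro l2_seq_geometric) simp
  have sK: "l2_seq (K w)" "l2_seq (K' w)" if w: "cmod w < 1" for w
  proof -
    have "l2_seq (\<lambda>n. k w n + (- cnj (b w)) * conv (tc b) (k w) n)"
      by (intro l2_seq_add l2_seq_scale sk w prod(1)[OF b bA])
    then show "l2_seq (K w)" by (simp add: K_def)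
    show "l2_seq (K' w)"
      unfolding K'_def by (intro l2_seq_scale w prod(1)[OF a aA])
  qed
  have RepK: "Rep_ell2 (fst (\<kappa> w)) = K w" "Rep_ell2 (snd (\<kappa> w)) = K' w" if "cmod w < 1" for w
    using sK[OF that] by (simp_all add: \<kappa>_def Abs_ell2_inverse)
  have G_sub: "subspace G"
  proof (rule subspaceI)
    note lin = toep_bounded_linear[OF sa, THEN bounded_linear.linear] toep_bounded_linear[OF sb, THEN bounded_linear.linear]
    show "0 \<in> G" using lin by (simp add: G_def linear_0)
    show "x + y \<in> G" if "x \<in> G" "y \<in> G" for x y using that lin by (simp add: G_def linear_add)
    show "c *\<^sub>R x \<in> G" if "x \<in> G" for c x using that lin by (simp add: G_def linear_scale)
  qed
  have G_closed: "closed G"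
    unfolding G_def
    by (intro closed_Collect_all closed_Collect_eq bounded_linear.continuous_on[OF toep_bounded_linear] sa sb continuous_intros)
  have csc_G: "csc c v \<in> G" if "v \<in> G" for c v
    using that by (simp add: G_def csc_def toep_linear sa sb)
  have \<kappa>_G: "\<kappa> w \<in> G" if w: "cmod w < 1" for w
  proof -
    have "toep (tc b) m (fst (\<kappa> w)) = toep (tc a) m (snd (\<kappa> w))" for m
    proof -
      have cw: "cmod (cnj w) < 1" using w by simp
      have s1: "summable (\<lambda>j. cnj (tc b j) * k w (m + j))"
        by (intro l2_pairing_bound l2_seq_shift sk w) (simp add: sb)
      have s2: "summable (\<lambda>j. cnj (tc b j) * conv (tc b) (k w) (m + j))"
        by (intro l2_pairing_bound l2_seq_shift prod(1)[OF b bA] w) (simp add: sb)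
      have s3: "summable (\<lambda>j. cnj (tc a j) * conv (tc a) (k w) (m + j))"
        by (intro l2_pairing_bound l2_seq_shift prod(1)[OF a aA] w) (simp add: sa)
      have "(\<lambda>j. tc b j * w ^ j) sums b w" by (rule tc_sums[OF b w])
      then have "(\<lambda>j. cnj (tc b j * w ^ j)) sums cnj (b w)" by (simp only: sums_cnj)
      then have "(\<lambda>j. cnj w ^ m * cnj (tc b j * w ^ j)) sums (cnj w ^ m * cnj (b w))" by (rule sums_mult)
      then have e1: "(\<Sum>j. cnj (tc b j) * k w (m + j)) = cnj w ^ m * cnj (b w)"
        by (simp add: sums_iff k_def power_add mult_ac)
      have "toep (tc b) m (fst (\<kappa> w)) = (\<Sum>j. cnj (tc b j) * k w (m + j) - cnj (b w) * (cnj (tc b j) * conv (tc b) (k w) (m + j)))"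
        unfolding toep_def RepK[OF w] K_def by (simp add: algebra_simps)
      also have "\<dots> = cnj w ^ m * cnj (b w) - cnj (b w) * (\<Sum>j. cnj (tc b j) * conv (tc b) (k w) (m + j))"
        by (simp only: suminf_diff[OF s1 summable_mult[OF s2], symmetric] suminf_mult[OF s2] e1)
      also have "\<dots> = cnj (b w) * (cnj w ^ m - (\<Sum>j. cnj (tc b j) * conv (tc b) (k w) (m + j)))"
        by (simp add: algebra_simps)
      \<comment> \<open>On the Szego kernel the boundary identity trades the identity minus the
        \<open>b\<close> part for the \<open>a\<close> part, which is what forces the second
        component of the kernel to be cnj (b w) times a k.\<close>
      also have "cnj w ^ m - (\<Sum>j. cnj (tc b j) * conv (tc b) (k w) (m + j)) = (\<Sum>j. cnj (tc a j) * conv (tc a) (k w) (m + j))"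
        using boundary_toeplitz_identity[OF a b aA bA bdry cw, of m] unfolding k_def by (simp add: algebra_simps)
      also have "cnj (b w) * \<dots> = toep (tc a) m (snd (\<kappa> w))"
        unfolding toep_def RepK[OF w] K'_def by (subst suminf_mult[OF s3, symmetric]) (simp add: mult_ac)
      finally show ?thesis .
    qed
    then show ?thesis by (simp add: G_def)
  qed
  \<comment> \<open>Pairing with the kernel leaves the value at \<open>w\<close>, minus
    \<open>b w\<close> times the pairing with \<open>b k\<close>, plus \<open>b w\<close> times that
    with \<open>a k\<close>. The last two cancel: \<open>pair_conv_geometric\<close> evaluates both,
    and elements of \<open>G\<close> have equal Toeplitz images.\<close>
  have rep: "hip v (\<kappa> w) = ev v w" if v: "v \<in> G" and w: "cmod w < 1" for v w
  proof -
    define x where "x = Rep_ell2 (fst v)"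
    define x' where "x' = Rep_ell2 (snd v)"
    have sx: "l2_seq x" "l2_seq x'" by (simp_all add: x_def x'_def)
    have pc: "pair x z = cnj (pair z x)" if "l2_seq x" "l2_seq z" for x z
      using that by (intro pair_commute)
    define c where "c = - cnj (b w)"
    have sc: "l2_seq (\<lambda>n. c * conv (tc b) (k w) n)"
      by (intro l2_seq_scale prod(1)[OF b bA] w)
    have "K w = (\<lambda>n. k w n + c * conv (tc b) (k w) n)" by (simp add: K_def c_def)
    then have "pair (K w) x = pair (k w) x + c * pair (conv (tc b) (k w)) x"
      by (simp only: pair_add_left[OF sk[OF w] sc sx(1)] pair_scale_left[OF prod(1)[OF b bA w] sx(1)])
    then have "pair (K w) x = pair (k w) x - cnj (b w) * pair (conv (tc b) (k w)) x" by (simp add: c_def)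
    then have 1: "pair x (K w) = pair x (k w) - b w * pair x (conv (tc b) (k w))"
      by (simp only: pc[OF sx(1) sK(1)[OF w]] pc[OF sx(1) sk[OF w]] pc[OF sx(1) prod(1)[OF b bA w]]) simp
    have "pair (K' w) x' = cnj (b w) * pair (conv (tc a) (k w)) x'"
      unfolding K'_def by (intro pair_scale_left sx prod(1)[OF a aA] w)
    then have 2: "pair x' (K' w) = b w * pair x' (conv (tc a) (k w))"
      by (simp only: pc[OF sx(2) sK(2)[OF w]] pc[OF sx(2) prod(1)[OF a aA w]]) simp
    have "pair x (conv (tc b) (k w)) = pair x' (conv (tc a) (k w))"
      unfolding x_def x'_def k_def pair_conv_geometric[OF sa w] pair_conv_geometric[OF sb w]
      using v by (simp add: G_def)
    then show ?thesis
      unfolding hip_def RepK[OF w] x_def[symmetric] x'_def[symmetric] 1 2 by (simp add: ev_def x_def k_def)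
  qed
  have ker: "ev (\<kappa> w) z = (1 - cnj (b w) * b z) / (1 - cnj w * z)" if z: "cmod z < 1" and w: "cmod w < 1" for z w
  proof -
    have cw: "cmod (cnj w) < 1" using w by simp
    have "(\<lambda>n. k w n * z ^ n) sums (1 / (1 - cnj w * z))"
      using tc_sums[OF szego_kernel(1)[OF cw] z] unfolding szego_kernel(2)[OF cw] k_def .
    from sums_diff[OF this sums_mult[OF prod(2)[OF b bA w z], of "cnj (b w)"]]
    have "(\<lambda>n. K w n * z ^ n) sums ((1 - cnj (b w) * b z) / (1 - cnj w * z))"
      by (simp add: K_def algebra_simps diff_divide_distrib)
    then show ?thesis by (simp add: ev_def pair_def RepK[OF w] sums_iff)
  qed
  \<comment> \<open>Uniqueness of power series kills the first component; the second is then
    annihilated by the operator of \<open>a\<close>, and \<open>inj\<close> applies.\<close>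
  have ev0: "v = 0" if v: "v \<in> G" and z: "\<And>w. cmod w < 1 \<Longrightarrow> ev v w = 0" for v
  proof -
    have "(\<lambda>n. Rep_ell2 (fst v) n * w ^ n) sums 0" if w: "cmod w < 1" for w
      using summable_sums[OF pair_summable[of "Rep_ell2 (fst v)" "\<lambda>n. cnj w ^ n"]] z[OF w] w
        l2_seq_geometric[of "cnj w"] by (simp add: ev_def pair_def)
    then have "tc (\<lambda>_. 0) n = Rep_ell2 (fst v) n" for n by (intro tc_eqI)
    moreover have "tc (\<lambda>_. 0) n = 0" for n by (rule tc_eqI) simp
    ultimately have r0: "Rep_ell2 (fst v) = (\<lambda>_. 0)" by (auto simp: fun_eq_iff)
    have "(\<Sum>k. cnj (tc a k) * Rep_ell2 (snd v) (m + k)) = 0" for m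
      using v by (simp add: G_def toep_def r0)
    then have "Rep_ell2 (snd v) = (\<lambda>_. 0)" by (intro inj) auto
    with r0 show "v = 0" by (simp add: prod_eq_iff Rep_ell2_inject[symmetric] zero_ell2.rep_eq)
  qed
  define v where "v = (Abs_ell2 (tc f), Abs_ell2 y)"
  have Rv: "Rep_ell2 (fst v) = tc f" "Rep_ell2 (snd v) = y"
    using sf sy by (simp_all add: v_def Abs_ell2_inverse)
  have vG: "v \<in> G" using rel by (simp add: G_def toep_def Rv)
  have rk: "reproducing_kernel_hilbert_space unit_disk (\<lambda>z w. (1 - cnj (b w) * b z) / (1 - cnj w * z)) H ip"
    using dBR by (simp add: is_de_branges_rovnyak_space_def)
  have R: "restrict (ev v) unit_disk \<in> H" "(hnorm ip (restrict (ev v) unit_disk))\<^sup>2 = (norm v)\<^sup>2"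
    by (rule rkhs_identification[OF rk G_sub G_closed csc_G[OF \<kappa>_G] rep ker ev0 vG]; assumption)+
  have evf: "restrict (ev v) unit_disk = restrict f unit_disk"
    using tc_sums[OF f] by (auto simp: fun_eq_iff ev_def pair_def Rv sums_iff)
  show "restrict f unit_disk \<in> H" using R(1) unfolding evf .
  have "(norm v)\<^sup>2 = (norm (fst v))\<^sup>2 + (norm (snd v))\<^sup>2"
    by (cases v) (simp add: norm_Pair)
  also have "\<dots> = energy (tc f) + energy y" unfolding norm_ell2_energy Rv ..
  finally show "(hnorm ip (restrict f unit_disk))\<^sup>2 = energy (tc f) + energy y"
    using R(2) unfolding evf by simp
qed

section \<open>The norm formula\<close>

text \<open>\<open>l\<close> may be any holomorphic logarithm of the zero-free function
  \<open>a\<close>: only its real part log |a| is matched with the outer representation, and this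
  depends neither on the branch nor on the unimodular constant.\<close>

lemma pythagorean_pair_data:
  assumes pp: "pythagorean_pair b a"
  obtains A l u where "a holomorphic_on unit_disk" "b holomorphic_on unit_disk"
    "\<And>z. cmod z < 1 \<Longrightarrow> cmod (a z) \<le> A" "\<And>z. cmod z < 1 \<Longrightarrow> cmod (b z) \<le> A"
    "l holomorphic_on unit_disk" "\<And>z. cmod z < 1 \<Longrightarrow> a z = exp (l z)" "integrable circ u"
    "\<And>z. cmod z < 1 \<Longrightarrow> 2 * pi * Re (l z) = cint (\<lambda>s. poisson z s * u s)"
    "boundary_pythagorean b a"
proof -
  have a: "a holomorphic_on unit_disk" and b: "b holomorphic_on unit_disk"
    and bd: "bounded (a ` unit_disk)" "bounded (b ` unit_disk)"
    using pp by (auto simp: pythagorean_pair_def hardy_space_inf_def)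
  obtain A1 A2 where "\<forall>x\<in>a ` unit_disk. cmod x \<le> A1" "\<forall>x\<in>b ` unit_disk. cmod x \<le> A2"
    using bd by (auto simp: bounded_iff)
  then have A: "cmod (a z) \<le> max A1 A2" "cmod (b z) \<le> max A1 A2" if "cmod z < 1" for z
    using that by (auto simp: le_max_iff_disj)
  have "outer_function a" using pp by (simp add: pythagorean_pair_def)
  then obtain c :: complex and k :: "real \<Rightarrow> real" where c: "cmod c = 1"
    and ai: "(\<lambda>t. ln (k t)) absolutely_integrable_on {0..2*pi}"
    and aeq: "\<And>z. z \<in> unit_disk \<Longrightarrow> a z = c * exp (1 / (2 * pi) *
        integral {0..2*pi} (\<lambda>t. (cis t + z) / (cis t - z) * of_real (ln (k t))))"
    unfolding outer_function_def by blast
  define u where "u = (\<lambda>t. ln (k t))"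
  have u: "integrable circ u"
    using ai unfolding circ_def u_def absolutely_integrable_on_def set_integrable_def
    by (subst integrable_restrict_space) auto
  have anz: "a z \<noteq> 0" if "z \<in> unit_disk" for z using aeq[OF that] c by auto
  obtain l where l: "l holomorphic_on unit_disk" and el: "\<And>z. z \<in> unit_disk \<Longrightarrow> exp (l z) = a z"
    using holomorphic_logarithm_exists[OF convex_ball open_ball a anz, of 0] by auto
  have outer: "2 * pi * Re (l z) = cint (\<lambda>s. poisson z s * u s)" if z: "cmod z < 1" for z
  proof -
    define h where "h = (\<lambda>t. (cis t + z) / (cis t - z) * of_real (u t))"
    have nz: "cis t - z \<noteq> 0" for t using norm_cis_diff_ge[of z t] z by auto
    have [measurable]: "(\<lambda>t. (cis t + z) / (cis t - z)) \<in> borel_measurable circ"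
      using nz by (intro borel_measurable_integrable circ_intros) auto
    have [measurable]: "u \<in> borel_measurable circ" using u by auto
    have h: "integrable circ h"
    proof (rule Bochner_Integration.integrable_bound)
      show "integrable circ (\<lambda>t. 2 / (1 - cmod z) * u t)" using u by (intro integrable_mult_right) auto
      show "h \<in> borel_measurable circ" unfolding h_def by measurable
      have "cmod ((cis t + z) / (cis t - z)) \<le> 2 / (1 - cmod z)" for t
        using norm_cis_diff_ge[of z t] norm_triangle_ineq[of "cis t" z] z
        unfolding norm_divide by (intro frac_le) auto
      then show "AE t in circ. norm (h t) \<le> norm (2 / (1 - cmod z) * u t)"
        using z unfolding h_def norm_mult by (intro AE_I2 mult_mono) auto
    qed
    have "exp (Re (l z)) = cmod (a z)" using el[of z] z by (simp flip: norm_exp_eq_Re)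
    also have "\<dots> = exp (Re (1 / (2 * pi) * integral {0..2*pi} h))"
      using aeq[of z] z c unfolding h_def u_def by (simp add: norm_mult)
    finally have "Re (l z) = Re (integral {0..2*pi} h) / (2 * pi)" by simp
    also have "integral {0..2*pi} h = cint h" by (rule circ_integral_eq[OF h, symmetric])
    also have "Re (cint h) = cint (\<lambda>t. Re (h t))" by (rule integral_Re[OF h, symmetric])
    also have "(\<lambda>t. Re (h t)) = (\<lambda>t. poisson z t * u t)"
      unfolding h_def poisson_Re[OF z, symmetric] times_complex.sel(1)[of _ "complex_of_real _"] by simp
    finally show ?thesis by simp
  qed
  show thesis
  proof (rule that[OF a b A l _ u outer])
    show "a z = exp (l z)" if "cmod z < 1" for z using el[of z] that by simp
    show "boundary_pythagorean b a"
      using pp unfolding pythagorean_pair_def boundary_pythagorean_def circ_def by blast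
  qed
qed

text \<open>The base changes from \<open>m\<close> to \<open>m + 1\<close> at the cost of
  \<open>2 powr (2 * \<kappa>)\<close>, as \<open>m + 2 \<le> 2 * (m + 1)\<close>. Index 0 is split
  off because \<open>0 powr x\<close> is 0 for every x, so the assumption does not see that
  term.\<close>

lemma weighted_taylor_l2_seq:
  fixes \<kappa> :: real
  assumes \<kappa>: "\<kappa> \<ge> 0" and s: "summable (\<lambda>m. real m powr (2 * \<kappa>) * (cmod (x m))\<^sup>2)"
  shows "l2_seq (wt \<kappa> x)"
proof -
  have "summable (\<lambda>m. 2 powr (2 * \<kappa>) * (real (Suc m) powr (2 * \<kappa>) * (cmod (x (Suc m)))\<^sup>2))"
    using s by (intro summable_mult) (subst summable_Suc_iff)
  then have "summable (\<lambda>m. (cmod (wt \<kappa> x (Suc m)))\<^sup>2)"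
  proof (rule summable_comparison_test'[where N=0])
    show "norm ((cmod (wt \<kappa> x (Suc m)))\<^sup>2) \<le> 2 powr (2 * \<kappa>) * (real (Suc m) powr (2 * \<kappa>) * (cmod (x (Suc m)))\<^sup>2)" for m
    proof -
      have "real (Suc (Suc m)) powr (2 * \<kappa>) \<le> (2 * real (Suc m)) powr (2 * \<kappa>)"
        using \<kappa> by (intro powr_mono2) auto
      also have "\<dots> = 2 powr (2 * \<kappa>) * real (Suc m) powr (2 * \<kappa>)" by (rule powr_mult)
      finally show ?thesis by (simp add: wt_norm_square mult.assoc[symmetric] mult_right_mono del: of_nat_Suc)
    qed
  qed
  then show ?thesis unfolding l2_seq_def by (subst (asm) summable_Suc_iff)
qed

lemma taylor_pairing_summable:
  assumes x: "l2_seq (wt (-\<kappa>) (tc \<phi>))" and f: "l2_seq (wt \<kappa> (tc f))" and \<kappa>: "\<kappa> \<ge> 0"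
  shows "summable (\<lambda>n. cmod (cnj (taylor_coeff \<phi> (int n)) * taylor_coeff f (m + int n)))"
proof (cases "m \<ge> 0")
  case True
  then have "m + int n = int (nat m + n)" for n by simp
  then have "taylor_coeff f (m + int n) = tc f (nat m + n)" for n by (simp only: taylor_coeff_int)
  then show ?thesis
    using weighted_pairing(1)[OF x f \<kappa>, of "nat m"] by (simp add: taylor_coeff_int norm_mult)
next
  case False
  \<comment> \<open>For \<open>m < 0\<close> the first \<open>j\<close> terms vanish by the
    convention on negative indices, leaving a shift on the side of \<phi>. The shifted weight is
    absorbed by n + j + 1 \<le> (j + 1)(n + 1).\<close>
  define j where "j = nat (- m)"
  have "m + int (n + j) = int n" for n using False by (simp add: j_def)
  then have *: "taylor_coeff f (m + int (n + j)) = tc f n" for n by (simp only: taylor_coeff_int)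
  have "l2_seq (\<lambda>n. of_real (real (Suc (n + j)) powr \<kappa>) * tc f n)"
  proof (rule l2_seq_mono(1))
    show "l2_seq (\<lambda>n. of_real (real (Suc j) powr \<kappa>) * wt \<kappa> (tc f) n)"
      by (rule l2_seq_scale[OF f])
    fix n
    have "real (Suc (n + j)) powr \<kappa> \<le> (real (Suc j) * real (Suc n)) powr \<kappa>"
      using \<kappa> by (intro powr_mono2) (auto simp: algebra_simps)
    also have "\<dots> = real (Suc j) powr \<kappa> * real (Suc n) powr \<kappa>" by (rule powr_mult)
    finally show "cmod (of_real (real (Suc (n + j)) powr \<kappa>) * tc f n) \<le> cmod (of_real (real (Suc j) powr \<kappa>) * wt \<kappa> (tc f) n)"
      by (simp add: wt_def norm_mult mult.assoc[symmetric] mult_right_mono del: of_nat_Suc)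
  qed
  from l2_Cauchy_Schwarz(1)[OF l2_seq_shift(1)[OF x, of j] this]
  have "summable (\<lambda>n. cmod (wt (-\<kappa>) (tc \<phi>) (j + n) * (of_real (real (Suc (n + j)) powr \<kappa>) * tc f n)))" .
  moreover have "wt (-\<kappa>) (tc \<phi>) (j + n) * (of_real (real (Suc (n + j)) powr \<kappa>) * tc f n) = tc \<phi> (n + j) * tc f n" for n
    using wt_inverse_mult[of \<kappa> "tc \<phi>" "n + j" "\<lambda>_. tc f n"] by (simp add: wt_def add.commute)
  ultimately have "summable (\<lambda>n. cmod (tc \<phi> (n + j) * tc f n))" by (simp only:)
  then have "summable (\<lambda>n. cmod (cnj (taylor_coeff \<phi> (int (n + j))) * taylor_coeff f (m + int (n + j))))"
    unfolding * by (simp only: taylor_coeff_int norm_mult complex_mod_cnj)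
  then show ?thesis by (subst (asm) summable_iff_shift)
qed

theorem theorem4p1:
  fixes p :: real and a b f \<phi> :: "complex \<Rightarrow> complex"
  assumes "0 < p" and "p \<le> 2"
    and "pythagorean_pair b a"
    and "\<phi> = (\<lambda>z. b z / a z)"
    and "\<phi> \<in> hardy_space p"
    and "f holomorphic_on unit_disk"
    and "summable (\<lambda>m::nat. real m powr (2 / p - 1) * (cmod (taylor_coeff f (int m)))\<^sup>2)"
  shows "(\<forall>m::int. summable (\<lambda>n::nat.
            cmod (cnj (taylor_coeff \<phi> (int n)) * taylor_coeff f (m + int n)))) \<and>
         (summable (\<lambda>m::nat.
            (cmod (\<Sum>n::nat. cnj (taylor_coeff \<phi> (int n)) * taylor_coeff f (int m + int n)))\<^sup>2) \<longrightarrow>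
          (\<forall>H ip. is_de_branges_rovnyak_space b H ip \<longrightarrow>
            restrict f unit_disk \<in> H \<and>
            (hnorm ip (restrict f unit_disk))\<^sup>2 =
              (\<Sum>m::nat. (cmod (taylor_coeff f (int m)))\<^sup>2) +
              (\<Sum>m::nat. (cmod (\<Sum>n::nat. cnj (taylor_coeff \<phi> (int n)) *
                 taylor_coeff f (int m + int n)))\<^sup>2)))"
proof -
  note p = assms(1,2) and \<phi>_def = assms(4) and f = assms(6)
  obtain A l u where a: "a holomorphic_on unit_disk" and b: "b holomorphic_on unit_disk"
    and aA: "\<And>z. cmod z < 1 \<Longrightarrow> cmod (a z) \<le> A" and bA: "\<And>z. cmod z < 1 \<Longrightarrow> cmod (b z) \<le> A"
    and l: "l holomorphic_on unit_disk" and el: "\<And>z. cmod z < 1 \<Longrightarrow> a z = exp (l z)" and u: "integrable circ u"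
    and outer: "\<And>z. cmod z < 1 \<Longrightarrow> 2 * pi * Re (l z) = cint (\<lambda>s. poisson z s * u s)"
    and bdry: "boundary_pythagorean b a"
    by (rule pythagorean_pair_data[OF assms(3)]) (rule that; assumption)
  have \<phi>: "\<phi> holomorphic_on unit_disk" using assms(5) by (simp add: hardy_space_def)
  obtain M where M: "\<And>r. r \<in> {0..<1} \<Longrightarrow>
      1 / (2 * pi) * integral {0..2*pi} (\<lambda>t. cmod (\<phi> (of_real r * cis t)) powr p) \<le> M"
    using assms(5) unfolding hardy_space_def mem_Collect_eq by blast
  have means: "cint (\<lambda>t. cmod (b (of_real r * cis t) / a (of_real r * cis t)) powr p) \<le> 2 * pi * M"
    if r: "0 \<le> r" "r < 1" for r
  proof -
    have "continuous_on {0..2*pi} (\<lambda>t. cmod (\<phi> (of_real r * cis t)) powr p)"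
      by (intro continuous_on_powr' continuous_intros continuous_on_circle \<phi> r) (use p in auto)
    from circ_integral_eq[OF integrable_circ_continuous[OF this]] M[of r] r
    show ?thesis by (simp add: \<phi>_def field_simps)
  qed
  \<comment> \<open>Half of 2/p - 1, because \<open>l2_seq\<close> squares the weight; it is
    nonnegative exactly since p \<le> 2.\<close>
  define \<kappa> where "\<kappa> = (2 / p - 1) / 2"
  have \<kappa>: "\<kappa> \<ge> 0" and s1: "2 / p \<ge> 1" using p by (auto simp: \<kappa>_def field_simps)
  define g where "g = (\<lambda>z. exp (- of_real (p / 2) * l z))"
  have g: "g holomorphic_on unit_disk" unfolding g_def by (intro holomorphic_intros l)
  have sg: "l2_seq (tc g)"
    unfolding g_def by (rule outer_power_l2_seq[OF l b el aA bA u outer bdry p means])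
  define h where "h = (\<lambda>z. exp (- l z))"
  have h: "h holomorphic_on unit_disk" unfolding h_def by (intro holomorphic_intros l)
  \<comment> \<open>The factors 2/p and - p/2 multiply to -1, so the power 2/p of \<open>g\<close>
    is 1/a.\<close>
  have "l2_seq (wt (- ((2 / p - 1) / 2)) (tc (\<lambda>z. exp (of_real (2 / p) * (- of_real (p / 2) * l z)))))"
    by (rule hardy_littlewood_exp[OF _ s1 sg[unfolded g_def]]) (intro holomorphic_intros l)
  moreover have "of_real (2 / p) * (- of_real (p / 2) * l z) = - l z" for z
    using p by (simp add: mult.assoc[symmetric] of_real_mult[symmetric] del: of_real_mult of_real_divide)
  ultimately have sh: "l2_seq (wt (-\<kappa>) (tc h))" by (simp only: \<kappa>_def h_def)
  have s\<phi>: "l2_seq (wt (-\<kappa>) (tc \<phi>))"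
  proof (rule weighted_domination(1)[OF h \<phi> _ \<kappa> sh])
    fix z :: complex assume z: "cmod z < 1"
    have "cmod (\<phi> z) = cmod (b z) * cmod (h z)"
      unfolding \<phi>_def h_def el[OF z] by (simp add: norm_mult exp_minus divide_inverse)
    also have "\<dots> \<le> A * cmod (h z)" by (intro mult_right_mono bA z) auto
    finally show "cmod (\<phi> z) \<le> A * cmod (h z)" .
  qed
  have "summable (\<lambda>m. real m powr (2 * \<kappa>) * (cmod (tc f m))\<^sup>2)"
  proof -
    have "2 * \<kappa> = 2 / p - 1" unfolding \<kappa>_def times_divide_eq_right by (rule nonzero_mult_div_cancel_left) simp
    then show ?thesis using assms(7) by (simp only: taylor_coeff_int)
  qed
  from weighted_taylor_l2_seq[OF \<kappa> this] have swf: "l2_seq (wt \<kappa> (tc f))" .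
  have sf: "l2_seq (tc f)"
  proof (rule l2_seq_mono(1)[OF swf])
    show "cmod (tc f n) \<le> cmod (wt \<kappa> (tc f) n)" for n
      using \<kappa> ge_one_powr_ge_zero[of "real (Suc n)" \<kappa>]
      by (simp add: wt_def norm_mult mult_le_cancel_right1 del: of_nat_Suc)
  qed
  define y where "y = (\<lambda>m. \<Sum>n. cnj (tc \<phi> n) * tc f (m + n))"
  have yt: "(\<Sum>n. cnj (taylor_coeff \<phi> (int n)) * taylor_coeff f (int m + int n)) = y m" for m
    by (simp only: y_def taylor_coeff_int of_nat_add[symmetric])
  have a_inj: "z = (\<lambda>_. 0)" if z: "l2_seq z" "\<And>m. (\<Sum>k. cnj (tc a k) * z (m + k)) = 0" for z
  proof -
    \<comment> \<open>From 1/N \<le> p/2 follows |a^(-1/N)| = |a|^\<theta> |g| with \<theta> \<ge>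
      0, so the bounded factor |a|^\<theta> lets a^(-1/N) inherit membership in H^2 from
      \<open>g\<close>.\<close>
    define N where "N = nat \<lceil>2 / p\<rceil>"
    have N: "real N \<ge> 2 / p" unfolding N_def by (rule real_nat_ceiling_ge)
    with s1 have "real N \<ge> 1" by linarith
    then have N0: "N > 0" by simp
    define \<theta> where "\<theta> = p / 2 - 1 / real N"
    have \<theta>: "0 \<le> \<theta>" "\<theta> \<le> 1"
    proof -
      show "0 \<le> \<theta>" using N N0 p by (simp add: \<theta>_def field_simps)
      have "0 \<le> 1 / real N" by simp
      with p show "\<theta> \<le> 1" unfolding \<theta>_def by linarith
    qed
    have v: "(\<lambda>z. exp (- of_real (1 / real N) * l z)) holomorphic_on unit_disk"
      by (intro holomorphic_intros l)
    have dom: "cmod (exp (- of_real (1 / real N) * l w)) \<le> max 1 A * cmod (g w)" if w: "cmod w < 1" for w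
    proof -
      have "cmod (exp (- of_real (1 / real N) * l w)) = exp (\<theta> * Re (l w)) * cmod (g w)"
        by (simp add: g_def \<theta>_def exp_add[symmetric] algebra_simps)
      also have "\<dots> \<le> max 1 A * cmod (g w)"
        using exp_scaled_bound[OF \<theta>, of "Re (l w)" A] aA[OF w] el[OF w] by (intro mult_right_mono) auto
      finally show ?thesis .
    qed
    have sv: "l2_seq (tc (\<lambda>z. exp (- of_real (1 / real N) * l z)))"
      using weighted_domination(1)[OF g v dom, of 0] sg by simp
    have ta: "tc a = tc (\<lambda>z. exp (l z))" by (rule tc_cong) (rule el)
    show ?thesis
      by (rule ext, rule coanalytic_toeplitz_exp_injective[OF l _ N0 sv z(1) z(2)[unfolded ta]])
        (use aA el in auto)
  qed
  have main: "restrict f unit_disk \<in> H \<and> (hnorm ip (restrict f unit_disk))\<^sup>2 = energy (tc f) + energy y"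
    if sy: "l2_seq y" and dBR: "is_de_branges_rovnyak_space b H ip" for H ip
  proof -
    have tb: "tc (\<lambda>z. a z * \<phi> z) = tc b" by (rule tc_cong) (simp add: \<phi>_def el)
    have rel: "(\<Sum>k. cnj (tc a k) * y (m + k)) = (\<Sum>k. cnj (tc b k) * tc f (m + k))" for m
      using coanalytic_toeplitz_product[OF a \<phi> aA s\<phi> swf \<kappa> sy[unfolded y_def], of m]
      by (simp only: tb y_def)
    show ?thesis
      by (intro conjI de_branges_rovnyak_membership[OF a b aA bA bdry a_inj f sf sy rel dBR])
  qed
  show ?thesis
    unfolding yt
  proof (intro conjI allI impI)
    show "summable (\<lambda>n. cmod (cnj (taylor_coeff \<phi> (int n)) * taylor_coeff f (m + int n)))" for m
      by (rule taylor_pairing_summable[OF s\<phi> swf \<kappa>])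
    fix H ip
    assume "summable (\<lambda>m. (cmod (y m))\<^sup>2)" and dBR: "is_de_branges_rovnyak_space b H ip"
    then have "l2_seq y" by (simp only: l2_seq_def)
    note D = main[OF this dBR]
    show "restrict f unit_disk \<in> H" using D by (rule conjunct1)
    show "(hnorm ip (restrict f unit_disk))\<^sup>2 =
        (\<Sum>m. (cmod (taylor_coeff f (int m)))\<^sup>2) + (\<Sum>m. (cmod (y m))\<^sup>2)"
      using conjunct2[OF D] by (simp only: energy_def taylor_coeff_int)
  qed
qed

end
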